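(* Let $Q\in\mathcal K_o^{1,m}$ and let $L\subset M_{n,m}$ be a compact domain with positive volume. If $\Gamma_{Q,\infty}L$ is in Santaló position or is centered, then \[ \mathrm{vol}_{nm}(L)^{1/m}\,\mathrm{vol}_n(\Gamma^\circ_{Q,\infty}L)\le\mathrm{vol}_n(B_2^n)\,\mathrm{vol}_{nm}(\Pi^\circ_{Q,\infty}B_2^n)^{1/m}. \]
   Context: $M_{k,l}$: real $k\times l$ matrices with inner product $\langle A,B\rangle=\mathrm{tr}(A^t.B)$, identified with $\mathbb R^{kl}$; $A.B$ matrix product; $\mathbb R^n\cong M_{n,1}$, $\mathbb R^m\cong M_{1,m}$. $\mathcal K_o^{1,m}$: convex bodies in $M_{1,m}$ containing the origin. $h_G(x)=\sup_{y\in G}\langle y,x\rangle$, $G^\circ=\{x:h_G(x)\le1\}$. For compact $L\subset M_{n,m}$ of positive volume, $\Gamma_{Q,\infty}L$ is the convex body in $M_{n,1}$ with $h_{\Gamma_{Q,\infty}L}(\xi)=\max_{x\in L}h_Q(\xi^t.x)$, and $\Gamma^\circ_{Q,\infty}L=(\Gamma_{Q,\infty}L)^\circ$. $\Pi_{Q,\infty}B_2^n$ is the convex body in $M_{n,m}$ with $h(x)=\max_{v\in B_2^n}h_Q(v^t.x)$ and $\Pi^\circ_{Q,\infty}B_2^n$ its polar. A convex body $K$ is centered if its center of mass is the origin, and in Santaló position if the origin is the unique point $z\in\mathrm{int}K$ minimizing $\mathrm{vol}((K-z)^\circ)$. $B_2^n$ is the Euclidean unit ball. *)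

theory Defs
  imports "HOL-Analysis.Analysis"
begin

text \<open>Matrices in M_{k,l} are represented as real^'l^'k (k rows, l columns); the
inner product on this type is the Frobenius product tr(A^t B).
M_{n,1} is real^'n, M_{1,m} is real^'m, and xi^t . x is  xi v* x.\<close>

definition convex_body :: "'a::euclidean_space set \<Rightarrow> bool" where
  "convex_body K \<longleftrightarrow> compact K \<and> convex K \<and> interior K \<noteq> {}"

definition support_fun :: "'a::real_inner set \<Rightarrow> 'a \<Rightarrow> real" where
  "support_fun G x = (SUP y\<in>G. y \<bullet> x)"

definition polar_body :: "'a::real_inner set \<Rightarrow> 'a set" where
  "polar_body G = {x. support_fun G x \<le> 1}"

definition vol :: "'a::euclidean_space set \<Rightarrow> real" where
  "vol S = measure lebesgue S"

text \<open>Gamma_{Q,infty} L: the convex body in M_{n,1} with support function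
 xi \<mapsto> max_{x in L} h_Q(xi^t . x).\<close>
definition Gamma_inf :: "(real^'m) set \<Rightarrow> (real^'m^'n) set \<Rightarrow> (real^'n) set" where
  "Gamma_inf Q L = {z. \<forall>\<xi>. z \<bullet> \<xi> \<le> (SUP x\<in>L. support_fun Q (\<xi> v* x))}"

text \<open>Pi_{Q,infty} B_2^n: the convex body in M_{n,m} with support function
 x \<mapsto> max_{v in B_2^n} h_Q(v^t . x).\<close>
definition Pi_inf_ball :: "(real^'m) set \<Rightarrow> (real^'m^'n) set" where
  "Pi_inf_ball Q = {z. \<forall>x. z \<bullet> x \<le> (SUP v\<in>(cball (0::real^'n) 1). support_fun Q (v v* x))}"

definition centered :: "'a::euclidean_space set \<Rightarrow> bool" where
  "centered K \<longleftrightarrow> integral K (\<lambda>x. x) /\<^sub>R vol K = 0"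

definition santalo_position :: "'a::euclidean_space set \<Rightarrow> bool" where
  "santalo_position K \<longleftrightarrow> 0 \<in> interior K \<and>
     (\<forall>z\<in>interior K. vol (polar_body K) \<le> vol (polar_body ((\<lambda>x. x - z) ` K))) \<and>
     (\<forall>z\<in>interior K. vol (polar_body ((\<lambda>x. x - z) ` K)) = vol (polar_body K) \<longrightarrow> z = 0)"

end

theory Submission
  imports Defs
begin

text \<open>Write \<open>K\<close> for the body \<open>Gamma_inf Q L\<close> and \<open>F(K)\<close> for the volume of the set of matrices
  \<open>x\<close> with \<open>xQ \<subseteq> K\<close>. This set contains \<open>L\<close>, and it is the polar of \<open>Pi_inf_ball Q\<close> when \<open>K\<close>
  is the Euclidean unit ball. Two inequalities then give the result: \<open>F\<close> is largest on balls
  among convex bodies of given volume, and \<open>vol K \<cdot> vol (polar_body K) \<le> vol (cball 0 1)\<^sup>2\<close>.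

  The first holds because Steiner symmetrization does not change volume and does not decrease \<open>F\<close>: the
  sections of the set of \<open>x\<close> along one row become sets \<open>T'\<close> with \<open>(T - T) / 2 \<subseteq> T'\<close>,
  so Brunn-Minkowski applies. Finitely many symmetrizations bring \<open>K\<close> into any ball slightly larger
  than the one of volume \<open>vol K\<close>, since a convex body of smaller volume than a ball containing it
  misses a cap of that ball, and the mirror images of this cap cover the sphere.

  The second is obtained from its functional version, by Lehec's induction on the dimension: cut by a
  hyperplane at the median, shear so that both halves have their barycentre over the origin, and apply
  the one-dimensional Prekopa-Leindler inequality on half lines.\<close>

section \<open>Prekopa-Leindler inequality\<close>

text \<open>In the functional inequality the two functions play different roles. The cut and the
  shear are made for the function that carries no barycentre condition. Moving it by a vector z
  multiplies its partner by exp (z . x), and since exp u >= 1 + u this cannot lower the integral of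
  a partner whose barycentre is the origin. The linear part of the shear is compensated by its
  inverse transpose, which keeps inner products and volumes.

  Both alternatives in the hypothesis lead to the same inequality for bodies. A centered body has
  its own barycentre at the origin; for a body in Santalo position the vanishing derivative of the
  volume of the polar puts the barycentre of the polar there; and the product of volumes is
  symmetric in the two bodies.

  The Gaussian constants occur identically for the unit ball, which is its own polar, and cancel.
  \<open>F\<close> is homogeneous of degree nm, so comparison with the ball of equal volume gives
  the m-th power of the volume ratio, of which the m-th root remains.\<close>

lemma brunn_minkowski_real_bounded:
  fixes A B C :: "real set"
  assumes A: "A \<noteq> {}" "bounded A" "A \<in> sets borel" and B: "B \<noteq> {}" "bounded B" "B \<in> sets borel"
    and C: "C \<in> sets borel" and mid: "\<And>a b. a \<in> A \<Longrightarrow> b \<in> B \<Longrightarrow> (a + b) / 2 \<in> C"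
  shows "emeasure lborel A + emeasure lborel B \<le> 2 * emeasure lborel C"
proof (rule ennreal_le_epsilon)
  fix e :: real assume e: "0 < e"
  have bA: "bdd_above A" and bB: "bdd_below B"
    using A B by (auto simp: bounded_imp_bdd_above bounded_imp_bdd_below)
  obtain a where a: "a \<in> A" "Sup A - e/2 < a"
    using less_cSup_iff[OF A(1) bA, of "Sup A - e/2"] e by auto
  obtain b where b: "b \<in> B" "b < Inf B + e/2"
    using cInf_less_iff[OF B(1) bB, of "Inf B + e/2"] e by auto
  have aff: "emeasure lborel (((\<lambda>x. (x - t) * 2) -` S)) = emeasure lborel S / 2"
    if "S \<in> sets borel" for S :: "real set" and t
  proof -
    have "emeasure lborel S = (\<integral>\<^sup>+x. indicator S x \<partial>lborel)" using that by simp
    also have "\<dots> = ennreal \<bar>2\<bar> * (\<integral>\<^sup>+x. indicator S (- 2 * t + 2 * x) \<partial>lborel)"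
      using that by (intro nn_integral_real_affine) auto
    also have "(\<integral>\<^sup>+x. indicator S (- 2 * t + 2 * x) \<partial>lborel)
        = (\<integral>\<^sup>+x. indicator (((\<lambda>x. (x - t) * 2) -` S)) x \<partial>lborel)"
      by (intro nn_integral_cong) (auto simp: indicator_def algebra_simps)
    also have "\<dots> = emeasure lborel (((\<lambda>x. (x - t) * 2) -` S))"
      using that measurable_sets_borel[of "\<lambda>x. (x - t) * 2" borel S] by (intro nn_integral_indicator) auto
    finally show ?thesis by (simp add: mult.commute[of 2] mult_divide_eq_ennreal)
  qed
  \<comment> \<open>These are the midpoint sets (A + b)/2 and (a + B)/2 inside \<open>C\<close>. As
    \<open>a\<close> is almost the supremum of \<open>A\<close> and \<open>b\<close> almost the
    infimum of \<open>B\<close>, the first lies essentially to the left of the second, so their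
    measures add up to an error of \<open>e/2\<close>. Preimages are used because they are visibly
    Borel; the set of all midpoints need not be.\<close>
  define A' where "A' = (\<lambda>x. (x - b/2) * 2) -` A"
  define B' where "B' = (\<lambda>x. (x - a/2) * 2) -` B"
  have m[measurable]: "A' \<in> sets borel" "B' \<in> sets borel"
    unfolding A'_def B'_def
    using measurable_sets_borel[of "\<lambda>x. (x - b/2) * 2" borel A] measurable_sets_borel[of "\<lambda>x. (x - a/2) * 2" borel B] A B by auto
  have sub: "A' \<union> B' \<subseteq> C"
  proof
    fix x assume "x \<in> A' \<union> B'"
    then show "x \<in> C"
      using mid[of "(x - b/2)*2" b] mid[of a "(x - a/2)*2"] a b by (auto simp: A'_def B'_def)
  qed
  have int: "A' \<inter> B' \<subseteq> {(a + Inf B) / 2 .. (Sup A + b)/2}"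
  proof
    fix x assume "x \<in> A' \<inter> B'"
    then have "(x - b/2)*2 \<le> Sup A" "Inf B \<le> (x - a/2)*2"
      using cSup_upper[OF _ bA] cInf_lower[OF _ bB] by (auto simp: A'_def B'_def)
    then show "x \<in> {(a + Inf B) / 2 .. (Sup A + b)/2}" by (auto simp: field_simps)
  qed
  have "emeasure lborel (A' \<inter> B') \<le> emeasure lborel {(a + Inf B) / 2 .. (Sup A + b)/2}"
    by (intro emeasure_mono int) auto
  also have "\<dots> \<le> ennreal (e/2)"
    using a b by (auto intro!: ennreal_leI simp: emeasure_lborel_Icc_eq field_simps)
  finally have i: "emeasure lborel (A' \<inter> B') \<le> ennreal (e/2)" .
  have "emeasure lborel A' + emeasure lborel B' = emeasure lborel (A' \<union> B') + emeasure lborel (A' \<inter> B')"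
    by (rule emeasure_Un_Int) auto
  also have "\<dots> \<le> emeasure lborel C + ennreal (e/2)"
    using i sub C by (intro add_mono emeasure_mono) auto
  finally have "2 * (emeasure lborel A' + emeasure lborel B') \<le> 2 * (emeasure lborel C + ennreal (e/2))"
    by (intro mult_left_mono) auto
  moreover have "2 * emeasure lborel A' = emeasure lborel A" "2 * emeasure lborel B' = emeasure lborel B"
    unfolding A'_def B'_def aff[OF A(3)] aff[OF B(3)]
    by (simp_all add: ennreal_times_divide mult.commute[of 2] mult_divide_eq_ennreal)
  moreover have "2 * ennreal (e/2) = ennreal e" using e
    by (metis ennreal_mult' ennreal_numeral field_sum_of_halves less_eq_real_def mult_2 zero_le_numeral)
  ultimately show "emeasure lborel A + emeasure lborel B \<le> 2 * emeasure lborel C + ennreal e"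
    by (simp add: distrib_left)
qed

lemma brunn_minkowski_real:
  fixes A B C :: "real set"
  assumes A: "A \<noteq> {}" "A \<in> sets borel" and B: "B \<noteq> {}" "B \<in> sets borel"
    and C: "C \<in> sets borel" and mid: "\<And>a b. a \<in> A \<Longrightarrow> b \<in> B \<Longrightarrow> (a + b) / 2 \<in> C"
  shows "emeasure lborel A + emeasure lborel B \<le> 2 * emeasure lborel C"
proof -
  obtain a b where ab: "a \<in> A" "b \<in> B" using A B by auto
  \<comment> \<open>Widening every truncation by \<open>c\<close> keeps \<open>a\<close> and
    \<open>b\<close> inside for all \<open>k\<close>, so the truncated sets are never empty.\<close>
  define c where "c = \<bar>a\<bar> + \<bar>b\<bar>"
  have c: "0 \<le> c" by (simp add: c_def)
  define S where "S T k = T \<inter> {- (real k + c) .. real k + c}" for T k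
  have lim: "(SUP k. emeasure lborel (S T k)) = emeasure lborel T" if "T \<in> sets borel" for T
  proof -
    have "(SUP k. emeasure lborel (S T k)) = emeasure lborel (\<Union>k. S T k)"
      using that by (intro SUP_emeasure_incseq) (auto simp: S_def incseq_def)
    also have "(\<Union>k. S T k) = T"
    proof -
      have "\<exists>k. x \<in> S T k" if "x \<in> T" for x
      proof -
        obtain k :: nat where "\<bar>x\<bar> \<le> real k" using real_arch_simple by blast
        then show ?thesis using that c by (auto simp: S_def abs_le_iff intro!: exI[of _ k])
      qed
      then show ?thesis by (auto simp: S_def)
    qed
    finally show ?thesis .
  qed
  have mono: "incseq (\<lambda>k. emeasure lborel (S T k))" if "T \<in> sets borel" for T
    using that by (intro monoI emeasure_mono) (auto simp: S_def)
  have 1: "(SUP k. emeasure lborel (S A k) + emeasure lborel (S B k)) = emeasure lborel A + emeasure lborel B"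
    unfolding ennreal_SUP_add[OF mono[OF A(2)] mono[OF B(2)]] lim[OF A(2)] lim[OF B(2)] ..
  have "emeasure lborel (S A k) + emeasure lborel (S B k) \<le> 2 * emeasure lborel C" for k
  proof (rule brunn_minkowski_real_bounded)
    have "\<bar>a\<bar> \<le> real k + c" "\<bar>b\<bar> \<le> real k + c" by (simp_all add: c_def add_increasing)
    then have "a \<in> S A k" "b \<in> S B k" using ab by (simp_all add: S_def abs_le_iff)
    then show "S A k \<noteq> {}" "S B k \<noteq> {}" by blast+
    show "bounded (S A k)" "bounded (S B k)" unfolding S_def by (simp_all add: bounded_Int)
    show "(x + y) / 2 \<in> C" if "x \<in> S A k" "y \<in> S B k" for x y
      using that mid by (simp add: S_def)
  qed (use A B C in \<open>simp_all add: S_def\<close>)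
  then have "(SUP k. emeasure lborel (S A k) + emeasure lborel (S B k)) \<le> 2 * emeasure lborel C"
    by (rule SUP_least)
  then show ?thesis unfolding 1 .
qed

lemma nn_integral_layer_cake:
  fixes f :: "real \<Rightarrow> real"
  assumes [measurable]: "f \<in> borel_measurable borel" and f: "\<And>x. 0 \<le> f x"
  shows "(\<integral>\<^sup>+x. f x \<partial>lborel) = (\<integral>\<^sup>+t. indicator {0<..} t * emeasure lborel {x. t < f x} \<partial>lborel)"
proof -
  have "(\<integral>\<^sup>+x. f x \<partial>lborel) = (\<integral>\<^sup>+x. (\<integral>\<^sup>+t. indicator {0<..<f x} t \<partial>lborel) \<partial>lborel)"
    using f by (intro nn_integral_cong) simp
  also have "\<dots> = (\<integral>\<^sup>+x. (\<integral>\<^sup>+t. indicator {0<..} t * indicator {x. t < f x} x \<partial>lborel) \<partial>lborel)"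
    by (intro nn_integral_cong) (auto simp: indicator_def)
  also have "\<dots> = (\<integral>\<^sup>+t. (\<integral>\<^sup>+x. indicator {0<..} t * indicator {x. t < f x} x \<partial>lborel) \<partial>lborel)"
    by (rule lborel_pair.Fubini') measurable
  also have "\<dots> = (\<integral>\<^sup>+t. indicator {0<..} t * emeasure lborel {x. t < f x} \<partial>lborel)"
    by (subst nn_integral_cmult) auto
  finally show ?thesis .
qed

text \<open>Brunn-Minkowski compares superlevel sets only while both are nonempty, so the bounded
  functions \<open>f\<close> and \<open>g\<close> are scaled to supremum 1 and \<open>h\<close> by
  the geometric mean \<open>c\<close>. Integration over the levels then bounds the sum of the
  normalised integrals, and the arithmetic-geometric mean inequality turns the sum into a
  product.\<close>

lemma prekopa_leindler_real_bounded:
  fixes f g h :: "real \<Rightarrow> real"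
  assumes [measurable]: "f \<in> borel_measurable borel" "g \<in> borel_measurable borel" "h \<in> borel_measurable borel"
    and f: "\<And>x. 0 \<le> f x" and g: "\<And>x. 0 \<le> g x" and h: "\<And>x. 0 \<le> h x"
    and bf: "bdd_above (range f)" and bg: "bdd_above (range g)"
    and fgh: "\<And>x y. f x * g y \<le> (h ((x + y) / 2))\<^sup>2"
  shows "(\<integral>\<^sup>+x. f x \<partial>lborel) * (\<integral>\<^sup>+x. g x \<partial>lborel) \<le> (\<integral>\<^sup>+x. h x \<partial>lborel)\<^sup>2"
proof -
  define a where "a = (SUP x. f x)"
  define b where "b = (SUP x. g x)"
  have fa: "f x \<le> a" and gb: "g x \<le> b" for x
    unfolding a_def b_def using bf bg by (auto intro: cSUP_upper)
  have a0: "0 \<le> a" and b0: "0 \<le> b" using fa gb f g order_trans by blast+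
  show ?thesis
  proof (cases "a = 0 \<or> b = 0")
    case True
    then have "(\<forall>x. f x = 0) \<or> (\<forall>x. g x = 0)" using fa gb f g by (auto simp: order_antisym)
    then show ?thesis by auto
  next
    case False
    with a0 b0 have ab: "0 < a" "0 < b" by auto
    define c where "c = sqrt (a * b)"
    have c: "0 < c" using ab by (simp add: c_def)
    have scale: "(\<integral>\<^sup>+x. p x \<partial>lborel) = ennreal d * (\<integral>\<^sup>+x. p x / d \<partial>lborel)"
      if [measurable]: "p \<in> borel_measurable borel" and "0 < d" for p :: "real \<Rightarrow> real" and d
      using that by (subst nn_integral_cmult[symmetric]) (auto simp: ennreal_mult'[symmetric])
    define F where "F = (\<integral>\<^sup>+x. f x / a \<partial>lborel)"
    define G where "G = (\<integral>\<^sup>+x. g x / b \<partial>lborel)"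
    define H where "H = (\<integral>\<^sup>+x. h x / c \<partial>lborel)"
    have lev: "emeasure lborel {x. t < f x / a} + emeasure lborel {x. t < g x / b} \<le> 2 * emeasure lborel {x. t < h x / c}"
      if t: "0 < t" "t < 1" for t
    proof (rule brunn_minkowski_real)
      have "a * t < a" "b * t < b" using ab t by auto
      then obtain x y where "a * t < f x" "b * t < g y"
        unfolding a_def b_def using less_cSUP_iff[OF _ bf] less_cSUP_iff[OF _ bg] by auto
      then show "{x. t < f x / a} \<noteq> {}" "{x. t < g x / b} \<noteq> {}" using ab by (auto simp: field_simps)
      fix x y assume "x \<in> {x. t < f x / a}" "y \<in> {x. t < g x / b}"
      then have "t * a < f x" "t * b < g y" using ab by (auto simp: field_simps)
      moreover have "0 < t * a" "0 < t * b" using ab t by auto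
      ultimately have "(t * a) * (t * b) < f x * g y" by (intro mult_strict_mono) linarith+
      also have "\<dots> \<le> (h ((x + y) / 2))\<^sup>2" by (rule fgh)
      finally have "(t * c)\<^sup>2 < (h ((x + y) / 2))\<^sup>2" using ab by (simp add: c_def power_mult_distrib power2_eq_square algebra_simps)
      then have "t * c < h ((x + y)/2)" using h power_less_imp_less_base by blast
      then show "(x + y) / 2 \<in> {x. t < h x / c}" using c by (simp add: field_simps)
    qed (auto)
    have one: "emeasure lborel {x. t < f x / a} = 0" "emeasure lborel {x. t < g x / b} = 0" if "1 \<le> t" for t
    proof -
      have "f x / a \<le> t" "g x / b \<le> t" for x
        using fa[of x] gb[of x] ab that by (auto intro!: order_trans[of _ 1 t])
      then have "{x. t < f x / a} = {}" "{x. t < g x / b} = {}" by (auto simp: not_less)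
      then show "emeasure lborel {x. t < f x / a} = 0" "emeasure lborel {x. t < g x / b} = 0" by simp_all
    qed
    have meas: "(\<lambda>t. emeasure lborel {x. t < p x}) \<in> borel_measurable borel" if [measurable]: "p \<in> borel_measurable borel" for p :: "real \<Rightarrow> real"
    proof -
      have "(\<lambda>t. \<integral>\<^sup>+x. indicator {x. t < p x} x \<partial>lborel) \<in> borel_measurable borel" by measurable
      then show ?thesis by simp
    qed
    note [measurable] = meas[of "\<lambda>x. f x / a"] meas[of "\<lambda>x. g x / b"] meas[of "\<lambda>x. h x / c"]
    have "F + G = (\<integral>\<^sup>+t. indicator {0<..} t * emeasure lborel {x. t < f x / a} + indicator {0<..} t * emeasure lborel {x. t < g x / b} \<partial>lborel)"
      unfolding F_def G_def using f g ab by (subst nn_integral_add) (auto simp: nn_integral_layer_cake)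
    also have "\<dots> \<le> (\<integral>\<^sup>+t. 2 * (indicator {0<..} t * emeasure lborel {x. t < h x / c}) \<partial>lborel)"
    proof (intro nn_integral_mono)
      fix t :: real
      show "indicator {0<..} t * emeasure lborel {x. t < f x / a} + indicator {0<..} t * emeasure lborel {x. t < g x / b}
          \<le> 2 * (indicator {0<..} t * emeasure lborel {x. t < h x / c})"
        using lev[of t] one[of t] by (cases "t < 1") (auto simp: indicator_def)
    qed
    also have "\<dots> = 2 * H"
      unfolding H_def using h c by (subst nn_integral_cmult) (auto simp: nn_integral_layer_cake)
    finally have FG: "F + G \<le> 2 * H" .
    have "F * G \<le> H\<^sup>2"
    proof (cases "H = top")
      case True then show ?thesis by (simp add: power2_eq_square ennreal_top_mult)
    next
      case False
      then obtain hh where hh: "H = ennreal hh" "0 \<le> hh" by (metis ennreal_cases)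
      have FG': "F + G \<le> ennreal (2 * hh)" using FG hh by (simp add: ennreal_mult')
      have "F \<noteq> top" "G \<noteq> top" using FG' by (auto simp: top_unique)
      then obtain p q where pq: "F = ennreal p" "0 \<le> p" "G = ennreal q" "0 \<le> q"
        by (cases F; cases G) auto
      have "p + q \<le> 2 * hh"
        using FG' pq hh by (simp add: ennreal_plus[symmetric] del: ennreal_plus)
      then have "(p + q)\<^sup>2 \<le> (2 * hh)\<^sup>2" using pq by (intro power_mono) auto
      moreover have "0 \<le> (p - q)\<^sup>2" by simp
      ultimately have "p * q \<le> hh\<^sup>2" by (simp add: power2_eq_square algebra_simps)
      then show ?thesis using pq hh by (simp add: ennreal_mult'[symmetric] ennreal_power)
    qed
    then have "ennreal (a * b) * (F * G) \<le> ennreal (a * b) * H\<^sup>2" by (rule mult_left_mono) auto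
    moreover have "ennreal (a * b) = (ennreal c)\<^sup>2" using ab by (simp add: c_def ennreal_power)
    moreover have "(\<integral>\<^sup>+x. f x \<partial>lborel) = ennreal a * F" "(\<integral>\<^sup>+x. g x \<partial>lborel) = ennreal b * G" "(\<integral>\<^sup>+x. h x \<partial>lborel) = ennreal c * H"
      unfolding F_def G_def H_def using ab c by (auto intro!: scale)
    ultimately show ?thesis using ab by (simp add: power_mult_distrib ennreal_mult mult_ac)
  qed
qed

lemma SUP_nn_integral_truncate:
  fixes f :: "'a \<Rightarrow> ennreal"
  assumes [measurable]: "f \<in> borel_measurable M"
  shows "(SUP k::nat. \<integral>\<^sup>+x. enn2real (min (f x) (of_nat k)) \<partial>M) = (\<integral>\<^sup>+x. f x \<partial>M)"
proof -
  have e: "ennreal (enn2real (min (f x) (of_nat k))) = min (f x) (of_nat k)" for x k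
    by (rule ennreal_enn2real) (simp add: min_less_iff_disj of_nat_less_top)
  have "(\<integral>\<^sup>+x. f x \<partial>M) = (\<integral>\<^sup>+x. (SUP k. min (f x) (of_nat k)) \<partial>M)"
  proof (intro nn_integral_cong)
    fix x
    have "(SUP k. min (f x) (of_nat k)) = min (f x) (SUP k. of_nat k)"
      using inf_SUP[of "f x" "of_nat" "UNIV::nat set"] by (simp add: inf_min)
    then show "f x = (SUP k. min (f x) (of_nat k))" by (simp add: ennreal_SUP_of_nat_eq_top)
  qed
  also have "\<dots> = (SUP k. \<integral>\<^sup>+x. min (f x) (of_nat k) \<partial>M)"
    by (rule nn_integral_monotone_convergence_SUP) (auto simp: incseq_def le_fun_def intro: min.coboundedI2)
  finally show ?thesis by (simp add: e)
qed

theorem prekopa_leindler_real: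
  fixes f g h :: "real \<Rightarrow> ennreal"
  assumes [measurable]: "f \<in> borel_measurable borel" "g \<in> borel_measurable borel" "h \<in> borel_measurable borel"
    and fgh: "\<And>x y. f x * g y \<le> (h ((x + y) / 2))\<^sup>2"
  shows "(\<integral>\<^sup>+x. f x \<partial>lborel) * (\<integral>\<^sup>+x. g x \<partial>lborel) \<le> (\<integral>\<^sup>+x. h x \<partial>lborel)\<^sup>2"
proof -
  define T where "T p k x = enn2real (min (p x) (of_nat k))" for p :: "real \<Rightarrow> ennreal" and k :: nat and x
  have Tm[measurable]: "T p k \<in> borel_measurable borel" if [measurable]: "p \<in> borel_measurable borel" for p k
    unfolding T_def by measurable
  have e: "ennreal (T p k x) = min (p x) (of_nat k)" for p k x
    unfolding T_def by (rule ennreal_enn2real) (simp add: min_less_iff_disj of_nat_less_top)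
  have T0: "0 \<le> T p k x" for p k x by (simp add: T_def)
  have Tk: "T p k x \<le> real k" for p k x
    using e[of p k x] by (metis ennreal_le_iff ennreal_of_nat_eq_real_of_nat min.cobounded2 of_nat_0_le_iff)
  have bdd: "bdd_above (range (T p k))" for p k using Tk by (intro bdd_aboveI2)
  have "(\<integral>\<^sup>+x. T f k x \<partial>lborel) * (\<integral>\<^sup>+x. T g l x \<partial>lborel) \<le> (\<integral>\<^sup>+x. h x \<partial>lborel)\<^sup>2" for k l
  proof -
    \<comment> \<open>Truncating \<open>h\<close> at the larger level keeps the hypothesis: where
      \<open>h\<close> exceeds \<open>j\<close>, the product of the truncated \<open>f\<close> and
      \<open>g\<close> is at most k l <= j^2.\<close>
    define j where "j = max k l"
    have "(\<integral>\<^sup>+x. T f k x \<partial>lborel) * (\<integral>\<^sup>+x. T g l x \<partial>lborel) \<le> (\<integral>\<^sup>+x. T h j x \<partial>lborel)\<^sup>2"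
    proof (rule prekopa_leindler_real_bounded)
      fix x y
      have "ennreal (T f k x) * ennreal (T g l y) \<le> (ennreal (T h j ((x + y) / 2)))\<^sup>2"
      proof (cases "h ((x + y)/2) \<le> of_nat j")
        case True
        have "ennreal (T f k x) * ennreal (T g l y) \<le> f x * g y" by (auto simp: e intro!: mult_mono)
        also have "\<dots> \<le> (h ((x + y) / 2))\<^sup>2" by (rule fgh)
        finally show ?thesis using True by (simp add: e min_def)
      next
        case False
        have "ennreal (T f k x) * ennreal (T g l y) \<le> of_nat j * of_nat j"
          unfolding e j_def by (intro mult_mono) (auto intro: min.coboundedI2)
        then show ?thesis using False by (simp add: e min_def power2_eq_square)
      qed
      then show "T f k x * T g l y \<le> (T h j ((x + y) / 2))\<^sup>2"
        by (simp add: T0 ennreal_mult'[symmetric] ennreal_power)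
    qed (auto simp: T0 bdd)
    also have "(\<integral>\<^sup>+x. T h j x \<partial>lborel) \<le> (\<integral>\<^sup>+x. h x \<partial>lborel)" by (auto simp: e intro!: nn_integral_mono)
    finally show ?thesis by (simp add: power_mono)
  qed
  then have "(SUP k. \<integral>\<^sup>+x. T f k x \<partial>lborel) * (SUP l. \<integral>\<^sup>+x. T g l x \<partial>lborel) \<le> (\<integral>\<^sup>+x. h x \<partial>lborel)\<^sup>2"
    by (auto simp: SUP_mult_left_ennreal SUP_mult_right_ennreal intro!: SUP_least)
  then show ?thesis
    unfolding T_def by (simp add: SUP_nn_integral_truncate)
qed

interpretation lborel_PiM: product_sigma_finite "\<lambda>_::'i. lborel :: 'a::euclidean_space measure"
  by standard

abbreviation lborel_on :: "'i set \<Rightarrow> ('i \<Rightarrow> real) measure" where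
  "lborel_on I \<equiv> PiM I (\<lambda>_. lborel)"

text \<open>Integrating out all coordinates but the new one leaves functions of one real variable,
  and the induction hypothesis is exactly the one-dimensional hypothesis for them. Products over
  finite index sets take the place of vectors because a coordinate can be split off.\<close>

theorem prekopa_leindler_PiM:
  fixes f g h :: "('i \<Rightarrow> real) \<Rightarrow> ennreal"
  assumes "finite I"
    and "f \<in> borel_measurable (lborel_on I)" "g \<in> borel_measurable (lborel_on I)"
      "h \<in> borel_measurable (lborel_on I)"
    and "\<And>x y. x \<in> space (lborel_on I) \<Longrightarrow> y \<in> space (lborel_on I) \<Longrightarrow>
        f x * g y \<le> (h (\<lambda>i\<in>I. (x i + y i) / 2))\<^sup>2"
  shows "(\<integral>\<^sup>+x. f x \<partial>lborel_on I) * (\<integral>\<^sup>+x. g x \<partial>lborel_on I)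
      \<le> (\<integral>\<^sup>+x. h x \<partial>lborel_on I)\<^sup>2"
  using assms
proof (induction I arbitrary: f g h rule: finite_induct)
  case empty
  from empty(4)[of "\<lambda>_. undefined" "\<lambda>_. undefined"] show ?case
    by (simp add: lborel_PiM.nn_integral_empty space_PiM restrict_def)
next
  case (insert i I)
  note [measurable] = insert.prems(1-3)
  interpret sigma_finite_measure "lborel_on I"
    by (rule lborel_PiM.sigma_finite[OF insert(1)])
  have "(\<integral>\<^sup>+s. (\<integral>\<^sup>+x. f (x(i := s)) \<partial>lborel_on I) \<partial>lborel) * (\<integral>\<^sup>+s. (\<integral>\<^sup>+x. g (x(i := s)) \<partial>lborel_on I) \<partial>lborel)
      \<le> (\<integral>\<^sup>+s. (\<integral>\<^sup>+x. h (x(i := s)) \<partial>lborel_on I) \<partial>lborel)\<^sup>2"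
  proof (rule prekopa_leindler_real)
    fix s t :: real
    show "(\<integral>\<^sup>+x. f (x(i := s)) \<partial>lborel_on I) * (\<integral>\<^sup>+x. g (x(i := t)) \<partial>lborel_on I)
        \<le> (\<integral>\<^sup>+x. h (x(i := (s + t) / 2)) \<partial>lborel_on I)\<^sup>2"
    proof (rule insert.IH)
      fix x y assume xy: "x \<in> space (lborel_on I)" "y \<in> space (lborel_on I)"
      have eq: "(\<lambda>j\<in>I. (x j + y j) / 2)(i := (s + t) / 2) = (\<lambda>j\<in>insert i I. ((x(i := s)) j + (y(i := t)) j) / 2)"
        using insert(2) by (auto simp: fun_eq_iff restrict_def)
      have "x(i := s) \<in> space (lborel_on (insert i I))"
        "y(i := t) \<in> space (lborel_on (insert i I))"
        using xy by (auto simp: space_PiM intro!: PiE_fun_upd)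
      then show "f (x(i := s)) * g (y(i := t)) \<le> (h ((\<lambda>j\<in>I. (x j + y j) / 2)(i := (s + t) / 2)))\<^sup>2"
        unfolding eq by (rule insert.prems(4))
    qed measurable
  qed measurable
  then show ?case
    by (simp add: lborel_PiM.product_nn_integral_insert_rev[OF insert(1,2)])
qed

section \<open>Multiplicative form on the half line\<close>

lemma nn_integral_exp_substitution:
  fixes f :: "real \<Rightarrow> ennreal"
  assumes [measurable]: "f \<in> borel_measurable borel"
  shows "(\<integral>\<^sup>+s. f s * indicator {0<..} s \<partial>lborel) = (\<integral>\<^sup>+u. f (exp u) * ennreal (exp u) \<partial>lborel)"
proof -
  let ?I = "\<lambda>k::nat. {- real (Suc k) .. real (Suc k)}"
  let ?E = "\<lambda>k::nat. {exp (- real (Suc k)) .. exp (real (Suc k))}"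
  have step: "(\<integral>\<^sup>+s. f s * indicator (?E k) s \<partial>lborel) = (\<integral>\<^sup>+u. f (exp u) * ennreal (exp u) * indicator (?I k) u \<partial>lborel)" for k
    by (rule nn_integral_substitution_aux) (auto intro!: derivative_eq_intros continuous_intros)
  have sup: "(SUP k. c * indicator (S k) x) = c * indicator (\<Union>k. S k) x"
    for c :: ennreal and S :: "nat \<Rightarrow> real set" and x
    by (rule antisym) (auto intro!: SUP_least SUP_upper2 simp: indicator_def)
  have inc: "incseq ?E" "incseq ?I" by (auto simp: incseq_def)
  have inc_ind: "incseq (\<lambda>k x. F x * indicator (S k) x)" if "incseq S"
    for F :: "real \<Rightarrow> ennreal" and S :: "nat \<Rightarrow> real set"
    using that by (intro monoI le_funI mult_left_mono indicator_leI) (auto simp: incseq_def)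
  have I: "(\<Union>k. ?I k) = UNIV"
  proof -
    have "\<exists>k. x \<in> ?I k" for x
    proof -
      obtain k :: nat where "\<bar>x\<bar> \<le> real k" using real_arch_simple by blast
      then show ?thesis by (auto intro!: exI[of _ k])
    qed
    then show ?thesis by blast
  qed
  have E: "(\<Union>k. ?E k) = {0<..}"
  proof -
    have "\<exists>k. x \<in> ?E k" if "0 < x" for x
    proof -
      obtain k where "ln x \<in> ?I k" using I by blast
      then show ?thesis using that by (auto intro!: exI[of _ k]) (metis exp_le_cancel_iff exp_ln)+
    qed
    moreover have "0 < x" if "x \<in> ?E k" for x k using that less_le_trans[OF exp_gt_zero, of "- real (Suc k)" x] by auto
    ultimately show ?thesis by (auto simp del: of_nat_Suc)
  qed
  have "(\<integral>\<^sup>+s. f s * indicator {0<..} s \<partial>lborel) = (\<integral>\<^sup>+s. (SUP k. f s * indicator (?E k) s) \<partial>lborel)"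
    by (simp only: sup E)
  also have "\<dots> = (SUP k. \<integral>\<^sup>+s. f s * indicator (?E k) s \<partial>lborel)"
    by (rule nn_integral_monotone_convergence_SUP)
       (rule inc_ind[OF inc(1)], measurable)
  also have "\<dots> = (SUP k. \<integral>\<^sup>+u. f (exp u) * ennreal (exp u) * indicator (?I k) u \<partial>lborel)"
    by (simp only: step)
  also have "\<dots> = (\<integral>\<^sup>+u. (SUP k. f (exp u) * ennreal (exp u) * indicator (?I k) u) \<partial>lborel)"
    by (rule nn_integral_monotone_convergence_SUP[symmetric])
       (rule inc_ind[OF inc(2)], measurable)
  also have "\<dots> = (\<integral>\<^sup>+u. f (exp u) * ennreal (exp u) \<partial>lborel)"
    by (simp only: sup I) simp
  finally show ?thesis .
qed

text \<open>Under s = exp u geometric means become arithmetic means, and the Jacobian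
  \<open>exp u\<close> satisfies the hypothesis with equality. This form suits polarity, where the
  bound depends on the product \<open>s * t\<close> alone.\<close>

theorem prekopa_leindler_geometric:
  fixes f g h :: "real \<Rightarrow> ennreal"
  assumes [measurable]: "f \<in> borel_measurable borel" "g \<in> borel_measurable borel" "h \<in> borel_measurable borel"
    and fgh: "\<And>s t. 0 < s \<Longrightarrow> 0 < t \<Longrightarrow> f s * g t \<le> (h (sqrt (s * t)))\<^sup>2"
  shows "(\<integral>\<^sup>+s. f s * indicator {0<..} s \<partial>lborel) * (\<integral>\<^sup>+s. g s * indicator {0<..} s \<partial>lborel)
      \<le> (\<integral>\<^sup>+s. h s * indicator {0<..} s \<partial>lborel)\<^sup>2"
  unfolding nn_integral_exp_substitution[OF assms(1)] nn_integral_exp_substitution[OF assms(2)]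
    nn_integral_exp_substitution[OF assms(3)]
proof (rule prekopa_leindler_real)
  fix u v :: real
  have s: "sqrt (exp u * exp v) = exp ((u + v) / 2)"
    by (rule real_sqrt_unique) (simp_all add: power2_eq_square exp_add[symmetric])
  have "f (exp u) * ennreal (exp u) * (g (exp v) * ennreal (exp v)) = f (exp u) * g (exp v) * (ennreal (exp u) * ennreal (exp v))"
    by (simp add: mult_ac)
  also have "\<dots> \<le> (h (exp ((u + v) / 2)))\<^sup>2 * (ennreal (exp u) * ennreal (exp v))"
    using fgh[of "exp u" "exp v"] by (intro mult_right_mono) (auto simp: s)
  also have "ennreal (exp u) * ennreal (exp v) = (ennreal (exp ((u + v) / 2)))\<^sup>2"
    by (simp add: power2_eq_square ennreal_mult'[symmetric] exp_add[symmetric])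
  finally show "f (exp u) * ennreal (exp u) * (g (exp v) * ennreal (exp v)) \<le> (h (exp ((u + v) / 2)) * ennreal (exp ((u + v) / 2)))\<^sup>2"
    by (simp add: power_mult_distrib)
qed measurable

section \<open>The functional Santalo inequality\<close>

lemma nn_integral_lborel_translate:
  fixes f :: "real \<Rightarrow> ennreal"
  assumes "f \<in> borel_measurable borel"
  shows "(\<integral>\<^sup>+x. f (x + c) \<partial>lborel) = (\<integral>\<^sup>+x. f x \<partial>lborel)"
  using nn_integral_real_affine[OF assms, of 1 c] by (simp add: add.commute)

lemma nn_integral_PiM_translate:
  fixes f :: "('i \<Rightarrow> real) \<Rightarrow> ennreal"
  assumes "finite I" "f \<in> borel_measurable (lborel_on I)"
  shows "(\<integral>\<^sup>+x. f (\<lambda>i\<in>I. x i + c i) \<partial>lborel_on I) = (\<integral>\<^sup>+x. f x \<partial>lborel_on I)"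
  using assms
proof (induction I arbitrary: f rule: finite_induct)
  case empty
  then show ?case by (simp add: PiM_empty restrict_def nn_integral_count_space_finite)
next
  case (insert i I)
  note [measurable] = insert.prems
  interpret sigma_finite_measure "lborel_on I"
    by (rule lborel_PiM.sigma_finite[OF insert(1)])
  have [measurable]: "(\<lambda>x. \<lambda>i\<in>insert i I. x i + c i) \<in> lborel_on (insert i I) \<rightarrow>\<^sub>M lborel_on (insert i I)"
    by measurable
  have eq: "(\<lambda>j\<in>insert i I. (x(i := s)) j + c j) = (\<lambda>j\<in>I. x j + c j)(i := s + c i)" for x s
    using insert(2) by (auto simp: fun_eq_iff restrict_def)
  have "(\<integral>\<^sup>+x. f (\<lambda>j\<in>insert i I. x j + c j) \<partial>lborel_on (insert i I))
      = (\<integral>\<^sup>+s. (\<integral>\<^sup>+x. f ((\<lambda>j\<in>I. x j + c j)(i := s + c i)) \<partial>lborel_on I) \<partial>lborel)"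
    by (subst lborel_PiM.product_nn_integral_insert_rev[OF insert(1,2)]) (simp_all add: eq del: fun_upd_apply)
  also have "\<dots> = (\<integral>\<^sup>+s. (\<integral>\<^sup>+x. f (x(i := s + c i)) \<partial>lborel_on I) \<partial>lborel)"
    by (intro nn_integral_cong insert.IH) measurable
  also have "\<dots> = (\<integral>\<^sup>+s. (\<integral>\<^sup>+x. f (x(i := s)) \<partial>lborel_on I) \<partial>lborel)"
    by (rule nn_integral_lborel_translate[of "\<lambda>s. \<integral>\<^sup>+x. f (x(i := s)) \<partial>lborel_on I"]) measurable
  also have "\<dots> = (\<integral>\<^sup>+x. f x \<partial>lborel_on (insert i I))"
    by (rule lborel_PiM.product_nn_integral_insert_rev[OF insert(1,2), symmetric]) measurable
  finally show ?case .
qed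

text \<open>For fixed \<open>y i\<close> this is a translation of the other coordinates; once they
  are integrated out, a translation of coordinate \<open>i\<close> remains.\<close>

lemma nn_integral_PiM_shear:
  fixes f :: "('i \<Rightarrow> real) \<Rightarrow> ennreal"
  assumes I: "finite I" "i \<notin> I" and [measurable]: "f \<in> borel_measurable (lborel_on (insert i I))"
  shows "(\<integral>\<^sup>+y. f ((\<lambda>j\<in>I. y j + (z j + y i * b j))(i := y i + c)) \<partial>lborel_on (insert i I))
      = (\<integral>\<^sup>+y. f y \<partial>lborel_on (insert i I))"
proof -
  interpret sigma_finite_measure "lborel_on I"
    by (rule lborel_PiM.sigma_finite[OF I(1)])
  have eq: "(\<lambda>j\<in>I. (x(i := s)) j + (z j + (x(i := s)) i * b j))(i := (x(i := s)) i + c) = (\<lambda>j\<in>I. x j + (z j + s * b j))(i := s + c)" for x s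
    using I(2) by (auto simp: fun_eq_iff restrict_def)
  have [measurable]: "(\<lambda>y. (\<lambda>j\<in>I. y j + (z j + y i * b j))(i := y i + c)) \<in> lborel_on (insert i I) \<rightarrow>\<^sub>M lborel_on (insert i I)"
    by measurable
  have "(\<integral>\<^sup>+y. f ((\<lambda>j\<in>I. y j + (z j + y i * b j))(i := y i + c)) \<partial>lborel_on (insert i I))
      = (\<integral>\<^sup>+s. (\<integral>\<^sup>+x. f ((\<lambda>j\<in>I. x j + (z j + s * b j))(i := s + c)) \<partial>lborel_on I) \<partial>lborel)"
    by (subst lborel_PiM.product_nn_integral_insert_rev[OF I]) (measurable, simp only: eq)
  also have "\<dots> = (\<integral>\<^sup>+s. (\<integral>\<^sup>+x. f (x(i := s + c)) \<partial>lborel_on I) \<partial>lborel)"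
  proof (rule nn_integral_cong)
    fix s :: real
    show "(\<integral>\<^sup>+x. f ((\<lambda>j\<in>I. x j + (z j + s * b j))(i := s + c)) \<partial>lborel_on I) = (\<integral>\<^sup>+x. f (x(i := s + c)) \<partial>lborel_on I)"
      by (rule nn_integral_PiM_translate[OF I(1), of "\<lambda>x. f (x(i := s + c))"]) measurable
  qed
  also have "\<dots> = (\<integral>\<^sup>+s. (\<integral>\<^sup>+x. f (x(i := s)) \<partial>lborel_on I) \<partial>lborel)"
    by (rule nn_integral_lborel_translate[of "\<lambda>s. \<integral>\<^sup>+x. f (x(i := s)) \<partial>lborel_on I"]) measurable
  also have "\<dots> = (\<integral>\<^sup>+x. f x \<partial>lborel_on (insert i I))"
    by (rule lborel_PiM.product_nn_integral_insert_rev[OF I, symmetric]) measurable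
  finally show ?thesis .
qed

text \<open>The map is the inverse transpose of the linear part of the shear in
  \<open>nn_integral_PiM_shear\<close>, so the pair preserves inner products. With coordinate
  \<open>i\<close> integrated first it is a translation by an amount that depends on the other
  coordinates only.\<close>

lemma nn_integral_PiM_dual_shear:
  fixes f :: "('i \<Rightarrow> real) \<Rightarrow> ennreal"
  assumes I: "finite I" "i \<notin> I" and [measurable]: "f \<in> borel_measurable (lborel_on (insert i I))"
  shows "(\<integral>\<^sup>+x. f (x(i := x i - (\<Sum>j\<in>I. x j * b j))) \<partial>lborel_on (insert i I))
      = (\<integral>\<^sup>+x. f x \<partial>lborel_on (insert i I))"
proof -
  have eq: "(x(i := s))(i := (x(i := s)) i - (\<Sum>j\<in>I. (x(i := s)) j * b j)) = x(i := s + - (\<Sum>j\<in>I. x j * b j))" for x s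
  proof -
    have "(\<Sum>j\<in>I. (x(i := s)) j * b j) = (\<Sum>j\<in>I. x j * b j)"
      using I(2) by (intro sum.cong) auto
    then show ?thesis by simp
  qed
  have [measurable]: "(\<lambda>x. x(i := x i - (\<Sum>j\<in>I. x j * b j))) \<in> lborel_on (insert i I) \<rightarrow>\<^sub>M lborel_on (insert i I)"
    by (rule measurable_fun_upd[where J="insert i I"]) auto
  have "(\<integral>\<^sup>+x. f (x(i := x i - (\<Sum>j\<in>I. x j * b j))) \<partial>lborel_on (insert i I))
      = (\<integral>\<^sup>+x. (\<integral>\<^sup>+s. f (x(i := s + - (\<Sum>j\<in>I. x j * b j))) \<partial>lborel) \<partial>lborel_on I)"
    by (subst lborel_PiM.product_nn_integral_insert[OF I]) (measurable, simp only: eq)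
  also have "\<dots> = (\<integral>\<^sup>+x. (\<integral>\<^sup>+s. f (x(i := s)) \<partial>lborel) \<partial>lborel_on I)"
  proof (rule nn_integral_cong)
    fix x assume [measurable]: "x \<in> space (lborel_on I)"
    show "(\<integral>\<^sup>+s. f (x(i := s + - (\<Sum>j\<in>I. x j * b j))) \<partial>lborel) = (\<integral>\<^sup>+s. f (x(i := s)) \<partial>lborel)"
      by (rule nn_integral_lborel_translate) measurable
  qed
  also have "\<dots> = (\<integral>\<^sup>+x. f x \<partial>lborel_on (insert i I))"
    by (rule lborel_PiM.product_nn_integral_insert[OF I, symmetric]) measurable
  finally show ?thesis .
qed

text \<open>The number sqrt (pi / 2). Only its positivity and finiteness enter; its powers cancel in
  the comparison with the ball.\<close>

definition half_gauss :: ennreal where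
  "half_gauss = (\<integral>\<^sup>+s. ennreal (exp (- (s\<^sup>2) / 2)) * indicator {0<..} s \<partial>lborel)"

lemma nn_integral_power_exp_finite:
  "(\<integral>\<^sup>+s. ennreal (s ^ k * exp (- s)) * indicator {0<..} s \<partial>lborel) < top"
proof -
  have "(\<integral>\<^sup>+s. ennreal (s ^ k * exp (- s)) * indicator {0<..} s \<partial>lborel)
      \<le> (\<integral>\<^sup>+s. ennreal (if s \<in> {0..} then s powr (real (Suc k) - 1) / exp s else 0) \<partial>lborel)"
    by (intro nn_integral_mono) (auto simp: indicator_def powr_realpow exp_minus divide_inverse)
  also have "\<dots> = ennreal (Gamma (real (Suc k)))"
  proof (rule nn_integral_has_integral_lborel)
    show "((\<lambda>s. if s \<in> {0..} then s powr (real (Suc k) - 1) / exp s else 0) has_integral Gamma (real (Suc k))) UNIV"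
      unfolding has_integral_restrict_UNIV by (rule Gamma_integral_real) simp
  qed auto
  also have "\<dots> < top" by simp
  finally show ?thesis .
qed

lemma nn_integral_power_gauss_finite:
  "(\<integral>\<^sup>+s. ennreal (s ^ k * exp (- (s\<^sup>2) / 2)) * indicator {0<..} s \<partial>lborel) < top"
proof -
  have "(\<integral>\<^sup>+s. ennreal (s ^ k * exp (- (s\<^sup>2) / 2)) * indicator {0<..} s \<partial>lborel)
      \<le> (\<integral>\<^sup>+s. ennreal (exp (1/2)) * (ennreal (s ^ k * exp (- s)) * indicator {0<..} s) \<partial>lborel)"
  proof (rule nn_integral_mono)
    fix s :: real
    \<comment> \<open>Completing the square bounds the Gaussian by a multiple of
      \<open>exp (- s)\<close>, whose moments are values of the Gamma function.\<close>
    have "0 \<le> (s - 1)\<^sup>2" by simp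
    then have "exp (- (s\<^sup>2) / 2) \<le> exp (1/2) * exp (- s)"
      by (subst exp_add[symmetric]) (simp add: power2_eq_square algebra_simps)
    then have "s ^ k * exp (- (s\<^sup>2) / 2) \<le> exp (1/2) * (s ^ k * exp (- s))" if "0 < s"
      using mult_left_mono[of _ _ "s ^ k"] that by (simp add: mult_ac)
    then show "ennreal (s ^ k * exp (- (s\<^sup>2) / 2)) * indicator {0<..} s \<le> ennreal (exp (1/2)) * (ennreal (s ^ k * exp (- s)) * indicator {0<..} s)"
      by (auto simp: indicator_def ennreal_mult'[symmetric] intro!: ennreal_leI)
  qed
  also have "\<dots> = ennreal (exp (1/2)) * (\<integral>\<^sup>+s. ennreal (s ^ k * exp (- s)) * indicator {0<..} s \<partial>lborel)"
    by (rule nn_integral_cmult) measurable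
  also have "\<dots> < top" using nn_integral_power_exp_finite by (simp add: ennreal_mult_less_top)
  finally show ?thesis .
qed

lemma half_gauss_finite: "half_gauss < top"
  using nn_integral_power_gauss_finite[of 0] by (simp add: half_gauss_def)

lemma half_gauss_pos: "0 < half_gauss"
proof -
  have "0 < ennreal (exp (-1/2))" by simp
  also have "ennreal (exp (-1/2)) = (\<integral>\<^sup>+s. ennreal (exp (-1/2)) * indicator {0<..1} (s::real) \<partial>lborel)"
    by (simp add: nn_integral_cmult)
  also have "\<dots> \<le> half_gauss"
    unfolding half_gauss_def by (intro nn_integral_mono) (auto simp: indicator_def power_le_one intro!: ennreal_leI)
  finally show ?thesis .
qed

text \<open>Since \<open>ennreal\<close> maps negative numbers to 0, the two integrals are those of the positive and
  of the negative part of \<open>x i * f x\<close>: a balanced \<open>f\<close> has its barycentre at the origin.\<close>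

definition balanced :: "'i set \<Rightarrow> (('i \<Rightarrow> real) \<Rightarrow> ennreal) \<Rightarrow> bool" where
  "balanced I f \<longleftrightarrow> (\<forall>i\<in>I.
     (\<integral>\<^sup>+x. ennreal (x i) * f x \<partial>lborel_on I) = (\<integral>\<^sup>+x. ennreal (- x i) * f x \<partial>lborel_on I) \<and>
     (\<integral>\<^sup>+x. ennreal (x i) * f x \<partial>lborel_on I) < top)"

text \<open>For two points of the same half line \<open>s * t\<close> is positive, and
  \<open>exp (- s * t)\<close> is the square of exp (- u^2 / 2) at the geometric mean u = sqrt (s *
  t), so \<open>prekopa_leindler_geometric\<close> applies. The sign \<open>e\<close> selects the
  half line; \<open>c\<close> stands for the inner product of the remaining coordinates.\<close>

lemma half_line_bound:
  fixes f g :: "real \<Rightarrow> ennreal"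
  assumes [measurable]: "f \<in> borel_measurable borel" "g \<in> borel_measurable borel"
    and e: "e = 1 \<or> e = -1" and fg: "\<And>s t. f s * g t \<le> ennreal (exp (- c - s * t))"
  shows "(\<integral>\<^sup>+s. f s * indicator {0<..} (e * s) \<partial>lborel) * (\<integral>\<^sup>+s. g s * indicator {0<..} (e * s) \<partial>lborel)
      \<le> ennreal (exp (- c)) * half_gauss\<^sup>2"
proof -
  have refl: "(\<integral>\<^sup>+s. p s * indicator {0<..} (e * s) \<partial>lborel) = (\<integral>\<^sup>+s. p (e * s) * indicator {0<..} s \<partial>lborel)"
    if [measurable]: "p \<in> borel_measurable borel" for p :: "real \<Rightarrow> ennreal"
    using nn_integral_real_affine[of "\<lambda>s. p s * indicator {0<..} (e * s)" e 0] e
    by (auto simp: mult.assoc[symmetric])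
  have "(\<integral>\<^sup>+s. f (e * s) * indicator {0<..} s \<partial>lborel) * (\<integral>\<^sup>+s. g (e * s) * indicator {0<..} s \<partial>lborel)
      \<le> (\<integral>\<^sup>+s. ennreal (exp (- c / 2) * exp (- (s\<^sup>2) / 2)) * indicator {0<..} s \<partial>lborel)\<^sup>2"
  proof (rule prekopa_leindler_geometric)
    fix s t :: real assume st: "0 < s" "0 < t"
    have "f (e * s) * g (e * t) \<le> ennreal (exp (- c - (e * s) * (e * t)))" by (rule fg)
    also have "- c - (e * s) * (e * t) = 2 * (- c / 2 + - ((sqrt (s * t))\<^sup>2) / 2)" using e st by auto
    also have "exp \<dots> = (exp (- c / 2) * exp (- ((sqrt (s * t))\<^sup>2) / 2))\<^sup>2"
      by (simp only: exp_double exp_add)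
    also have "ennreal \<dots> = (ennreal (exp (- c / 2) * exp (- ((sqrt (s * t))\<^sup>2) / 2)))\<^sup>2"
      by (simp add: ennreal_power)
    finally show "f (e * s) * g (e * t) \<le> (ennreal (exp (- c / 2) * exp (- ((sqrt (s * t))\<^sup>2) / 2)))\<^sup>2" .
  qed measurable
  also have "(\<integral>\<^sup>+s. ennreal (exp (- c / 2) * exp (- (s\<^sup>2) / 2)) * indicator {0<..} s \<partial>lborel) = ennreal (exp (- c / 2)) * half_gauss"
    unfolding half_gauss_def by (subst nn_integral_cmult[symmetric]) (auto simp: ennreal_mult mult.assoc)
  also have "(ennreal (exp (- c / 2)) * half_gauss)\<^sup>2 = ennreal (exp (- c)) * half_gauss\<^sup>2"
    by (simp add: power_mult_distrib ennreal_power exp_double[symmetric])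
  finally show ?thesis by (simp add: refl)
qed

text \<open>The integrals over half-line fibres satisfy the hypothesis of the inequality in one
  dimension less, by \<open>half_line_bound\<close> for each pair of fibres. The condition
  \<open>bal\<close> says that the fibre integral of \<open>f\<close> is balanced in the remaining
  coordinates, and \<open>IH\<close> is the inequality there.\<close>

lemma half_space_bound:
  fixes f g :: "('i \<Rightarrow> real) \<Rightarrow> ennreal"
  assumes I: "finite I" "i \<notin> I"
    and IH: "\<And>F G. F \<in> borel_measurable (lborel_on I) \<Longrightarrow> G \<in> borel_measurable (lborel_on I) \<Longrightarrow>
       balanced I F \<Longrightarrow> (\<And>x y. x \<in> space (lborel_on I) \<Longrightarrow> y \<in> space (lborel_on I) \<Longrightarrow>
         F x * G y \<le> ennreal (exp (- (\<Sum>j\<in>I. x j * y j)))) \<Longrightarrow>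
       (\<integral>\<^sup>+x. F x \<partial>lborel_on I) * (\<integral>\<^sup>+x. G x \<partial>lborel_on I) \<le> C"
    and fm[measurable]: "f \<in> borel_measurable (lborel_on (insert i I))"
    and gm[measurable]: "g \<in> borel_measurable (lborel_on (insert i I))"
    and e: "e = 1 \<or> e = -1"
    and bal: "\<And>j. j \<in> I \<Longrightarrow>
       (\<integral>\<^sup>+x. ennreal (x j) * (f x * indicator {0<..} (e * x i)) \<partial>lborel_on (insert i I))
     = (\<integral>\<^sup>+x. ennreal (- x j) * (f x * indicator {0<..} (e * x i)) \<partial>lborel_on (insert i I))"
      "\<And>j. j \<in> I \<Longrightarrow> (\<integral>\<^sup>+x. ennreal (x j) * (f x * indicator {0<..} (e * x i)) \<partial>lborel_on (insert i I)) < top"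
    and fg: "\<And>x y. x \<in> space (lborel_on (insert i I)) \<Longrightarrow> y \<in> space (lborel_on (insert i I)) \<Longrightarrow>
         f x * g y \<le> ennreal (exp (- (\<Sum>j\<in>insert i I. x j * y j)))"
  shows "(\<integral>\<^sup>+x. f x * indicator {0<..} (e * x i) \<partial>lborel_on (insert i I))
       * (\<integral>\<^sup>+x. g x * indicator {0<..} (e * x i) \<partial>lborel_on (insert i I)) \<le> half_gauss\<^sup>2 * C"
proof -
  define F where "F x = (\<integral>\<^sup>+s. f (x(i := s)) * indicator {0<..} (e * s) \<partial>lborel)" for x
  define G where "G x = (\<integral>\<^sup>+s. g (x(i := s)) * indicator {0<..} (e * s) \<partial>lborel)" for x
  have [measurable]: "F \<in> borel_measurable (lborel_on I)" "G \<in> borel_measurable (lborel_on I)"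
    unfolding F_def G_def by measurable
  have fub: "(\<integral>\<^sup>+x. p x \<partial>lborel_on (insert i I)) = (\<integral>\<^sup>+x. (\<integral>\<^sup>+s. p (x(i := s)) \<partial>lborel) \<partial>lborel_on I)"
    if "p \<in> borel_measurable (lborel_on (insert i I))" for p
    using that by (rule lborel_PiM.product_nn_integral_insert[OF I])
  have iF: "(\<integral>\<^sup>+x. f x * indicator {0<..} (e * x i) \<partial>lborel_on (insert i I)) = (\<integral>\<^sup>+x. F x \<partial>lborel_on I)"
    unfolding F_def by (subst fub) simp_all
  have iG: "(\<integral>\<^sup>+x. g x * indicator {0<..} (e * x i) \<partial>lborel_on (insert i I)) = (\<integral>\<^sup>+x. G x \<partial>lborel_on I)"
    unfolding G_def by (subst fub) simp_all
  have mom: "(\<integral>\<^sup>+x. ennreal (d * x j) * (f x * indicator {0<..} (e * x i)) \<partial>lborel_on (insert i I))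
      = (\<integral>\<^sup>+x. ennreal (d * x j) * F x \<partial>lborel_on I)" if j: "j \<in> I" for d j
  proof -
    have "j \<noteq> i" using j I by auto
    have "(\<integral>\<^sup>+s. ennreal (d * x j) * (f (x(i := s)) * indicator {0<..} (e * s)) \<partial>lborel) = ennreal (d * x j) * F x"
      if [measurable]: "x \<in> space (lborel_on I)" for x
      unfolding F_def by (rule nn_integral_cmult) measurable
    then show ?thesis
      using j \<open>j \<noteq> i\<close> by (subst fub) (auto intro!: nn_integral_cong)
  qed
  have "balanced I F"
    unfolding balanced_def using bal mom[of _ 1] mom[of _ "-1"] by simp
  have hg: "half_gauss\<^sup>2 \<noteq> 0" "half_gauss\<^sup>2 \<noteq> top"
    using half_gauss_pos half_gauss_finite by (auto simp: power2_eq_square ennreal_mult_eq_top_iff)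
  \<comment> \<open>The factor \<open>half_gauss\<^sup>2\<close> lost on the fibres is moved into
    \<open>G\<close>, since \<open>IH\<close> expects the bound with constant 1.\<close>
  have "(\<integral>\<^sup>+x. F x \<partial>lborel_on I) * (\<integral>\<^sup>+x. G x / half_gauss\<^sup>2 \<partial>lborel_on I) \<le> C"
  proof (rule IH)
    fix x y assume xy: "x \<in> space (lborel_on I)" "y \<in> space (lborel_on I)"
    have "F x * G y \<le> ennreal (exp (- (\<Sum>j\<in>I. x j * y j))) * half_gauss\<^sup>2"
      unfolding F_def G_def
    proof (rule half_line_bound[OF _ _ e])
      fix s t :: real
      have "x(i := s) \<in> space (lborel_on (insert i I))"
        "y(i := t) \<in> space (lborel_on (insert i I))"
        using xy by (auto simp: space_PiM intro!: PiE_fun_upd)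
      then have "f (x(i := s)) * g (y(i := t)) \<le> ennreal (exp (- (\<Sum>j\<in>insert i I. (x(i := s)) j * (y(i := t)) j)))"
        by (rule fg)
      also have "(\<Sum>j\<in>insert i I. (x(i := s)) j * (y(i := t)) j) = s * t + (\<Sum>j\<in>I. (x(i := s)) j * (y(i := t)) j)"
        using I by (subst sum.insert) auto
      also have "(\<Sum>j\<in>I. (x(i := s)) j * (y(i := t)) j) = (\<Sum>j\<in>I. x j * y j)"
        using I(2) by (intro sum.cong) auto
      also have "- (s * t + (\<Sum>j\<in>I. x j * y j)) = - (\<Sum>j\<in>I. x j * y j) - s * t" by simp
      finally show "f (x(i := s)) * g (y(i := t)) \<le> ennreal (exp (- (\<Sum>j\<in>I. x j * y j) - s * t))" .
    qed (use xy in measurable)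
    then have "F x * G y / half_gauss\<^sup>2 \<le> ennreal (exp (- (\<Sum>j\<in>I. x j * y j))) * half_gauss\<^sup>2 / half_gauss\<^sup>2"
      by (rule divide_right_mono_ennreal)
    then show "F x * (G y / half_gauss\<^sup>2) \<le> ennreal (exp (- (\<Sum>j\<in>I. x j * y j)))"
      using hg by (simp add: ennreal_times_divide mult_divide_eq_ennreal)
  qed (use \<open>balanced I F\<close> in measurable)
  then have "(\<integral>\<^sup>+x. F x \<partial>lborel_on I) * ((\<integral>\<^sup>+x. G x \<partial>lborel_on I) / half_gauss\<^sup>2) \<le> C"
    by (simp add: nn_integral_divide)
  then have "half_gauss\<^sup>2 * ((\<integral>\<^sup>+x. F x \<partial>lborel_on I) * ((\<integral>\<^sup>+x. G x \<partial>lborel_on I) / half_gauss\<^sup>2)) \<le> half_gauss\<^sup>2 * C"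
    by (rule mult_left_mono) simp
  also have "half_gauss\<^sup>2 * ((\<integral>\<^sup>+x. F x \<partial>lborel_on I) * ((\<integral>\<^sup>+x. G x \<partial>lborel_on I) / half_gauss\<^sup>2))
      = (\<integral>\<^sup>+x. F x \<partial>lborel_on I) * (\<integral>\<^sup>+x. G x \<partial>lborel_on I) * half_gauss\<^sup>2 / half_gauss\<^sup>2"
    by (simp add: ennreal_times_divide mult_ac)
  also have "\<dots> = (\<integral>\<^sup>+x. F x \<partial>lborel_on I) * (\<integral>\<^sup>+x. G x \<partial>lborel_on I)"
    using hg by (simp add: mult_divide_eq_ennreal)
  finally show ?thesis by (simp add: iF iG)
qed

section \<open>Median hyperplane and barycentre\<close>

lemma exists_median:
  fixes X r :: "'a \<Rightarrow> real"
  assumes [measurable]: "X \<in> borel_measurable M" and r: "integrable M r"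
    and null: "\<And>c. AE x in M. X x \<noteq> c" and bd: "\<And>x. x \<in> space M \<Longrightarrow> r x \<noteq> 0 \<Longrightarrow> \<bar>X x\<bar> \<le> K"
    and r0: "\<And>x. 0 \<le> r x"
  obtains s where "(\<integral>x. indicator {0<..} (X x - s) * r x \<partial>M) = (\<integral>x. r x \<partial>M) / 2"
proof -
  define F where "F s = (\<integral>x. indicator {0<..} (X x - s) * r x \<partial>M)" for s
  have [measurable]: "r \<in> borel_measurable M" using r by auto
  have "isCont F a" for a
  proof (rule continuous_at_sequentiallyI)
    fix u :: "nat \<Rightarrow> real" assume u: "u \<longlonglongrightarrow> a"
    show "(\<lambda>n. F (u n)) \<longlonglongrightarrow> F a"
      unfolding F_def
    proof (rule integral_dominated_convergence[where w="\<lambda>x. \<bar>r x\<bar>"])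
      show "AE x in M. (\<lambda>n. indicator {0<..} (X x - u n) * r x) \<longlonglongrightarrow> indicator {0<..} (X x - a) * r x"
        using null[of a]
      proof eventually_elim
        case (elim x)
        have "eventually (\<lambda>n. indicator {0<..} (X x - u n) = (indicator {0<..} (X x - a) :: real)) sequentially"
        proof (cases "X x < a")
          case True
          show ?thesis
            using order_tendstoD(1)[OF u True] by eventually_elim (use True in \<open>auto simp: indicator_def\<close>)
        next
          case False
          then have "a < X x" using elim by simp
          show ?thesis
            using order_tendstoD(2)[OF u \<open>a < X x\<close>] by eventually_elim (use \<open>a < X x\<close> in \<open>auto simp: indicator_def\<close>)
        qed
        then have "eventually (\<lambda>n. indicator {0<..} (X x - u n) * r x = indicator {0<..} (X x - a) * r x) sequentially"
          by eventually_elim simp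
        then show ?case by (rule tendsto_eventually)
      qed
    qed (use r in \<open>auto simp: indicator_def\<close>)
  qed
  \<comment> \<open>On this interval the mass above level \<open>s\<close> falls from everything to
    nothing. The extra 1 on the left is there because the half line is open: at
    \<open>s = - \<bar>K\<bar>\<close> a point with \<open>X x = - \<bar>K\<bar>\<close> would not
    be counted.\<close>
  then have cont: "continuous_on {- \<bar>K\<bar> - 1 .. \<bar>K\<bar>} F" by (simp add: continuous_at_imp_continuous_on)
  have "F \<bar>K\<bar> = (\<integral>x. 0 \<partial>M)"
    unfolding F_def by (rule Bochner_Integration.integral_cong) (auto simp: indicator_def dest: bd)
  then have F0: "F \<bar>K\<bar> = 0" by simp
  have F1: "F (- \<bar>K\<bar> - 1) = (\<integral>x. r x \<partial>M)"
    unfolding F_def by (rule Bochner_Integration.integral_cong) (auto simp: indicator_def dest!: bd)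
  have "0 \<le> (\<integral>x. r x \<partial>M)" using r0 by simp
  then have "\<exists>s\<ge>- \<bar>K\<bar> - 1. s \<le> \<bar>K\<bar> \<and> F s = (\<integral>x. r x \<partial>M) / 2"
    by (intro IVT2' cont) (auto simp: F0 F1)
  then show thesis using that unfolding F_def by blast
qed

lemma integral_zero_nn_integral:
  fixes u :: "'a \<Rightarrow> real"
  assumes u: "integrable M u" "(\<integral>x. u x \<partial>M) = 0"
  shows "(\<integral>\<^sup>+x. ennreal (u x) \<partial>M) = (\<integral>\<^sup>+x. ennreal (- u x) \<partial>M)" "(\<integral>\<^sup>+x. ennreal (u x) \<partial>M) < top"
proof -
  have f: "(\<integral>\<^sup>+x. ennreal (u x) \<partial>M) \<noteq> top" "(\<integral>\<^sup>+x. ennreal (- u x) \<partial>M) \<noteq> top"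
    using u(1) unfolding real_integrable_def by (simp_all add: infinity_ennreal_def)
  then show "(\<integral>\<^sup>+x. ennreal (u x) \<partial>M) < top" by (simp add: less_top)
  have "enn2real (\<integral>\<^sup>+x. ennreal (u x) \<partial>M) = enn2real (\<integral>\<^sup>+x. ennreal (- u x) \<partial>M)"
    using u(2) real_lebesgue_integral_def[OF u(1)] by simp
  then have "ennreal (enn2real (\<integral>\<^sup>+x. ennreal (u x) \<partial>M)) = ennreal (enn2real (\<integral>\<^sup>+x. ennreal (- u x) \<partial>M))" by simp
  then show "(\<integral>\<^sup>+x. ennreal (u x) \<partial>M) = (\<integral>\<^sup>+x. ennreal (- u x) \<partial>M)"
    unfolding ennreal_enn2real[OF f(1)[unfolded less_top]] ennreal_enn2real[OF f(2)[unfolded less_top]] .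
qed

text \<open>Jensen's inequality through exp u >= 1 + u: the linear term integrates to zero. In
  \<open>ennreal\<close> the negative parts are moved to the other side, and the sum of the first
  moments, finite by \<open>balanced\<close>, is cancelled.\<close>

lemma balanced_exp:
  fixes f :: "('i \<Rightarrow> real) \<Rightarrow> ennreal"
  assumes J: "finite J" and [measurable]: "f \<in> borel_measurable (lborel_on J)" and bal: "balanced J f"
  shows "(\<integral>\<^sup>+x. f x \<partial>lborel_on J) \<le> (\<integral>\<^sup>+x. f x * ennreal (exp (\<Sum>j\<in>J. z j * x j)) \<partial>lborel_on J)"
proof -
  let ?M = "lborel_on J"
  define P where "P j = (\<integral>\<^sup>+x. ennreal (z j * x j) * f x \<partial>?M)" for j
  define N where "N j = (\<integral>\<^sup>+x. ennreal (- (z j * x j)) * f x \<partial>?M)" for j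
  have PN: "P j = N j \<and> P j < top" if j: "j \<in> J" for j
  proof -
    have b1: "(\<integral>\<^sup>+x. ennreal (x j) * f x \<partial>?M) = (\<integral>\<^sup>+x. ennreal (- x j) * f x \<partial>?M)"
      and b2: "(\<integral>\<^sup>+x. ennreal (x j) * f x \<partial>?M) < top"
      using bal j unfolding balanced_def by blast+
    note b = b1 b2 b2[unfolded b1]
    have m[measurable]: "(\<lambda>x. x j) \<in> borel_measurable ?M" using j by simp
    have sc: "(\<integral>\<^sup>+x. ennreal (c * (d * x j)) * f x \<partial>?M) = ennreal c * (\<integral>\<^sup>+x. ennreal (d * x j) * f x \<partial>?M)"
      if "0 \<le> c" for c d
      using that by (subst nn_integral_cmult[symmetric]) (auto simp: ennreal_mult' mult.assoc)
    show ?thesis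
    proof (cases "0 \<le> z j")
      case True
      then show ?thesis
        using sc[of "z j" 1] sc[of "z j" "-1"] b by (simp add: P_def N_def ennreal_mult_less_top)
    next
      case False
      then show ?thesis
        using sc[of "- z j" 1] sc[of "- z j" "-1"] b by (simp add: P_def N_def ennreal_mult_less_top)
    qed
  qed
  have "P j < top" if "j \<in> J" for j using PN[OF that] by blast
  then have fin: "(\<Sum>j\<in>J. P j) < top" using J by simp
  have m[measurable]: "(\<lambda>x. x j) \<in> borel_measurable ?M" if "j \<in> J" for j using that by simp
  have "(\<integral>\<^sup>+x. f x \<partial>?M) + (\<Sum>j\<in>J. P j) = (\<integral>\<^sup>+x. f x + (\<Sum>j\<in>J. ennreal (z j * x j) * f x) \<partial>?M)"
    unfolding P_def by (subst nn_integral_add, measurable, subst nn_integral_sum) auto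
  also have "\<dots> \<le> (\<integral>\<^sup>+x. f x * ennreal (exp (\<Sum>j\<in>J. z j * x j)) + (\<Sum>j\<in>J. ennreal (- (z j * x j)) * f x) \<partial>?M)"
  proof (rule nn_integral_mono)
    fix x
    have s: "(\<Sum>j\<in>J. ennreal (a j) * f x) = ennreal (\<Sum>j\<in>J. max 0 (a j)) * f x" for a
    proof -
      have "ennreal (\<Sum>j\<in>J. max 0 (a j)) = (\<Sum>j\<in>J. ennreal (max 0 (a j)))" by (rule sum_ennreal[symmetric]) auto
      also have "\<dots> = (\<Sum>j\<in>J. ennreal (a j))" by (intro sum.cong) (auto simp: max_def ennreal_neg)
      finally show ?thesis by (simp add: sum_distrib_right)
    qed
    have "(\<Sum>j\<in>J. max 0 (z j * x j)) - (\<Sum>j\<in>J. max 0 (- (z j * x j))) = (\<Sum>j\<in>J. z j * x j)"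
      unfolding sum_subtractf[symmetric] by (rule sum.cong) auto
    then have "1 + (\<Sum>j\<in>J. max 0 (z j * x j)) \<le> exp (\<Sum>j\<in>J. z j * x j) + (\<Sum>j\<in>J. max 0 (- (z j * x j)))"
      using exp_ge_add_one_self[of "\<Sum>j\<in>J. z j * x j"] by linarith
    then have "ennreal (1 + (\<Sum>j\<in>J. max 0 (z j * x j))) * f x \<le> ennreal (exp (\<Sum>j\<in>J. z j * x j) + (\<Sum>j\<in>J. max 0 (- (z j * x j)))) * f x"
      by (intro mult_right_mono ennreal_leI) auto
    then show "f x + (\<Sum>j\<in>J. ennreal (z j * x j) * f x) \<le> f x * ennreal (exp (\<Sum>j\<in>J. z j * x j)) + (\<Sum>j\<in>J. ennreal (- (z j * x j)) * f x)"
      unfolding s by (simp add: sum_nonneg distrib_left distrib_right mult.commute)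
  qed
  also have "\<dots> = (\<integral>\<^sup>+x. f x * ennreal (exp (\<Sum>j\<in>J. z j * x j)) \<partial>?M) + (\<Sum>j\<in>J. N j)"
    unfolding N_def by (subst nn_integral_add, measurable, subst nn_integral_sum) auto
  also have "(\<Sum>j\<in>J. N j) = (\<Sum>j\<in>J. P j)" using PN by simp
  finally have "(\<Sum>j\<in>J. P j) + (\<integral>\<^sup>+x. f x \<partial>?M) \<le> (\<Sum>j\<in>J. P j) + (\<integral>\<^sup>+x. f x * ennreal (exp (\<Sum>j\<in>J. z j * x j)) \<partial>?M)"
    by (simp only: add.commute)
  then show ?thesis unfolding ennreal_add_left_cancel_le using fin by auto
qed

lemma AE_PiM_coordinate_neq:
  assumes "finite J" "i \<in> J"
  shows "AE x in lborel_on J. x i \<noteq> c"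
proof (rule AE_I)
  let ?A = "PiE J (\<lambda>j. if j = i then {c} else UNIV)"
  show "{x \<in> space (lborel_on J). \<not> x i \<noteq> c} \<subseteq> ?A"
    by (auto simp: space_PiM PiE_iff extensional_def)
  show "?A \<in> sets (lborel_on J)"
    using assms by (intro sets_PiM_I_finite) auto
  have "emeasure (lborel_on J) ?A = (\<Prod>j\<in>J. emeasure lborel (if j = i then {c} else UNIV))"
    using assms by (intro lborel_PiM.emeasure_PiM) auto
  also have "\<dots> = 0" using assms by (intro prod_zero) (auto intro!: bexI[of _ i])
  finally show "emeasure (lborel_on J) ?A = 0" .
qed

text \<open>The cut is made through \<open>r\<close>, which is bounded with bounded support, so that
  its moments and a median hyperplane exist. After an affine change of variables both halves of
  \<open>r\<close> have their barycentres on the axis \<open>i\<close>. Then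
  \<open>half_space_bound\<close> applies on either side, with the transformed \<open>r\<close> as
  the balanced function and the transformed \<open>f\<close> as its partner.\<close>

lemma santalo_step:
  fixes f :: "('i \<Rightarrow> real) \<Rightarrow> ennreal" and r :: "('i \<Rightarrow> real) \<Rightarrow> real"
  assumes I: "finite I" "i \<notin> I"
    and IH: "\<And>F G. F \<in> borel_measurable (lborel_on I) \<Longrightarrow> G \<in> borel_measurable (lborel_on I) \<Longrightarrow>
       balanced I F \<Longrightarrow> (\<And>x y. x \<in> space (lborel_on I) \<Longrightarrow> y \<in> space (lborel_on I) \<Longrightarrow>
         F x * G y \<le> ennreal (exp (- (\<Sum>j\<in>I. x j * y j)))) \<Longrightarrow>
       (\<integral>\<^sup>+x. F x \<partial>lborel_on I) * (\<integral>\<^sup>+x. G x \<partial>lborel_on I) \<le> C"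
    and fm[measurable]: "f \<in> borel_measurable (lborel_on (insert i I))"
    and rm[measurable]: "r \<in> borel_measurable (lborel_on (insert i I))"
    and bal: "balanced (insert i I) f"
    and r0: "\<And>x. 0 \<le> r x" and rB: "\<And>x. r x \<le> B"
    and supp: "\<And>x j. r x \<noteq> 0 \<Longrightarrow> j \<in> insert i I \<Longrightarrow> \<bar>x j\<bar> \<le> K"
    and fr: "\<And>x y. x \<in> space (lborel_on (insert i I)) \<Longrightarrow> y \<in> space (lborel_on (insert i I)) \<Longrightarrow>
         f x * ennreal (r y) \<le> ennreal (exp (- (\<Sum>j\<in>insert i I. x j * y j)))"
  shows "(\<integral>\<^sup>+x. f x \<partial>lborel_on (insert i I)) * (\<integral>\<^sup>+x. r x \<partial>lborel_on (insert i I)) \<le> 4 * half_gauss\<^sup>2 * C"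
proof -
  let ?M = "lborel_on (insert i I)"
  let ?J = "insert i I"
  have fJ: "finite ?J" using I by simp
  have cm[measurable]: "(\<lambda>x. x j) \<in> borel_measurable ?M" if "j \<in> ?J" for j using that by simp
  define A where "A = PiE ?J (\<lambda>_. {-K..K})"
  have A: "A \<in> sets ?M" "emeasure ?M A < top"
  proof -
    show "A \<in> sets ?M" unfolding A_def using fJ by (intro sets_PiM_I_finite) auto
    have "emeasure ?M A = (\<Prod>j\<in>?J. emeasure lborel {-K..K})"
      unfolding A_def by (rule lborel_PiM.emeasure_PiM[OF fJ]) auto
    also have "\<dots> < top" by (simp add: emeasure_lborel_Icc_eq ennreal_power power_less_top_ennreal)
    finally show "emeasure ?M A < top" .
  qed
  have intg: "integrable ?M (\<lambda>x. p x * r x)"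
    if [measurable]: "p \<in> borel_measurable ?M" and D: "\<And>x. (\<forall>j\<in>?J. \<bar>x j\<bar> \<le> K) \<Longrightarrow> \<bar>p x\<bar> \<le> D" for p D
  proof (rule integrableI_bounded_set[where A=A and B="D * B"])
    show "AE x in ?M. x \<in> A \<longrightarrow> norm (p x * r x) \<le> D * B"
    proof (intro AE_I2 impI)
      fix x assume "x \<in> A"
      then have "\<bar>x j\<bar> \<le> K" if "j \<in> ?J" for j
        using PiE_mem[of x ?J "\<lambda>_. {-K..K}" j] that by (auto simp: A_def abs_le_iff)
      then have "\<bar>p x\<bar> \<le> D" using D by blast
      then show "norm (p x * r x) \<le> D * B"
        using r0[of x] rB[of x] abs_ge_zero[of "p x"] by (auto simp: abs_mult intro!: mult_mono)
    qed
    show "AE x in ?M. x \<notin> A \<longrightarrow> p x * r x = 0"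
    proof (intro AE_I2 impI)
      fix x assume x: "x \<in> space ?M" "x \<notin> A"
      have "r x = 0"
      proof (rule ccontr)
        assume "r x \<noteq> 0"
        then have "- K \<le> x j \<and> x j \<le> K" if "j \<in> ?J" for j using supp[of x j] that by (simp add: abs_le_iff)
        then show False using x by (auto simp: A_def space_PiM PiE_iff)
      qed
      then show "p x * r x = 0" by simp
    qed
  qed (use A in auto)
  have rint: "integrable ?M r" using intg[of "\<lambda>_. 1" 1] by simp
  define N where "N = (\<integral>x. r x \<partial>?M)"
  have N: "(\<integral>\<^sup>+x. r x \<partial>?M) = ennreal N" unfolding N_def by (rule nn_integral_eq_integral[OF rint]) (simp add: r0)
  have N0: "0 \<le> N" unfolding N_def using r0 by simp
  show ?thesis
  proof (cases "N = 0")
    case True then show ?thesis by (simp add: N)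
  next
    case False
    with N0 have Npos: "0 < N" by simp
    have null: "AE x in ?M. x i \<noteq> c" for c using AE_PiM_coordinate_neq[OF fJ] by simp
    obtain s where s: "(\<integral>x. indicator {0<..} (x i - s) * r x \<partial>?M) = N / 2"
      unfolding N_def
      by (rule exists_median[of "\<lambda>x. x i" ?M r K]) (use rint null r0 supp in auto)
    define E where "E e p = (\<integral>x. (p x * indicator {0<..} (e * (x i - s))) * r x \<partial>?M)" for e :: real and p :: "('i \<Rightarrow> real) \<Rightarrow> real"
    have Eint: "integrable ?M (\<lambda>x. (p x * indicator {0<..} (e * (x i - s))) * r x)"
      if "p \<in> borel_measurable ?M" and D: "\<And>x. (\<forall>j\<in>?J. \<bar>x j\<bar> \<le> K) \<Longrightarrow> \<bar>p x\<bar> \<le> D" for p D e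
    proof (rule intg)
      show "(\<lambda>x. p x * indicator {0<..} (e * (x i - s))) \<in> borel_measurable ?M" using that by measurable
      fix x :: "'i \<Rightarrow> real" assume "\<forall>j\<in>?J. \<bar>x j\<bar> \<le> K"
      then show "\<bar>p x * indicator {0<..} (e * (x i - s))\<bar> \<le> D" using D[of x] by (auto simp: indicator_def)
    qed
    have split: "AE x in ?M. indicator {0<..} (1 * (x i - s)) + indicator {0<..} (- 1 * (x i - s)) = (1::real)"
      using null[of s] by eventually_elim (auto simp: indicator_def)
    have E1: "E 1 (\<lambda>_. 1) = N / 2" using s by (simp add: E_def)
    have "E 1 (\<lambda>_. 1) + E (- 1) (\<lambda>_. 1) = (\<integral>x. (1 * indicator {0<..} (1 * (x i - s))) * r x + (1 * indicator {0<..} (- 1 * (x i - s))) * r x \<partial>?M)"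
      unfolding E_def by (rule Bochner_Integration.integral_add[symmetric]; rule Eint[where D=1]; simp)
    also have "\<dots> = N"
      unfolding N_def
    proof (rule integral_cong_AE)
      show "AE x in ?M. (1 * indicator {0<..} (1 * (x i - s))) * r x + (1 * indicator {0<..} (- 1 * (x i - s))) * r x = r x"
        using split by eventually_elim (simp add: distrib_right[symmetric] del: mult_minus_left)
    qed measurable
    finally have E2: "E (- 1) (\<lambda>_. 1) = N / 2" using E1 by simp
    have bdi: "\<bar>x i - s\<bar> \<le> K + \<bar>s\<bar>" if "\<forall>j\<in>?J. \<bar>x j\<bar> \<le> K" for x :: "'i \<Rightarrow> real"
      using that abs_triangle_ineq4[of "x i" s] by force
    define m where "m e = E e (\<lambda>x. x i - s)" for e
    have "m 1 - m (- 1) = (\<integral>x. ((x i - s) * indicator {0<..} (1 * (x i - s))) * r x - ((x i - s) * indicator {0<..} (- 1 * (x i - s))) * r x \<partial>?M)"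
      unfolding m_def E_def by (rule Bochner_Integration.integral_diff[symmetric]; rule Eint[OF _ bdi]; simp)
    also have "\<dots> = (\<integral>x. \<bar>x i - s\<bar> * r x \<partial>?M)"
      by (rule Bochner_Integration.integral_cong) (auto simp: indicator_def left_diff_distrib)
    finally have mm: "m 1 - m (- 1) = (\<integral>x. \<bar>x i - s\<bar> * r x \<partial>?M)" .
    \<comment> \<open>The difference is the integral of the distance to the hyperplane against
      \<open>r\<close>. It is nonzero because the hyperplane is a null set, so the two barycentres
      have different heights and the slope \<open>b\<close> below makes sense.\<close>
    have "m 1 - m (- 1) \<noteq> 0"
    proof
      assume "m 1 - m (- 1) = 0"
      then have "AE x in ?M. \<bar>x i - s\<bar> * r x = 0"
        unfolding mm using r0 by (subst (asm) integral_nonneg_eq_0_iff_AE) (auto intro!: intg[of _ "K + \<bar>s\<bar>"] bdi)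
      then have "AE x in ?M. r x = 0" using null[of s] by eventually_elim auto
      then have "N = 0" unfolding N_def by (subst integral_cong_AE[of _ _ "\<lambda>_. 0"]) auto
      with Npos show False by simp
    qed
    \<comment> \<open>\<open>a e\<close> and \<open>m e\<close> are the first moments of the two
      halves, \<open>m\<close> being measured from the median level. The line through the two
      barycentres has slope \<open>b\<close> and meets the median hyperplane at \<open>z\<close>.
      Both halves have mass \<open>N / 2\<close>, so the first moments of both vanish after the
      change of variables.\<close>
    define a where "a e j = E e (\<lambda>x. x j)" for e j
    define b where "b j = (a 1 j - a (- 1) j) / (m 1 - m (- 1))" for j
    define z where "z j = (a 1 j - m 1 * b j) / (N / 2)" for j
    have bD: "b j * (m 1 - m (- 1)) = a 1 j - a (- 1) j" for j
      unfolding b_def using \<open>m 1 - m (- 1) \<noteq> 0\<close> by simp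
    have zD: "z j * (N / 2) = a 1 j - m 1 * b j" for j
      unfolding z_def using Npos by simp
    define u where "u e j x = ((x j - z j - (x i - s) * b j) * indicator {0<..} (e * (x i - s))) * r x" for e :: real and j and x :: "'i \<Rightarrow> real"
    have u: "integrable ?M (u e j)" "(\<integral>x. u e j x \<partial>?M) = 0" if e: "e = 1 \<or> e = -1" and j: "j \<in> I" for e j
    proof -
      have 1: "integrable ?M (\<lambda>x. (x j * indicator {0<..} (e * (x i - s))) * r x)"
        using j by (intro Eint[of _ K]) auto
      have 2: "integrable ?M (\<lambda>x. (1 * indicator {0<..} (e * (x i - s))) * r x)"
        by (intro Eint[of _ 1]) auto
      have 3: "integrable ?M (\<lambda>x. ((x i - s) * indicator {0<..} (e * (x i - s))) * r x)"
        by (rule Eint[OF _ bdi]) auto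
      have eq: "u e j = (\<lambda>x. (x j * indicator {0<..} (e * (x i - s))) * r x - z j * ((1 * indicator {0<..} (e * (x i - s))) * r x)
           - b j * (((x i - s) * indicator {0<..} (e * (x i - s))) * r x))"
        by (auto simp: u_def fun_eq_iff algebra_simps)
      show "integrable ?M (u e j)" unfolding eq using 1 2 3 by (intro Bochner_Integration.integrable_diff integrable_mult_right)
      have "(\<integral>x. u e j x \<partial>?M) = a e j - z j * E e (\<lambda>_. 1) - b j * m e"
        unfolding eq a_def m_def E_def using 1 2 3
        by (simp only: Bochner_Integration.integral_diff integrable_mult_right Bochner_Integration.integrable_diff integral_mult_right_zero)
      also have "\<dots> = 0"
        using e E1 E2 zD[of j] bD[of j] by (auto simp: algebra_simps)
      finally show "(\<integral>x. u e j x \<partial>?M) = 0" .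
    qed
    define psi where "psi y = (\<lambda>j\<in>I. y j + (z j + y i * b j))(i := y i + s)" for y :: "'i \<Rightarrow> real"
    have psim[measurable]: "psi \<in> ?M \<rightarrow>\<^sub>M ?M" unfolding psi_def by measurable
    have psi: "(\<integral>\<^sup>+y. p (psi y) \<partial>?M) = (\<integral>\<^sup>+y. p y \<partial>?M)" if "p \<in> borel_measurable ?M" for p
      unfolding psi_def using that by (rule nn_integral_PiM_shear[OF I])
    have psii: "psi y i = y i + s" for y by (simp add: psi_def)
    have psij: "psi y j = y j + (z j + y i * b j)" if "j \<in> I" for y j using that I by (auto simp: psi_def)
    define phi where "phi x = x(i := x i - (\<Sum>j\<in>I. x j * b j))" for x :: "'i \<Rightarrow> real"
    have phim[measurable]: "phi \<in> ?M \<rightarrow>\<^sub>M ?M"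
      unfolding phi_def by (rule measurable_fun_upd[where J="?J"]) auto
    have phi: "(\<integral>\<^sup>+y. p (phi y) \<partial>?M) = (\<integral>\<^sup>+y. p y \<partial>?M)" if "p \<in> borel_measurable ?M" for p
      unfolding phi_def using that by (rule nn_integral_PiM_dual_shear[OF I])
    \<comment> \<open>Substituting \<open>psi\<close> into \<open>r\<close> and \<open>phi\<close>
      into \<open>f\<close> changes the inner product only by the term zz . phi x, which the
      exponential factor in \<open>f'\<close> absorbs.\<close>
    define zz where "zz = z(i := s)"
    define G where "G y = ennreal (r (psi y))" for y
    define f' where "f' x = f x * ennreal (exp (\<Sum>j\<in>?J. zz j * x j))" for x
    have f'm[measurable]: "f' \<in> borel_measurable ?M" unfolding f'_def by measurable
    have dual: "(\<Sum>j\<in>?J. phi x j * psi y j) = (\<Sum>j\<in>?J. y j * x j) + (\<Sum>j\<in>?J. zz j * phi x j)" for x y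
    proof -
      have p: "phi x i = x i - (\<Sum>j\<in>I. x j * b j)" "\<And>j. j \<in> I \<Longrightarrow> phi x j = x j"
        using I by (auto simp: phi_def)
      have zz: "zz i = s" "\<And>j. j \<in> I \<Longrightarrow> zz j = z j" using I by (auto simp: zz_def)
      have "(\<Sum>j\<in>I. phi x j * psi y j) = (\<Sum>j\<in>I. y j * x j + zz j * phi x j + y i * (x j * b j))"
        by (rule sum.cong) (auto simp: p psij zz algebra_simps)
      also have "\<dots> = (\<Sum>j\<in>I. y j * x j) + (\<Sum>j\<in>I. zz j * phi x j) + y i * (\<Sum>j\<in>I. x j * b j)"
        by (simp add: sum.distrib sum_distrib_left)
      finally show ?thesis
        using I by (simp add: p psii zz algebra_simps)
    qed
    have half: "(N / 2) * (\<integral>\<^sup>+x. f' (phi x) * indicator {0<..} (e * x i) \<partial>?M) \<le> half_gauss\<^sup>2 * C" if e: "e = 1 \<or> e = -1" for e :: real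
    proof -
      have mass: "(\<integral>\<^sup>+x. G x * indicator {0<..} (e * x i) \<partial>?M) = ennreal (N / 2)"
      proof -
        have "(\<integral>\<^sup>+x. G x * indicator {0<..} (e * x i) \<partial>?M) = (\<integral>\<^sup>+x. ennreal (r (psi x)) * indicator {0<..} (e * (psi x i - s)) \<partial>?M)"
          by (simp add: G_def psii)
        also have "\<dots> = (\<integral>\<^sup>+x. ennreal (r x) * indicator {0<..} (e * (x i - s)) \<partial>?M)"
          by (rule psi[of "\<lambda>x. ennreal (r x) * indicator {0<..} (e * (x i - s))"]) measurable
        also have "\<dots> = (\<integral>\<^sup>+x. ennreal ((1 * indicator {0<..} (e * (x i - s))) * r x) \<partial>?M)"
          by (rule nn_integral_cong) (auto simp: indicator_def)
        also have "\<dots> = ennreal (E e (\<lambda>_. 1))"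
          unfolding E_def by (rule nn_integral_eq_integral[OF Eint[where D=1]]) (auto simp: r0)
        finally show ?thesis using e E1 E2 by auto
      qed
      have mom: "(\<integral>\<^sup>+x. ennreal (d * x j) * (G x * indicator {0<..} (e * x i)) \<partial>?M) = (\<integral>\<^sup>+x. ennreal (d * u e j x) \<partial>?M)"
        if j: "j \<in> I" for d j
      proof -
        have "(\<integral>\<^sup>+x. ennreal (d * x j) * (G x * indicator {0<..} (e * x i)) \<partial>?M) = (\<integral>\<^sup>+x. ennreal (d * u e j (psi x)) \<partial>?M)"
        proof (rule nn_integral_cong)
          fix x
          have "u e j (psi x) = (x j * indicator {0<..} (e * x i)) * r (psi x)"
            using j by (simp add: u_def psii psij)
          then show "ennreal (d * x j) * (G x * indicator {0<..} (e * x i)) = ennreal (d * u e j (psi x))"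
            using ennreal_mult''[OF r0, of "d * x j" "psi x"] by (simp add: G_def indicator_def mult.assoc)
        qed
        also have "\<dots> = (\<integral>\<^sup>+x. ennreal (d * u e j x) \<partial>?M)"
          by (rule psi) (use u(1)[OF e j] in measurable)
        finally show ?thesis .
      qed
      have "(\<integral>\<^sup>+x. G x * indicator {0<..} (e * x i) \<partial>?M) * (\<integral>\<^sup>+x. f' (phi x) * indicator {0<..} (e * x i) \<partial>?M) \<le> half_gauss\<^sup>2 * C"
      proof (rule half_space_bound[OF I IH _ _ e])
        fix j assume j: "j \<in> I"
        note nn = integral_zero_nn_integral[OF u[OF e j]]
        show "(\<integral>\<^sup>+x. ennreal (x j) * (G x * indicator {0<..} (e * x i)) \<partial>?M) = (\<integral>\<^sup>+x. ennreal (- x j) * (G x * indicator {0<..} (e * x i)) \<partial>?M)"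
          using mom[OF j, of 1] mom[OF j, of "-1"] nn(1) by simp
        show "(\<integral>\<^sup>+x. ennreal (x j) * (G x * indicator {0<..} (e * x i)) \<partial>?M) < top"
          using mom[OF j, of 1] nn(2) by simp
      next
        fix x y assume xy[measurable]: "x \<in> space ?M" "y \<in> space ?M"
        have sp: "psi x \<in> space ?M" "phi y \<in> space ?M" using xy measurable_space[OF psim] measurable_space[OF phim] by auto
        have "G x * f' (phi y) = (f (phi y) * ennreal (r (psi x))) * ennreal (exp (\<Sum>j\<in>?J. zz j * phi y j))"
          by (simp add: G_def f'_def mult_ac)
        also have "\<dots> \<le> ennreal (exp (- (\<Sum>j\<in>?J. phi y j * psi x j))) * ennreal (exp (\<Sum>j\<in>?J. zz j * phi y j))"
          by (intro mult_right_mono fr sp) simp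
        also have "\<dots> = ennreal (exp (- (\<Sum>j\<in>?J. x j * y j)))"
          unfolding dual by (simp add: ennreal_mult'[symmetric] exp_add[symmetric] del: sum.insert)
        finally show "G x * f' (phi y) \<le> ennreal (exp (- (\<Sum>j\<in>?J. x j * y j)))" .
      next
        show "G \<in> borel_measurable ?M" unfolding G_def by measurable
        show "(\<lambda>x. f' (phi x)) \<in> borel_measurable ?M" by measurable
      qed
      then show ?thesis by (simp add: mass)
    qed
    \<comment> \<open>This is the place where the barycentre condition on \<open>f\<close>
      enters.\<close>
    have "(\<integral>\<^sup>+x. f x \<partial>?M) \<le> (\<integral>\<^sup>+x. f' x \<partial>?M)"
      unfolding f'_def by (rule balanced_exp[OF fJ fm bal])
    also have "\<dots> = (\<integral>\<^sup>+x. f' (phi x) \<partial>?M)" by (rule phi[symmetric]) measurable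
    also have "\<dots> = (\<integral>\<^sup>+x. f' (phi x) * indicator {0<..} (1 * x i) + f' (phi x) * indicator {0<..} (- 1 * x i) \<partial>?M)"
      by (rule nn_integral_cong_AE) (use null[of 0] in \<open>eventually_elim; auto simp: indicator_def\<close>)
    also have "\<dots> = (\<integral>\<^sup>+x. f' (phi x) * indicator {0<..} (1 * x i) \<partial>?M) + (\<integral>\<^sup>+x. f' (phi x) * indicator {0<..} (- 1 * x i) \<partial>?M)"
      by (rule nn_integral_add) measurable
    finally have "(\<integral>\<^sup>+x. f x \<partial>?M) \<le> \<dots>" .
    then have "ennreal (N / 2) * (\<integral>\<^sup>+x. f x \<partial>?M)
       \<le> ennreal (N / 2) * ((\<integral>\<^sup>+x. f' (phi x) * indicator {0<..} (1 * x i) \<partial>?M) + (\<integral>\<^sup>+x. f' (phi x) * indicator {0<..} (- 1 * x i) \<partial>?M))"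
      by (rule mult_left_mono) simp
    also have "\<dots> \<le> half_gauss\<^sup>2 * C + half_gauss\<^sup>2 * C"
      unfolding distrib_left by (intro add_mono half) auto
    \<comment> \<open>The two halves together give twice the bound for half of the mass of
      \<open>r\<close>, hence the factor 4.\<close>
    finally have "2 * (ennreal (N / 2) * (\<integral>\<^sup>+x. f x \<partial>?M)) \<le> 2 * (half_gauss\<^sup>2 * C + half_gauss\<^sup>2 * C)"
      by (rule mult_left_mono) simp
    moreover have "2 * ennreal (N / 2) = ennreal N"
      using N0 by (simp add: ennreal_mult'[symmetric] flip: ennreal_numeral)
    ultimately have "ennreal N * (\<integral>\<^sup>+x. f x \<partial>?M) \<le> 2 * (half_gauss\<^sup>2 * C + half_gauss\<^sup>2 * C)"
      by (simp add: mult.assoc[symmetric])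
    also have "half_gauss\<^sup>2 * C + half_gauss\<^sup>2 * C = 2 * (half_gauss\<^sup>2 * C)" by (simp add: mult_2)
    finally show ?thesis by (simp add: N mult_ac)
  qed
qed

text \<open>Truncating \<open>g\<close> in height and in support makes \<open>santalo_step\<close>
  applicable, and monotone convergence removes the truncation. Each coordinate contributes
  \<open>4 * half_gauss\<^sup>2\<close>, so the bound is the square of a full Gaussian integral in
  dimension \<open>card I\<close>.\<close>

theorem functional_santalo:
  fixes f g :: "('i \<Rightarrow> real) \<Rightarrow> ennreal"
  assumes "finite I" "f \<in> borel_measurable (lborel_on I)" "g \<in> borel_measurable (lborel_on I)"
    and "balanced I f"
    and "\<And>x y. x \<in> space (lborel_on I) \<Longrightarrow> y \<in> space (lborel_on I) \<Longrightarrow>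
         f x * g y \<le> ennreal (exp (- (\<Sum>j\<in>I. x j * y j)))"
  shows "(\<integral>\<^sup>+x. f x \<partial>lborel_on I) * (\<integral>\<^sup>+x. g x \<partial>lborel_on I)
       \<le> (2 * half_gauss) ^ (2 * card I)"
  using assms
proof (induction I arbitrary: f g rule: finite_induct)
  case empty
  from empty(4)[of "\<lambda>_. undefined" "\<lambda>_. undefined"] show ?case
    by (simp add: lborel_PiM.nn_integral_empty space_PiM)
next
  case (insert i I)
  let ?M = "lborel_on (insert i I)"
  note [measurable] = insert.prems(1,2)
  define box where "box k = {x :: 'i \<Rightarrow> real. \<forall>j\<in>insert i I. \<bar>x j\<bar> \<le> real k}" for k
  define r where "r k x = enn2real (min (g x) (of_nat k)) * indicator (box k) x" for k x
  have rm[measurable]: "r k \<in> borel_measurable ?M" for k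
  proof -
    \<comment> \<open>\<open>box k\<close> consists of arbitrary functions, not only of points of
      the product space. Its indicator is therefore written as a product over the coordinates to
      obtain measurability.\<close>
    have "(\<lambda>x. enn2real (min (g x) (of_nat k)) * (\<Prod>j\<in>insert i I. indicator {- real k..real k} (x j))) \<in> borel_measurable ?M"
      by measurable
    also have "(\<lambda>x. enn2real (min (g x) (of_nat k)) * (\<Prod>j\<in>insert i I. indicator {- real k..real k} (x j))) = r k"
    proof
      fix x
      have "(\<Prod>j\<in>insert i I. indicator {- real k..real k} (x j)) = (indicator (box k) x :: real)"
      proof (cases "x \<in> box k")
        case True
        then have "(\<Prod>j\<in>insert i I. indicator {- real k..real k} (x j)) = (\<Prod>j\<in>insert i I. 1 :: real)"
          by (intro prod.cong) (auto simp: box_def indicator_def abs_le_iff)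
        then show ?thesis using True by simp
      next
        case False
        then obtain j where "j \<in> insert i I" "x j \<notin> {- real k..real k}" by (auto simp: box_def abs_le_iff minus_le_iff)
        then have "(\<Prod>j\<in>insert i I. indicator {- real k..real k} (x j)) = (0 :: real)"
          using insert(1) by (intro prod_zero bexI[of _ j]) auto
        then show ?thesis using False by simp
      qed
      then show "enn2real (min (g x) (of_nat k)) * (\<Prod>j\<in>insert i I. indicator {- real k..real k} (x j)) = r k x"
        by (simp add: r_def)
    qed
    finally show ?thesis .
  qed
  have e: "ennreal (r k x) = min (g x) (of_nat k) * indicator (box k) x" for k x
  proof -
    have "ennreal (enn2real (min (g x) (of_nat k))) = min (g x) (of_nat k)"
      by (rule ennreal_enn2real) (simp add: min_less_iff_disj of_nat_less_top)
    then show ?thesis by (simp add: r_def indicator_def)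
  qed
  have step: "(\<integral>\<^sup>+x. f x \<partial>?M) * (\<integral>\<^sup>+x. r k x \<partial>?M) \<le> (2 * half_gauss) ^ (2 * card (insert i I))" for k
  proof -
    have "(\<integral>\<^sup>+x. f x \<partial>?M) * (\<integral>\<^sup>+x. r k x \<partial>?M) \<le> 4 * half_gauss\<^sup>2 * (2 * half_gauss) ^ (2 * card I)"
    proof (rule santalo_step[OF insert(1,2) insert.IH insert.prems(1) rm insert.prems(3), where B="real k" and K="real k"])
      show "0 \<le> r k x" for x by (simp add: r_def)
      show "r k x \<le> real k" for x
      proof -
        have "ennreal (r k x) \<le> ennreal (real k)"
          unfolding e by (auto simp: indicator_def ennreal_of_nat_eq_real_of_nat)
        then show ?thesis by simp
      qed
      show "\<bar>x j\<bar> \<le> real k" if "r k x \<noteq> 0" "j \<in> insert i I" for x j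
        using that by (auto simp: r_def box_def indicator_def split: if_splits)
      fix x y assume "x \<in> space ?M" "y \<in> space ?M"
      have "f x * ennreal (r k y) \<le> f x * g y"
        unfolding e by (rule mult_left_mono) (auto simp: indicator_def)
      also have "\<dots> \<le> ennreal (exp (- (\<Sum>j\<in>insert i I. x j * y j)))" by (rule insert.prems(4)) fact+
      finally show "f x * ennreal (r k y) \<le> ennreal (exp (- (\<Sum>j\<in>insert i I. x j * y j)))" .
    qed
    also have "\<dots> = (2 * half_gauss) ^ (2 * card (insert i I))"
      using insert(1,2) by (simp add: power2_eq_square mult_ac)
    finally show ?thesis .
  qed
  have "(\<integral>\<^sup>+x. g x \<partial>?M) = (\<integral>\<^sup>+x. (SUP k. ennreal (r k x)) \<partial>?M)"
  proof (rule nn_integral_cong)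
    fix x :: "'i \<Rightarrow> real"
    have "finite ((\<lambda>j. \<bar>x j\<bar>) ` insert i I)" using insert(1) by simp
    then have m: "\<bar>x j\<bar> \<le> Max ((\<lambda>j. \<bar>x j\<bar>) ` insert i I)" if "j \<in> insert i I" for j
      by (rule Max_ge) (use that in blast)
    obtain n :: nat where "Max ((\<lambda>j. \<bar>x j\<bar>) ` insert i I) \<le> real n" using real_arch_simple by blast
    then have n: "\<bar>x j\<bar> \<le> real n" if "j \<in> insert i I" for j using m[OF that] by linarith
    have "g x = (SUP k. min (g x) (of_nat k))"
      using inf_SUP[of "g x" "of_nat" "UNIV::nat set"] by (simp add: inf_min ennreal_SUP_of_nat_eq_top)
    also have "\<dots> \<le> (SUP k. ennreal (r k x))"
    proof (rule SUP_least)
      fix k :: nat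
      \<comment> \<open>One index governs both height and support, so it has to exceed
        \<open>k\<close> as well as all coordinates of \<open>x\<close>.\<close>
      have "x \<in> box (max k n)" using n by (auto simp: box_def of_nat_max le_max_iff_disj)
      then have "min (g x) (of_nat k) \<le> ennreal (r (max k n) x)"
        unfolding e by (auto simp: intro: min.coboundedI2)
      then show "min (g x) (of_nat k) \<le> (SUP k. ennreal (r k x))" by (rule SUP_upper2[OF UNIV_I])
    qed
    finally have "g x \<le> (SUP k. ennreal (r k x))" .
    moreover have "(SUP k. ennreal (r k x)) \<le> g x" unfolding e by (rule SUP_least) (auto simp: indicator_def)
    ultimately show "g x = (SUP k. ennreal (r k x))" by simp
  qed
  also have "\<dots> = (SUP k. \<integral>\<^sup>+x. r k x \<partial>?M)"
  proof (rule nn_integral_monotone_convergence_SUP)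
    show "incseq (\<lambda>k x. ennreal (r k x))"
    proof (intro monoI le_funI)
      fix k l :: nat and x assume kl: "k \<le> l"
      then have "x \<in> box k \<Longrightarrow> x \<in> box l" by (force simp: box_def)
      then show "ennreal (r k x) \<le> ennreal (r l x)"
        unfolding e using kl by (intro mult_mono indicator_leI) (auto intro: min.coboundedI2)
    qed
  qed measurable
  finally show ?case using step by (auto simp: SUP_mult_left_ennreal intro!: SUP_least)
qed

section \<open>Blaschke-Santalo inequality\<close>

lemma measurable_vec_lambda [measurable]:
  "vec_lambda \<in> PiM UNIV (\<lambda>_. lborel :: 'a::euclidean_space measure) \<rightarrow>\<^sub>M (borel :: ('a ^ 'n) measure)"
  by (subst borel_measurable_euclidean_space) (auto simp: Basis_vec_def inner_axis)

lemma prod_Basis_vec: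
  "(\<Prod>b\<in>Basis. F b) = (\<Prod>i\<in>UNIV. \<Prod>b\<in>Basis. F (axis i b))" for F :: "'a::euclidean_space ^ 'n \<Rightarrow> 'b::comm_monoid_mult"
proof -
  have "(\<Prod>i\<in>UNIV. \<Prod>b\<in>Basis. F (axis i b)) = (\<Prod>(i,b)\<in>UNIV \<times> Basis. F (axis i b :: 'a ^ 'n))"
    by (simp add: prod.cartesian_product)
  also have "\<dots> = (\<Prod>b\<in>(\<lambda>(i,b). axis i b) ` (UNIV \<times> Basis). F b)"
    by (subst prod.reindex) (auto simp: inj_on_def axis_eq_axis nonzero_Basis split_def)
  also have "(\<lambda>(i,b). axis i b) ` (UNIV \<times> Basis) = (Basis :: ('a ^ 'n) set)"
    by (auto simp: Basis_vec_def)
  finally show ?thesis ..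
qed

text \<open>The entries may themselves be vectors, since matrices are vectors of rows and a whole
  row will be split off at once.\<close>

lemma lborel_vec: "lborel = distr (PiM UNIV (\<lambda>_. lborel)) borel (vec_lambda :: ('n::finite \<Rightarrow> 'a::euclidean_space) \<Rightarrow> 'a ^ 'n)"
proof (rule lborel_eqI)
  fix l u :: "'a ^ 'n" assume lu: "\<And>b. b \<in> Basis \<Longrightarrow> l \<bullet> b \<le> u \<bullet> b"
  let ?M = "PiM (UNIV :: 'n set) (\<lambda>_. lborel :: 'a measure)"
  have le: "l $ i \<bullet> b \<le> u $ i \<bullet> b" if "b \<in> Basis" for i b
    using lu[of "axis i b"] that by (auto simp: inner_axis Basis_vec_def)
  have "vec_lambda -` box l u \<inter> space ?M = PiE UNIV (\<lambda>i. box (l $ i) (u $ i))"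
    by (auto simp: space_PiM box_def Basis_vec_def inner_axis PiE_iff)
  then have "emeasure (distr ?M borel vec_lambda) (box l u) = emeasure ?M (PiE UNIV (\<lambda>i. box (l $ i) (u $ i)))"
    by (simp add: emeasure_distr)
  also have "\<dots> = (\<Prod>i\<in>UNIV. emeasure lborel (box (l $ i) (u $ i)))"
    by (intro lborel_PiM.emeasure_PiM) auto
  also have "\<dots> = (\<Prod>i\<in>UNIV. ennreal (\<Prod>b\<in>Basis. (u $ i - l $ i) \<bullet> b))"
    using le by (intro prod.cong) (auto simp: emeasure_lborel_box)
  also have "\<dots> = ennreal (\<Prod>i\<in>UNIV. \<Prod>b\<in>Basis. (u $ i - l $ i) \<bullet> b)"
    using le by (intro prod_ennreal prod_nonneg) (auto simp: inner_diff_left)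
  also have "(\<Prod>i\<in>UNIV. \<Prod>b\<in>Basis. (u $ i - l $ i) \<bullet> b) = (\<Prod>b\<in>Basis. (u - l) \<bullet> b)"
    by (simp add: prod_Basis_vec inner_axis)
  finally show "emeasure (distr ?M borel vec_lambda) (box l u) = ennreal (\<Prod>b\<in>Basis. (u - l) \<bullet> b)" .
qed simp

lemma nn_integral_lborel_vec:
  fixes f :: "'a::euclidean_space ^ 'n \<Rightarrow> ennreal"
  assumes "f \<in> borel_measurable borel"
  shows "(\<integral>\<^sup>+x. f x \<partial>lborel) = (\<integral>\<^sup>+x. f (vec_lambda x) \<partial>PiM UNIV (\<lambda>_. lborel))"
  by (subst lborel_vec, subst nn_integral_distr) (use assms in auto)

theorem functional_santalo_vec:
  fixes f g :: "real ^ 'n \<Rightarrow> ennreal"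
  assumes [measurable]: "f \<in> borel_measurable borel" "g \<in> borel_measurable borel"
    and bal: "\<And>i. (\<integral>\<^sup>+x. ennreal (x $ i) * f x \<partial>lborel) = (\<integral>\<^sup>+x. ennreal (- x $ i) * f x \<partial>lborel)"
      "\<And>i. (\<integral>\<^sup>+x. ennreal (x $ i) * f x \<partial>lborel) < top"
    and fg: "\<And>x y. f x * g y \<le> ennreal (exp (- (x \<bullet> y)))"
  shows "(\<integral>\<^sup>+x. f x \<partial>lborel) * (\<integral>\<^sup>+x. g x \<partial>lborel) \<le> (2 * half_gauss) ^ (2 * CARD('n))"
  unfolding nn_integral_lborel_vec[OF assms(1)] nn_integral_lborel_vec[OF assms(2)]
proof (rule functional_santalo)
  show "balanced UNIV (\<lambda>x. f (vec_lambda x))"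
    using bal by (simp add: balanced_def nn_integral_lborel_vec)
  show "f (vec_lambda x) * g (vec_lambda y) \<le> ennreal (exp (- (\<Sum>j\<in>UNIV. x j * y j)))" for x y
    using fg[of "vec_lambda x" "vec_lambda y"] by (simp add: inner_vec_def)
qed measurable

lemma nn_integral_gauss_line: "(\<integral>\<^sup>+s. ennreal (exp (- (s\<^sup>2) / 2)) \<partial>lborel) = 2 * half_gauss"
proof -
  have "(\<integral>\<^sup>+s. ennreal (exp (- (s\<^sup>2) / 2)) \<partial>lborel)
      = (\<integral>\<^sup>+s. ennreal (exp (- (s\<^sup>2) / 2)) * indicator {0<..} s + ennreal (exp (- (s\<^sup>2) / 2)) * indicator {0<..} (- s) \<partial>lborel)"
  proof (rule nn_integral_cong_AE)
    show "AE s in lborel. ennreal (exp (- (s\<^sup>2) / 2)) = ennreal (exp (- (s\<^sup>2) / 2)) * indicator {0<..} s + ennreal (exp (- (s\<^sup>2) / 2)) * indicator {0<..} (- s)"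
      using AE_lborel_singleton[of "0::real"] by eventually_elim (auto simp: indicator_def)
  qed
  also have "\<dots> = half_gauss + (\<integral>\<^sup>+s. ennreal (exp (- (s\<^sup>2) / 2)) * indicator {0<..} (- s) \<partial>lborel)"
    unfolding half_gauss_def by (rule nn_integral_add) measurable
  also have "(\<integral>\<^sup>+s. ennreal (exp (- (s\<^sup>2) / 2)) * indicator {0<..} (- s) \<partial>lborel) = half_gauss"
    using nn_integral_real_affine[of "\<lambda>s. ennreal (exp (- (s\<^sup>2) / 2)) * indicator {0<..} (- s)" "-1" 0]
    by (simp add: half_gauss_def)
  finally show ?thesis by (simp add: mult_2)
qed

lemma nn_integral_gauss_vec:
  "(\<integral>\<^sup>+x. ennreal (exp (- ((norm x)\<^sup>2) / 2)) \<partial>(lborel :: (real ^ 'n) measure)) = (2 * half_gauss) ^ CARD('n)"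
proof -
  have "(\<integral>\<^sup>+x. ennreal (exp (- ((norm x)\<^sup>2) / 2)) \<partial>(lborel :: (real ^ 'n) measure))
      = (\<integral>\<^sup>+x. (\<Prod>i\<in>UNIV. ennreal (exp (- ((x i)\<^sup>2) / 2))) \<partial>PiM (UNIV :: 'n set) (\<lambda>_. lborel))"
  proof (subst nn_integral_lborel_vec, measurable, rule nn_integral_cong)
    fix x :: "'n \<Rightarrow> real"
    have "(norm (vec_lambda x :: real ^ 'n))\<^sup>2 = (\<Sum>i\<in>UNIV. (x i)\<^sup>2)"
      by (simp add: norm_vec_def L2_set_def sum_nonneg)
    then have "- ((norm (vec_lambda x :: real ^ 'n))\<^sup>2) / 2 = (\<Sum>i\<in>UNIV. - ((x i)\<^sup>2) / 2)"
      by (simp add: sum_divide_distrib sum_negf)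
    then have "exp (- ((norm (vec_lambda x :: real ^ 'n))\<^sup>2) / 2) = (\<Prod>i\<in>UNIV. exp (- ((x i)\<^sup>2) / 2))"
      by (simp only: exp_sum finite)
    then show "ennreal (exp (- ((norm (vec_lambda x :: real ^ 'n))\<^sup>2) / 2)) = (\<Prod>i\<in>UNIV. ennreal (exp (- ((x i)\<^sup>2) / 2)))"
      by (simp only: prod_ennreal exp_ge_zero)
  qed
  also have "\<dots> = (\<Prod>i\<in>(UNIV :: 'n set). (\<integral>\<^sup>+s. ennreal (exp (- (s\<^sup>2) / 2)) \<partial>lborel))"
    by (rule lborel_PiM.product_nn_integral_prod) auto
  finally show ?thesis unfolding nn_integral_gauss_line prod_constant .
qed

section \<open>Functions attached to bodies\<close>

lemma nn_integral_lborel_scale: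
  fixes f :: "'a::euclidean_space \<Rightarrow> ennreal"
  assumes [measurable]: "f \<in> borel_measurable borel" and c: "0 < c"
  shows "(\<integral>\<^sup>+x. f x \<partial>lborel) = ennreal (c ^ DIM('a)) * (\<integral>\<^sup>+x. f (c *\<^sub>R x) \<partial>lborel)"
proof -
  have "(\<integral>\<^sup>+x. f x \<partial>lborel) = (\<integral>\<^sup>+x. f x \<partial>density (distr lborel borel (\<lambda>x. 0 + c *\<^sub>R x)) (\<lambda>_. \<bar>c\<bar> ^ DIM('a)))"
    using c by (subst lborel_affine[of c 0]) auto
  also have "\<dots> = ennreal (c ^ DIM('a)) * (\<integral>\<^sup>+x. f (c *\<^sub>R x) \<partial>lborel)"
    using c by (simp add: nn_integral_density nn_integral_distr nn_integral_cmult)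
  finally show ?thesis .
qed

text \<open>Up to normalisation this is a radial function of the gauge of \<open>K\<close>; writing it as a
  superposition of indicators of dilates avoids the gauge itself.\<close>

definition layers :: "(real \<Rightarrow> ennreal) \<Rightarrow> 'a::euclidean_space set \<Rightarrow> 'a \<Rightarrow> ennreal" where
  "layers w K x = (\<integral>\<^sup>+s. w s * (indicator {0<..} s * indicator K (inverse s *\<^sub>R x)) \<partial>lborel)"

lemma borel_measurable_layers [measurable]:
  assumes [measurable]: "w \<in> borel_measurable borel" "K \<in> sets borel"
  shows "layers w K \<in> borel_measurable borel"
proof -
  have "(\<lambda>x. \<integral>\<^sup>+s. w s * (indicator {0<..} s * indicator K (inverse s *\<^sub>R x)) \<partial>lborel) \<in> borel_measurable borel"
    by measurable
  then show ?thesis unfolding layers_def[abs_def] .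
qed

text \<open>Rescaling each dilate of \<open>K\<close> separates a radial integral from the integral
  over \<open>K\<close>. Degree \<open>d = 0\<close> gives volumes and \<open>d = 1\<close> the
  positive and negative parts of coordinates, so a barycentre condition passes between a body and
  its layered function.\<close>

lemma nn_integral_layers:
  fixes K :: "'a::euclidean_space set"
  assumes [measurable]: "w \<in> borel_measurable borel" "K \<in> sets borel" "p \<in> borel_measurable borel"
    and p: "\<And>s x. 0 < s \<Longrightarrow> p (s *\<^sub>R x) = ennreal (s ^ d) * p x"
  shows "(\<integral>\<^sup>+x. p x * layers w K x \<partial>lborel)
       = (\<integral>\<^sup>+s. w s * ennreal (s ^ (DIM('a) + d)) * indicator {0<..} s \<partial>lborel) * (\<integral>\<^sup>+x. p x * indicator K x \<partial>lborel)"
proof -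
  have "(\<integral>\<^sup>+x. p x * layers w K x \<partial>lborel)
      = (\<integral>\<^sup>+x. (\<integral>\<^sup>+s. p x * (w s * (indicator {0<..} s * indicator K (inverse s *\<^sub>R x))) \<partial>lborel) \<partial>lborel)"
    unfolding layers_def by (intro nn_integral_cong nn_integral_cmult[symmetric]) measurable
  also have "\<dots> = (\<integral>\<^sup>+s. (\<integral>\<^sup>+x. p x * (w s * (indicator {0<..} s * indicator K (inverse s *\<^sub>R x))) \<partial>lborel) \<partial>lborel)"
    by (rule lborel_pair.Fubini') measurable
  also have "\<dots> = (\<integral>\<^sup>+s. w s * ennreal (s ^ (DIM('a) + d)) * indicator {0<..} s * (\<integral>\<^sup>+x. p x * indicator K x \<partial>lborel) \<partial>lborel)"
  proof (rule nn_integral_cong)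
    fix s :: real
    show "(\<integral>\<^sup>+x. p x * (w s * (indicator {0<..} s * indicator K (inverse s *\<^sub>R x))) \<partial>lborel)
        = w s * ennreal (s ^ (DIM('a) + d)) * indicator {0<..} s * (\<integral>\<^sup>+x. p x * indicator K x \<partial>lborel)"
    proof (cases "0 < s")
      case True
      have "(\<integral>\<^sup>+x. p x * (w s * (indicator {0<..} s * indicator K (inverse s *\<^sub>R x))) \<partial>lborel)
          = ennreal (s ^ DIM('a)) * (\<integral>\<^sup>+x. p (s *\<^sub>R x) * (w s * (indicator {0<..} s * indicator K (inverse s *\<^sub>R s *\<^sub>R x))) \<partial>lborel)"
        by (rule nn_integral_lborel_scale[OF _ True]) measurable
      also have "\<dots> = ennreal (s ^ DIM('a)) * (\<integral>\<^sup>+x. (ennreal (s ^ d) * w s) * (p x * indicator K x) \<partial>lborel)"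
        using True by (simp add: p mult_ac)
      also have "\<dots> = ennreal (s ^ DIM('a)) * ((ennreal (s ^ d) * w s) * (\<integral>\<^sup>+x. p x * indicator K x \<partial>lborel))"
        by (subst nn_integral_cmult) measurable
      finally show ?thesis using True by (simp add: power_add ennreal_mult mult_ac)
    qed simp
  qed
  also have "\<dots> = (\<integral>\<^sup>+s. w s * ennreal (s ^ (DIM('a) + d)) * indicator {0<..} s \<partial>lborel) * (\<integral>\<^sup>+x. p x * indicator K x \<partial>lborel)"
    by (rule nn_integral_multc) measurable
  finally show ?thesis .
qed

lemma emeasure_layers:
  fixes K :: "'a::euclidean_space set"
  assumes [measurable]: "w \<in> borel_measurable borel" "K \<in> sets borel"
  shows "(\<integral>\<^sup>+x. layers w K x \<partial>lborel)
       = (\<integral>\<^sup>+s. w s * ennreal (s ^ DIM('a)) * indicator {0<..} s \<partial>lborel) * emeasure lborel K"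
  using nn_integral_layers[of w K "\<lambda>_. 1" 0] by simp

text \<open>Minus the derivative of exp (- s^2 / 2), so that the layers of the unit ball add up to
  the Gaussian. For negative \<open>s\<close> the value is 0 by the convention of
  \<open>ennreal\<close>.\<close>

definition gauss_weight :: "real \<Rightarrow> ennreal" where
  "gauss_weight s = ennreal (s * exp (- (s\<^sup>2) / 2))"

lemma borel_measurable_gauss_weight [measurable]: "gauss_weight \<in> borel_measurable borel"
  unfolding gauss_weight_def by measurable

lemma nn_integral_gauss_weight_tail:
  assumes "0 \<le> c"
  shows "(\<integral>\<^sup>+s. gauss_weight s * indicator {c..} s \<partial>lborel) = ennreal (exp (- (c\<^sup>2) / 2))"
proof -
  have "(\<integral>\<^sup>+s. ennreal (s * exp (- (s\<^sup>2) / 2)) * indicator {c..} s \<partial>lborel) = ennreal (0 - (- exp (- (c\<^sup>2) / 2)))"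
  proof (rule nn_integral_FTC_atLeast)
    show "((\<lambda>s. - exp (- (s\<^sup>2) / 2)) \<longlongrightarrow> (0::real)) at_top"
    proof -
      have "LIM s at_top. - (1/2) * (s::real)\<^sup>2 :> at_bot"
        by (rule filterlim_tendsto_neg_mult_at_bot[OF tendsto_const]) (auto intro!: filterlim_pow_at_top filterlim_ident)
      then have "((\<lambda>s. exp (- (1/2) * s\<^sup>2)) \<longlongrightarrow> (0::real)) at_top"
        by (rule filterlim_compose[OF exp_at_bot])
      then show ?thesis using tendsto_minus[of "\<lambda>s. exp (- (1/2) * s\<^sup>2)" "0::real"] by simp
    qed
    show "((\<lambda>s. - exp (- (s\<^sup>2) / 2)) has_real_derivative x * exp (- (x\<^sup>2) / 2)) (at x)" for x :: real
      by (auto intro!: derivative_eq_intros)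
  qed (use assms in auto)
  then show ?thesis by (simp add: gauss_weight_def)
qed

text \<open>The infima \<open>a\<close> and \<open>b\<close> play the role of the gauges of
  \<open>x\<close> and \<open>y\<close>. The layered functions are at most exp (- a^2 / 2) and exp
  (- b^2 / 2), polarity gives x . y <= a b, and a b <= (a^2 + b^2) / 2. If no dilate contains the
  point, the product is 0.\<close>

lemma layers_gauss_le:
  fixes K P :: "'a::euclidean_space set"
  assumes KP: "\<And>x y. x \<in> K \<Longrightarrow> y \<in> P \<Longrightarrow> x \<bullet> y \<le> 1"
  shows "layers gauss_weight K x * layers gauss_weight P y \<le> ennreal (exp (- (x \<bullet> y)))"
proof -
  define S where "S K x = {s. 0 < s \<and> inverse s *\<^sub>R x \<in> K}" for K and x :: 'a
  have lay: "layers gauss_weight K x = (\<integral>\<^sup>+s. gauss_weight s * indicator (S K x) s \<partial>lborel)" for K and x :: 'a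
    unfolding layers_def by (intro nn_integral_cong) (auto simp: S_def indicator_def)
  show ?thesis
  proof (cases "S K x = {} \<or> S P y = {}")
    case True then show ?thesis by (auto simp: lay)
  next
    case False
    then have ne: "S K x \<noteq> {}" "S P y \<noteq> {}" by auto
    have bdd: "bdd_below (S K x)" for K and x :: 'a by (rule bdd_belowI[of _ 0]) (auto simp: S_def)
    define a where "a = Inf (S K x)"
    define b where "b = Inf (S P y)"
    have a0: "0 \<le> a" "0 \<le> b" unfolding a_def b_def using ne by (auto intro!: cInf_greatest simp: S_def)
    have bound: "layers gauss_weight K x \<le> ennreal (exp (- ((Inf (S K x))\<^sup>2) / 2))" if "0 \<le> Inf (S K x)" for K and x :: 'a
    proof -
      have "layers gauss_weight K x \<le> (\<integral>\<^sup>+s. gauss_weight s * indicator {Inf (S K x)..} s \<partial>lborel)"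
        unfolding lay by (intro nn_integral_mono mult_left_mono indicator_leI) (auto intro: cInf_lower bdd)
      then show ?thesis using nn_integral_gauss_weight_tail[OF that] by simp
    qed
    have st: "x \<bullet> y \<le> s * t" if "s \<in> S K x" "t \<in> S P y" for s t
    proof -
      have "(inverse s *\<^sub>R x) \<bullet> (inverse t *\<^sub>R y) \<le> 1" using that by (intro KP) (auto simp: S_def)
      then show ?thesis using that by (simp add: S_def field_simps)
    qed
    have "x \<bullet> y \<le> s * b" if s: "s \<in> S K x" for s
    proof -
      have "0 < s" using s by (simp add: S_def)
      then have "x \<bullet> y / s \<le> b"
        unfolding b_def using st[OF s] ne by (intro cInf_greatest) (auto simp: field_simps)
      then show ?thesis using \<open>0 < s\<close> by (simp add: field_simps)
    qed
    then have sb: "x \<bullet> y \<le> s * b" if "s \<in> S K x" for s using that by blast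
    \<comment> \<open>The infimum over \<open>t\<close> is already taken; dividing by
      \<open>b\<close> to take the one over \<open>s\<close> fails for \<open>b = 0\<close>, but
      then \<open>sb\<close> itself gives x . y <= 0.\<close>
    have ab: "x \<bullet> y \<le> a * b"
    proof (cases "b = 0")
      case True
      then show ?thesis using sb ne by auto
    next
      case False
      then have "0 < b" using a0 by simp
      then have "x \<bullet> y / b \<le> a"
        unfolding a_def using sb ne by (intro cInf_greatest) (auto simp: field_simps)
      then show ?thesis using \<open>0 < b\<close> by (simp add: field_simps)
    qed
    have "layers gauss_weight K x * layers gauss_weight P y \<le> ennreal (exp (- (a\<^sup>2) / 2)) * ennreal (exp (- (b\<^sup>2) / 2))"
      unfolding a_def b_def using a0 by (intro mult_mono bound) (auto simp: a_def b_def)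
    also have "\<dots> = ennreal (exp (- (a\<^sup>2 + b\<^sup>2) / 2))"
      by (simp add: ennreal_mult'[symmetric] exp_add[symmetric] field_simps)
    also have "\<dots> \<le> ennreal (exp (- (x \<bullet> y)))"
    proof -
      have "0 \<le> (a - b)\<^sup>2" by simp
      then have "- (a\<^sup>2 + b\<^sup>2) / 2 \<le> - (x \<bullet> y)" using ab by (simp add: power2_eq_square algebra_simps)
      then show ?thesis by (intro ennreal_leI) simp
    qed
    finally show ?thesis .
  qed
qed

lemma layers_gauss_ball: "layers gauss_weight (cball 0 1) x = ennreal (exp (- ((norm x)\<^sup>2) / 2))"
proof -
  have "layers gauss_weight (cball 0 1) x = (\<integral>\<^sup>+s. gauss_weight s * indicator {norm x..} s \<partial>lborel)"
    unfolding layers_def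
  proof (rule nn_integral_cong)
    fix s :: real
    show "gauss_weight s * (indicator {0<..} s * indicator (cball 0 1) (inverse s *\<^sub>R x)) = gauss_weight s * indicator {norm x..} s"
    proof (cases "0 < s")
      case True
      then show ?thesis by (auto simp: indicator_def field_simps)
    next
      case False
      then have "s * exp (- (s\<^sup>2) / 2) \<le> 0" by (simp add: mult_le_0_iff)
      then show ?thesis by (simp add: gauss_weight_def ennreal_neg)
    qed
  qed
  also have "\<dots> = ennreal (exp (- ((norm x)\<^sup>2) / 2))" by (rule nn_integral_gauss_weight_tail) simp
  finally show ?thesis .
qed

text \<open>\<open>P\<close> is any set paired with \<open>K\<close> by x . y <= 1, so that the
  roles of a body and its polar can be exchanged. The factor \<open>c 0\<close> between volumes and
  integrals of layered functions is the same for all sets. The ball becomes the Gaussian, the square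
  of whose integral is the functional bound, and so \<open>c 0\<close> cancels.\<close>

theorem blaschke_santalo:
  fixes K P :: "(real ^ 'n) set"
  assumes [measurable]: "K \<in> sets borel" "P \<in> sets borel"
    and bal: "\<And>i. (\<integral>\<^sup>+x. ennreal (x $ i) * indicator K x \<partial>lborel) = (\<integral>\<^sup>+x. ennreal (- x $ i) * indicator K x \<partial>lborel)"
      "\<And>i. (\<integral>\<^sup>+x. ennreal (x $ i) * indicator K x \<partial>lborel) < top"
    and KP: "\<And>x y. x \<in> K \<Longrightarrow> y \<in> P \<Longrightarrow> x \<bullet> y \<le> 1"
  shows "emeasure lborel K * emeasure lborel P \<le> (emeasure lborel (cball (0 :: real ^ 'n) 1))\<^sup>2"
proof -
  define c where "c d = (\<integral>\<^sup>+s. gauss_weight s * ennreal (s ^ (CARD('n) + d)) * indicator {0<..} s \<partial>lborel)" for d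
  have c_top: "c d < top" for d
  proof -
    have "c d = (\<integral>\<^sup>+s. ennreal (s ^ Suc (CARD('n) + d) * exp (- (s\<^sup>2) / 2)) * indicator {0<..} s \<partial>lborel)"
      unfolding c_def gauss_weight_def by (intro nn_integral_cong) (auto simp: indicator_def ennreal_mult'[symmetric] mult_ac)
    then show ?thesis using nn_integral_power_gauss_finite[of "Suc (CARD('n) + d)"] by (simp only:)
  qed
  have lay: "(\<integral>\<^sup>+x. layers gauss_weight A x \<partial>lborel) = c 0 * emeasure lborel A"
    if "A \<in> sets borel" for A :: "(real ^ 'n) set"
    using that by (subst emeasure_layers) (auto simp: c_def)
  have ball: "c 0 * emeasure lborel (cball (0 :: real ^ 'n) 1) = (2 * half_gauss) ^ CARD('n)"
    using lay[of "cball 0 1"] unfolding layers_gauss_ball nn_integral_gauss_vec by (simp only: borel_closed closed_cball)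
  have mom: "(\<integral>\<^sup>+x. ennreal (e * x $ i) * layers gauss_weight K x \<partial>lborel) = c 1 * (\<integral>\<^sup>+x. ennreal (e * x $ i) * indicator K x \<partial>lborel)" for e i
    unfolding c_def by (subst nn_integral_layers[where d=1]) (auto simp: ennreal_mult'[symmetric] mult_ac)
  have "(\<integral>\<^sup>+x. layers gauss_weight K x \<partial>lborel) * (\<integral>\<^sup>+x. layers gauss_weight P x \<partial>lborel) \<le> (2 * half_gauss) ^ (2 * CARD('n))"
  proof (rule functional_santalo_vec)
    show "(\<integral>\<^sup>+x. ennreal (x $ i) * layers gauss_weight K x \<partial>lborel) = (\<integral>\<^sup>+x. ennreal (- x $ i) * layers gauss_weight K x \<partial>lborel)" for i
      using mom[of 1 i] mom[of "-1" i] bal(1)[of i] by simp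
    show "(\<integral>\<^sup>+x. ennreal (x $ i) * layers gauss_weight K x \<partial>lborel) < top" for i
      using mom[of 1 i] bal(2)[of i] c_top by (simp add: ennreal_mult_less_top)
    show "layers gauss_weight K x * layers gauss_weight P y \<le> ennreal (exp (- (x \<bullet> y)))" for x y
      by (rule layers_gauss_le[OF KP])
  qed measurable
  also have "\<dots> = (c 0 * emeasure lborel (cball (0 :: real ^ 'n) 1))\<^sup>2"
    by (simp only: ball power_mult[symmetric] mult.commute[of 2 "CARD('n)"])
  finally have main: "(c 0)\<^sup>2 * (emeasure lborel K * emeasure lborel P) \<le> (c 0)\<^sup>2 * (emeasure lborel (cball (0 :: real ^ 'n) 1))\<^sup>2"
    by (simp add: lay power2_eq_square mult_ac)
  have "(2 * half_gauss) ^ CARD('n) \<noteq> 0" using half_gauss_pos by auto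
  then have "c 0 \<noteq> 0" using ball by auto
  then have "(c 0)\<^sup>2 \<noteq> 0" "(c 0)\<^sup>2 \<noteq> top" using c_top[of 0] by (auto simp: power2_eq_square ennreal_mult_eq_top_iff)
  with main show ?thesis
    by (metis ennreal_mult_le_mult_iff)
qed

section \<open>Steiner symmetrization\<close>

lemma emeasure_orthogonal_vimage:
  fixes R :: "'a::euclidean_space \<Rightarrow> 'a"
  assumes R: "orthogonal_transformation R" and [measurable]: "A \<in> sets borel"
  shows "emeasure lborel (R -` A) = emeasure lborel A"
proof -
  have lin: "linear R" using R by (rule orthogonal_transformation_linear)
  have Rm[measurable]: "R \<in> borel_measurable borel"
    using lin by (intro borel_measurable_continuous_onI) (auto intro: linear_continuous_on simp: linear_conv_bounded_linear)
  have RA[measurable]: "R -` A \<in> sets borel" using measurable_sets_borel[of R borel A] by simp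
  have RB[measurable]: "(\<lambda>z. R (fst z)) \<in> borel_measurable (lborel \<Otimes>\<^sub>M (lborel :: 'a measure))"
    by (rule measurable_compose[OF measurable_fst]) simp
  let ?B = "cball (0 :: 'a) 1"
  have mB: "(\<lambda>z. indicator ?B (R (fst z)) * indicator A (snd z + R (fst z)) :: ennreal) \<in> borel_measurable (lborel \<Otimes>\<^sub>M lborel)"
    by (intro borel_measurable_times_ennreal measurable_compose[OF RB] measurable_compose[OF borel_measurable_add[OF measurable_compose[OF measurable_snd] RB], where g="indicator A"]) (auto intro!: borel_measurable_indicator)
  have mB2: "(\<lambda>z. indicator ?B (R (fst z) - snd z) * indicator A (R (fst z)) :: ennreal) \<in> borel_measurable (lborel \<Otimes>\<^sub>M lborel)"
    by (intro borel_measurable_times_ennreal measurable_compose[OF RB] measurable_compose[OF borel_measurable_diff[OF RB measurable_compose[OF measurable_snd]], where g="indicator ?B"]) (auto intro!: borel_measurable_indicator)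
  have mx: "(\<lambda>y. indicator ?B (R y) * indicator A (x + R y) :: ennreal) \<in> borel_measurable borel" for x
    by (intro borel_measurable_times_ennreal measurable_compose[OF Rm] measurable_compose[OF borel_measurable_add[OF borel_measurable_const Rm], where g="indicator A"]) (auto intro!: borel_measurable_indicator)
  obtain R' where R': "\<And>x. R (R' x) = x"
    using orthogonal_transformation_surj[OF R] by (metis surj_f_inv_f)
  have trans: "(\<integral>\<^sup>+x. f (x + c) \<partial>lborel) = (\<integral>\<^sup>+x. f x \<partial>lborel)" if [measurable]: "f \<in> borel_measurable borel" for f :: "'a \<Rightarrow> ennreal" and c
  proof -
    have "(\<integral>\<^sup>+x. f x \<partial>lborel) = (\<integral>\<^sup>+x. f x \<partial>distr lborel borel ((+) c))" by (simp add: lborel_distr_plus)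
    also have "\<dots> = (\<integral>\<^sup>+x. f (x + c) \<partial>lborel)" by (subst nn_integral_distr) (auto simp: add.commute)
    finally show ?thesis by simp
  qed
  have B: "emeasure lborel {x. R y - x \<in> ?B} = emeasure lborel ?B" for y
  proof -
    have "{x. R y - x \<in> ?B} = cball (R y) 1" by (auto simp: dist_norm norm_minus_commute)
    then show ?thesis by (simp add: emeasure_cball)
  qed
  have RB: "emeasure lborel (R -` ?B) = emeasure lborel ?B"
    by (rule arg_cong[of _ _ "emeasure lborel"]) (auto simp: orthogonal_transformation_norm[OF R])
  \<comment> \<open>One double integral is computed in two ways. Integrating over \<open>x\<close>
    first gives the measure of \<open>A\<close>; after the shift of \<open>y\<close> that replaces
    \<open>R y\<close> by \<open>R y - x\<close>, it gives the measure of the preimage. Both carry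
    the measure of the unit ball as a factor, because the ball is invariant under \<open>R\<close>,
    and this factor cancels.\<close>
  have "emeasure lborel A * emeasure lborel ?B = (\<integral>\<^sup>+y. indicator ?B (R y) * (\<integral>\<^sup>+x. indicator A (x + R y) \<partial>lborel) \<partial>lborel)"
  proof -
    have "(\<integral>\<^sup>+y. indicator ?B (R y) * (\<integral>\<^sup>+x. indicator A (x + R y) \<partial>lborel) \<partial>lborel) = (\<integral>\<^sup>+y. indicator (R -` ?B) y * emeasure lborel A \<partial>lborel)"
      by (subst trans[of "indicator A"]) (auto simp: indicator_def)
    also have "\<dots> = emeasure lborel ?B * emeasure lborel A"
      using measurable_sets_borel[of R borel ?B] by (simp add: nn_integral_multc RB)
    finally show ?thesis by (simp add: mult.commute)
  qed
  also have "\<dots> = (\<integral>\<^sup>+y. (\<integral>\<^sup>+x. indicator ?B (R y) * indicator A (x + R y) \<partial>lborel) \<partial>lborel)"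
    by (intro nn_integral_cong nn_integral_cmult[symmetric]) measurable
  also have "\<dots> = (\<integral>\<^sup>+x. (\<integral>\<^sup>+y. indicator ?B (R y) * indicator A (x + R y) \<partial>lborel) \<partial>lborel)"
    by (rule sym, rule lborel_pair.Fubini') (simp add: split_beta' mB)
  also have "\<dots> = (\<integral>\<^sup>+x. (\<integral>\<^sup>+y. indicator ?B (R y - x) * indicator A (R y) \<partial>lborel) \<partial>lborel)"
  proof (rule nn_integral_cong)
    fix x
    have "R (y + R' (- x)) = R y - x" for y using lin by (simp add: linear_add R')
    then show "(\<integral>\<^sup>+y. indicator ?B (R y) * indicator A (x + R y) \<partial>lborel) = (\<integral>\<^sup>+y. indicator ?B (R y - x) * indicator A (R y) \<partial>lborel)"
      using trans[OF mx[of x], of "R' (- x)"] by simp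
  qed
  also have "\<dots> = (\<integral>\<^sup>+y. (\<integral>\<^sup>+x. indicator ?B (R y - x) * indicator A (R y) \<partial>lborel) \<partial>lborel)"
    by (rule lborel_pair.Fubini') (simp add: split_beta' mB2)
  also have "\<dots> = (\<integral>\<^sup>+y. emeasure lborel ?B * indicator (R -` A) y \<partial>lborel)"
  proof (rule nn_integral_cong)
    fix y
    have "(\<integral>\<^sup>+x. indicator ?B (R y - x) * indicator A (R y) \<partial>lborel) = (\<integral>\<^sup>+x. indicator {x. R y - x \<in> ?B} x * indicator A (R y) \<partial>lborel)"
      by (intro nn_integral_cong) (auto simp: indicator_def)
    also have "\<dots> = emeasure lborel {x. R y - x \<in> ?B} * indicator A (R y)"
      by (subst nn_integral_multc) (auto intro!: nn_integral_indicator)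
    finally show "(\<integral>\<^sup>+x. indicator ?B (R y - x) * indicator A (R y) \<partial>lborel) = emeasure lborel ?B * indicator (R -` A) y"
      unfolding B by (simp add: indicator_def)
  qed
  also have "\<dots> = emeasure lborel (R -` A) * emeasure lborel ?B"
    using RA by (subst nn_integral_cmult) (simp_all add: mult.commute)
  finally have eq: "emeasure lborel ?B * emeasure lborel A = emeasure lborel ?B * emeasure lborel (R -` A)"
    by (simp add: mult.commute)
  have "emeasure lborel ?B \<noteq> 0" "emeasure lborel ?B \<noteq> top" by (simp_all add: emeasure_cball order_less_imp_not_eq2)
  then show ?thesis using eq by (metis ennreal_mult_le_mult_iff antisym order_refl)
qed

lemma emeasure_orthogonal_image:
  fixes R :: "'a::euclidean_space \<Rightarrow> 'a"
  assumes R: "orthogonal_transformation R" and A: "compact A"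
  shows "emeasure lborel (R ` A) = emeasure lborel A"
proof -
  have "compact (R ` A)"
    using A orthogonal_transformation_linear[OF R] by (intro compact_continuous_image linear_continuous_on) (auto simp: linear_conv_bounded_linear)
  then have "emeasure lborel (R -` (R ` A)) = emeasure lborel (R ` A)"
    by (intro emeasure_orthogonal_vimage R) (simp add: borel_compact)
  then show ?thesis by (simp add: inj_vimage_image_eq orthogonal_transformation_inj[OF R])
qed

section \<open>Reflections and symmetrization of sets\<close>

definition reflect :: "'a::real_inner \<Rightarrow> 'a \<Rightarrow> 'a" where
  "reflect u x = x - (2 * (x \<bullet> u)) *\<^sub>R u"

text \<open>For convex \<open>K\<close> and a unit vector \<open>u\<close> this is the usual symmetrization: \<open>a\<close> and \<open>b\<close>
  run over a chord parallel to \<open>u\<close>, and half the sum of \<open>a\<close> and the mirror image of \<open>b\<close>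
  runs over that chord recentred on the hyperplane orthogonal to \<open>u\<close>.\<close>

definition steiner :: "'a::real_inner \<Rightarrow> 'a set \<Rightarrow> 'a set" where
  "steiner u K = {(1/2) *\<^sub>R (a + reflect u b) | a b. a \<in> K \<and> b \<in> K \<and> (\<exists>c. a - b = c *\<^sub>R u)}"

lemma linear_reflect: "linear (reflect u)"
  by (rule linearI) (simp_all add: reflect_def inner_add_left algebra_simps)

lemma norm_reflect:
  assumes "norm u = 1"
  shows "norm (reflect u x) = norm x"
proof -
  have "u \<bullet> u = 1" using assms by (simp add: norm_eq_1)
  then have "reflect u x \<bullet> reflect u x = x \<bullet> x"
    by (simp add: reflect_def inner_diff_left inner_diff_right inner_commute[of u x])
  then show ?thesis by (simp add: norm_eq)
qed

lemma reflect_reflect: "norm u = 1 \<Longrightarrow> reflect u (reflect u x) = x"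
  by (simp add: reflect_def inner_diff_left norm_eq_1 algebra_simps flip: scaleR_add_left)

lemma steiner_mono: "A \<subseteq> B \<Longrightarrow> steiner u A \<subseteq> steiner u B"
  unfolding steiner_def by blast

text \<open>A linear image of a linear section of \<open>K \<times> K\<close>, which yields
  convexity and compactness of the symmetrization.\<close>

lemma steiner_eq_image:
  "steiner u K = (\<lambda>(a, b). (1/2) *\<^sub>R (a + reflect u b)) ` ((K \<times> K) \<inter> (\<lambda>(a, b). a - b) -` span {u})"
  by (auto simp: steiner_def span_singleton image_iff)

lemma linear_diff_pair: "linear (\<lambda>(a, b). a - b)"
  by (rule linearI) (auto simp: algebra_simps)

lemma linear_steiner_map: "linear (\<lambda>(a, b). (1/2) *\<^sub>R (a + reflect u b))"
  by (rule linearI) (auto simp: algebra_simps linear_add[OF linear_reflect] linear_scale[OF linear_reflect])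

lemma convex_steiner: "convex K \<Longrightarrow> convex (steiner u K)" for K :: "'a::euclidean_space set"
  unfolding steiner_eq_image
  using subspace_imp_convex[OF subspace_span, of "{u}"]
  by (intro convex_linear_image[OF linear_steiner_map] convex_Int convex_Times convex_linear_vimage[OF linear_diff_pair])

lemma compact_steiner: "compact K \<Longrightarrow> compact (steiner u K)" for K :: "'a::euclidean_space set"
proof -
  assume K: "compact K"
  have "closed ((\<lambda>(a, b). a - b) -` span {u} :: ('a \<times> 'a) set)"
    by (intro closed_vimage closed_subspace subspace_span linear_continuous_on)
       (auto intro: linear_continuous_on linear_diff_pair simp: linear_conv_bounded_linear[symmetric])
  then have "compact ((K \<times> K) \<inter> (\<lambda>(a, b). a - b) -` span {u})"
    using K by (intro compact_Int_closed compact_Times)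
  then show ?thesis unfolding steiner_eq_image
    by (intro compact_continuous_image linear_continuous_on)
       (auto intro: linear_steiner_map simp: linear_conv_bounded_linear[symmetric])
qed

lemma steiner_subset_cball:
  assumes "norm u = 1" "K \<subseteq> cball 0 R"
  shows "steiner u K \<subseteq> cball 0 R"
proof
  fix x assume "x \<in> steiner u K"
  then obtain a b where ab: "x = (1/2) *\<^sub>R (a + reflect u b)" "a \<in> K" "b \<in> K" by (auto simp: steiner_def)
  then have "norm a \<le> R" "norm (reflect u b) \<le> R" using assms by (auto simp: norm_reflect)
  then have "norm (a + reflect u b) \<le> 2 * R" using norm_triangle_ineq[of a "reflect u b"] by linarith
  then show "x \<in> cball 0 R" using ab by simp
qed

text \<open>Symmetrization commutes with rotations and dilations. This is used to turn a cap into
  any direction and to bring a body to unit scale.\<close>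

lemma steiner_similarity:
  fixes R :: "'a::euclidean_space \<Rightarrow> 'a"
  assumes R: "orthogonal_transformation R" and c: "c \<noteq> 0"
  shows "steiner (R u) ((\<lambda>x. c *\<^sub>R R x) ` K) = (\<lambda>x. c *\<^sub>R R x) ` steiner u K"
proof -
  have lin: "linear R" using R by (rule orthogonal_transformation_linear)
  have inj: "R x = R y \<longleftrightarrow> x = y" for x y using orthogonal_transformation_inj[OF R] by (auto dest: injD)
  have in': "R x \<bullet> R y = x \<bullet> y" for x y using R by (simp add: orthogonal_transformation_def)
  have r: "reflect (R u) (c *\<^sub>R R b) = c *\<^sub>R R (reflect u b)" for b
    by (simp add: reflect_def in' linear_diff[OF lin] linear_scale[OF lin] algebra_simps)
  have d: "(\<exists>d. c *\<^sub>R R a - c *\<^sub>R R b = d *\<^sub>R R u) \<longleftrightarrow> (\<exists>d. a - b = d *\<^sub>R u)" for a b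
  proof
    assume "\<exists>d. c *\<^sub>R R a - c *\<^sub>R R b = d *\<^sub>R R u"
    then obtain d where "c *\<^sub>R R a - c *\<^sub>R R b = d *\<^sub>R R u" by blast
    then have "c *\<^sub>R R (a - b) = d *\<^sub>R R u" by (simp add: linear_diff[OF lin] algebra_simps)
    then have "inverse c *\<^sub>R c *\<^sub>R R (a - b) = inverse c *\<^sub>R d *\<^sub>R R u" by simp
    then have "R (a - b) = R ((inverse c * d) *\<^sub>R u)" using c by (simp add: linear_scale[OF lin])
    then show "\<exists>d. a - b = d *\<^sub>R u" using inj by blast
  next
    assume "\<exists>d. a - b = d *\<^sub>R u"
    then obtain d where "a - b = d *\<^sub>R u" by blast
    then have "R (a - b) = d *\<^sub>R R u" by (simp add: linear_scale[OF lin])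
    then have "c *\<^sub>R R a - c *\<^sub>R R b = (c * d) *\<^sub>R R u" by (simp add: linear_diff[OF lin] flip: scaleR_diff_right)
    then show "\<exists>d. c *\<^sub>R R a - c *\<^sub>R R b = d *\<^sub>R R u" by blast
  qed
  have m: "(1/2) *\<^sub>R (c *\<^sub>R R a + reflect (R u) (c *\<^sub>R R b)) = c *\<^sub>R R ((1/2) *\<^sub>R (a + reflect u b))" for a b
    unfolding r by (simp add: linear_add[OF lin] linear_scale[OF lin] algebra_simps)
  show ?thesis
  proof (intro equalityI subsetI)
    fix x assume "x \<in> steiner (R u) ((\<lambda>x. c *\<^sub>R R x) ` K)"
    then obtain a b where "a \<in> K" "b \<in> K" "\<exists>d. c *\<^sub>R R a - c *\<^sub>R R b = d *\<^sub>R R u" "x = (1/2) *\<^sub>R (c *\<^sub>R R a + reflect (R u) (c *\<^sub>R R b))"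
      by (auto simp: steiner_def)
    then show "x \<in> (\<lambda>x. c *\<^sub>R R x) ` steiner u K" unfolding m d steiner_def by blast
  next
    fix x assume "x \<in> (\<lambda>x. c *\<^sub>R R x) ` steiner u K"
    then obtain a b where "a \<in> K" "b \<in> K" "\<exists>d. a - b = d *\<^sub>R u" "x = c *\<^sub>R R ((1/2) *\<^sub>R (a + reflect u b))"
      by (auto simp: steiner_def)
    then show "x \<in> steiner (R u) ((\<lambda>x. c *\<^sub>R R x) ` K)" unfolding m[symmetric] d[symmetric] steiner_def by blast
  qed
qed

section \<open>Iterated symmetrization and caps of the ball\<close>

lemma fold_steiner_similarity:
  fixes R :: "'a::euclidean_space \<Rightarrow> 'a"
  assumes R: "orthogonal_transformation R" and c: "c \<noteq> 0"
  shows "fold steiner (map R us) ((\<lambda>x. c *\<^sub>R R x) ` K) = (\<lambda>x. c *\<^sub>R R x) ` fold steiner us K"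
  by (induction us arbitrary: K) (simp_all add: steiner_similarity[OF R c])

lemma fold_steiner_mono: "A \<subseteq> B \<Longrightarrow> fold steiner us A \<subseteq> fold steiner us B"
  by (induction us arbitrary: A B) (simp_all add: steiner_mono)

lemma fold_steiner_compact: "compact K \<Longrightarrow> compact (fold steiner us K)" for K :: "'a::euclidean_space set"
  by (induction us arbitrary: K) (simp_all add: compact_steiner)

lemma fold_steiner_convex: "convex K \<Longrightarrow> convex (fold steiner us K)" for K :: "'a::euclidean_space set"
  by (induction us arbitrary: K) (simp_all add: convex_steiner)

lemma fold_steiner_subset_cball:
  assumes "\<forall>u\<in>set us. norm u = 1" "K \<subseteq> cball 0 R"
  shows "fold steiner us K \<subseteq> cball 0 R"
  using assms by (induction us arbitrary: K) (simp_all add: steiner_subset_cball)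

text \<open>The ball is strictly convex: a point of its boundary is the midpoint of \<open>a\<close>
  and \<open>reflect u b\<close> only if both coincide with it.\<close>

lemma steiner_sphere:
  assumes u: "norm u = 1" and C: "C \<subseteq> cball 0 1" and p: "norm p = 1" "p \<in> steiner u C"
  shows "p \<in> C \<and> reflect u p \<in> C"
proof -
  obtain a b where ab: "p = (1/2) *\<^sub>R (a + reflect u b)" "a \<in> C" "b \<in> C" using p by (auto simp: steiner_def)
  let ?b = "reflect u b"
  have "norm a \<le> 1" "norm ?b \<le> 1" using ab C by (auto simp: norm_reflect[OF u])
  then have "(norm a)\<^sup>2 \<le> 1" "(norm ?b)\<^sup>2 \<le> 1" by (auto simp: power_le_one)
  then have n: "a \<bullet> a \<le> 1" "?b \<bullet> ?b \<le> 1" by (simp_all only: power2_norm_eq_inner)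
  have "(1/2) *\<^sub>R (a + ?b) \<bullet> (1/2) *\<^sub>R (a + ?b) = 1" using p(1) ab by (simp only: norm_eq_1)
  then have "(a + ?b) \<bullet> (a + ?b) = 4" by simp
  then have "(a - ?b) \<bullet> (a - ?b) \<le> 0" using n by (simp add: inner_add_left inner_add_right inner_diff_left inner_diff_right)
  then have "a = ?b" using inner_ge_zero[of "a - ?b"] by (metis antisym eq_iff_diff_eq_0 inner_eq_zero_iff)
  then have "p = a" using ab(1) by (simp flip: scaleR_2)
  then show ?thesis using ab \<open>a = ?b\<close> reflect_reflect[OF u, of b] by simp
qed

text \<open>Used contrapositively: a point of the sphere disappears as soon as one of its mirror
  images is missing from \<open>C\<close>, whatever the order of the directions.\<close>

lemma fold_steiner_sphere:
  assumes "\<forall>u\<in>set us. norm u = 1" "C \<subseteq> cball 0 1" "norm p = 1" "p \<in> fold steiner us C"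
  shows "p \<in> C \<and> (\<forall>u\<in>set us. reflect u p \<in> C)"
  using assms
proof (induction us arbitrary: C)
  case (Cons u us)
  have u: "norm u = 1" using Cons by simp
  have sub: "steiner u C \<subseteq> cball 0 1" using steiner_subset_cball[OF u Cons.prems(2)] .
  have "p \<in> steiner u C \<and> (\<forall>w\<in>set us. reflect w p \<in> steiner u C)"
    using Cons sub by (intro Cons.IH) auto
  moreover have "norm (reflect w p) = 1" if "w \<in> set us" for w using that Cons.prems by (simp add: norm_reflect)
  ultimately show ?case using steiner_sphere[OF u Cons.prems(2)] Cons.prems(3) by auto
qed simp

lemma cap_symmetrization:
  fixes e :: "real ^ 'n"
  assumes e: "norm e = 1" and t: "t < 1"
  obtains us d where "0 < d" "d < 1" "\<forall>u\<in>set us. norm u = 1"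
    "fold steiner us (cball 0 1 \<inter> {x. x \<bullet> e \<le> t}) \<subseteq> cball 0 (1 - d)"
proof -
  define D where "D = cball 0 1 \<inter> {x. x \<bullet> e \<le> t}"
  define U where "U = {u :: real ^ 'n. u = 0 \<or> norm u = 1}"
  have "compact (sphere (0 :: real ^ 'n) 1)" by simp
  moreover have "open {p. t < reflect u p \<bullet> e}" for u
    by (intro open_Collect_less continuous_intros linear_continuous_on)
       (auto intro: linear_reflect simp: linear_conv_bounded_linear[symmetric])
  moreover have "sphere 0 1 \<subseteq> (\<Union>u\<in>U. {p. t < reflect u p \<bullet> e})"
  proof
    fix p :: "real ^ 'n" assume "p \<in> sphere 0 1"
    then have p: "p \<bullet> p = 1" by (simp add: norm_eq_1)
    have ee: "e \<bullet> e = 1" using e by (simp add: norm_eq_1)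
    show "p \<in> (\<Union>u\<in>U. {p. t < reflect u p \<bullet> e})"
    proof (cases "p = e")
      case True
      then have "t < reflect 0 p \<bullet> e" using ee t by (simp add: reflect_def)
      then show ?thesis by (auto simp: U_def)
    next
      case False
      \<comment> \<open>The reflection in the hyperplane bisecting \<open>p\<close> and
        \<open>e\<close> exchanges the two points.\<close>
      define u where "u = (p - e) /\<^sub>R norm (p - e)"
      have "norm u = 1" using False by (simp add: u_def)
      have pe: "(norm (p - e))\<^sup>2 = 2 * (p \<bullet> (p - e))"
        by (simp add: power2_norm_eq_inner inner_diff_left inner_diff_right p ee inner_commute)
      have "reflect u p = p - (2 * (p \<bullet> (p - e)) / (norm (p - e))\<^sup>2) *\<^sub>R (p - e)"
        by (simp add: reflect_def u_def power2_eq_square divide_inverse mult_ac)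
      also have "\<dots> = e" using pe False by (simp flip: pe)
      finally have "t < reflect u p \<bullet> e" using ee t by simp
      then show ?thesis using \<open>norm u = 1\<close> by (auto simp: U_def)
    qed
  qed
  ultimately obtain V where V: "V \<subseteq> U" "finite V" "sphere 0 1 \<subseteq> (\<Union>u\<in>V. {p. t < reflect u p \<bullet> e})"
    by (rule compactE_image)
  obtain us where us: "set us = V - {0}" using finite_list[of "V - {0}"] V by blast
  have nus: "\<forall>u\<in>set us. norm u = 1" using us V by (auto simp: U_def)
  define C where "C = fold steiner us D"
  have Dsub: "D \<subseteq> cball 0 1" by (auto simp: D_def)
  have C1: "C \<subseteq> cball 0 1" unfolding C_def by (rule fold_steiner_subset_cball[OF nus Dsub])
  have "compact D"
    unfolding D_def by (intro compact_Int_closed compact_cball) (use closed_halfspace_le[of e t] in \<open>simp add: inner_commute\<close>)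
  then have "compact C" unfolding C_def by (rule fold_steiner_compact)
  have lt: "norm x < 1" if x: "x \<in> C" for x
  proof (rule ccontr)
    assume "\<not> norm x < 1"
    with x C1 have nx: "norm x = 1" by fastforce
    have "x \<in> D \<and> (\<forall>u\<in>set us. reflect u x \<in> D)"
      using fold_steiner_sphere[OF nus Dsub nx] x by (simp add: C_def)
    then have "reflect u x \<bullet> e \<le> t" if "u \<in> V" for u
      using that us by (cases "u = 0") (auto simp: D_def reflect_def)
    moreover have "x \<in> sphere 0 1" using nx by simp
    ultimately show False using V(3) by fastforce
  qed
  have "\<exists>d>0. d < 1 \<and> C \<subseteq> cball 0 (1 - d)"
  proof (cases "C = {}")
    case True then show ?thesis by (intro exI[of _ "1/2"]) auto
  next
    case False
    obtain x where x: "x \<in> C" "\<And>y. y \<in> C \<Longrightarrow> norm y \<le> norm x"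
      using continuous_attains_sup[OF \<open>compact C\<close> False, of norm] continuous_on_norm_id by blast
    have "norm x < 1" using lt x by blast
    then show ?thesis using x by (intro exI[of _ "(1 - norm x) / 2"]) (auto simp: field_simps add_pos_nonneg dest!: x(2))
  qed
  then show thesis using that nus unfolding C_def D_def by blast
qed

text \<open>Rotating one list of directions serves every \<open>v\<close> with the same gain
  \<open>d\<close>. Uniformity matters because in \<open>steiner_symmetrization_to_ball\<close> the
  direction of the cap is known only after a radius has been chosen in terms of
  \<open>d\<close>.\<close>

lemma uniform_cap_symmetrization:
  assumes "t < 1"
  obtains d where "0 < d" "d < 1"
    "\<forall>v :: real ^ 'n. norm v = 1 \<longrightarrow> (\<exists>us. (\<forall>u\<in>set us. norm u = 1) \<and> fold steiner us (cball 0 1 \<inter> {x. x \<bullet> v \<le> t}) \<subseteq> cball 0 (1 - d))"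
proof -
  obtain e :: "real ^ 'n" where e: "norm e = 1" using norm_axis_1 by blast
  obtain us d where d: "0 < d" "d < 1" and us: "\<forall>u\<in>set us. norm u = 1"
    and sub: "fold steiner us (cball 0 1 \<inter> {x. x \<bullet> e \<le> t}) \<subseteq> cball 0 (1 - d)"
    by (rule cap_symmetrization[OF e assms])
  have "\<exists>us. (\<forall>u\<in>set us. norm u = 1) \<and> fold steiner us (cball 0 1 \<inter> {x. x \<bullet> v \<le> t}) \<subseteq> cball 0 (1 - d)"
    if v: "norm v = 1" for v :: "real ^ 'n"
  proof -
    obtain R where R: "orthogonal_transformation R" "R e = v" using orthogonal_transformation_exists_1[OF e v] .
    have n: "norm (R x) = norm x" for x by (rule orthogonal_transformation_norm[OF R(1)])
    have i: "R x \<bullet> R y = x \<bullet> y" for x y using R(1) by (simp add: orthogonal_transformation_def)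
    have "cball 0 1 \<inter> {x. x \<bullet> v \<le> t} \<subseteq> (\<lambda>x. 1 *\<^sub>R R x) ` (cball 0 1 \<inter> {x. x \<bullet> e \<le> t})"
    proof
      fix x assume x: "x \<in> cball 0 1 \<inter> {x. x \<bullet> v \<le> t}"
      obtain y where y: "x = R y" using surjD[OF orthogonal_transformation_surj[OF R(1)], of x] by blast
      have "y \<in> cball 0 1 \<inter> {x. x \<bullet> e \<le> t}" using x n[of y] i[of y e] by (simp add: y R(2))
      then show "x \<in> (\<lambda>x. 1 *\<^sub>R R x) ` (cball 0 1 \<inter> {x. x \<bullet> e \<le> t})" using y by simp
    qed
    then have "fold steiner (map R us) (cball 0 1 \<inter> {x. x \<bullet> v \<le> t}) \<subseteq> (\<lambda>x. 1 *\<^sub>R R x) ` fold steiner us (cball 0 1 \<inter> {x. x \<bullet> e \<le> t})"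
      unfolding fold_steiner_similarity[OF R(1) one_neq_zero, symmetric] by (rule fold_steiner_mono)
    also have "\<dots> \<subseteq> cball 0 (1 - d)" using sub by (auto simp: n subset_iff)
    finally show ?thesis using us n by (intro exI[of _ "map R us"]) auto
  qed
  then show thesis using that[OF d] by blast
qed

text \<open>The direction comes from separating \<open>C\<close> from a point of the larger ball
  that the volume bound forces out of \<open>C\<close>.\<close>

lemma halfspace_of_small_volume:
  fixes C :: "(real ^ 'n) set"
  assumes C: "convex C" "closed C" and vol: "emeasure lborel C \<le> emeasure lborel (cball (0 :: real ^ 'n) r)"
    and r: "0 \<le> r" "r < r'"
  obtains v where "norm v = 1" "C \<subseteq> {x. x \<bullet> v \<le> r'}"
proof -
  have "\<not> cball 0 r' \<subseteq> C"
  proof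
    assume "cball 0 r' \<subseteq> C"
    then have "emeasure lborel (cball (0 :: real ^ 'n) r') \<le> emeasure lborel C" using C by (intro emeasure_mono) auto
    with vol have "emeasure lborel (cball (0 :: real ^ 'n) r') \<le> emeasure lborel (cball (0 :: real ^ 'n) r)" by (rule order_trans[rotated])
    then have "unit_ball_vol (real CARD('n)) * r' ^ CARD('n) \<le> unit_ball_vol (real CARD('n)) * r ^ CARD('n)"
      using r by (simp add: emeasure_cball)
    moreover have "r ^ CARD('n) < r' ^ CARD('n)" using r by (intro power_strict_mono) auto
    ultimately show False by (simp add: mult_le_cancel_left_pos)
  qed
  then obtain p where p: "p \<in> cball 0 r'" "p \<notin> C" by blast
  obtain a b where ab: "a \<bullet> p < b" "\<And>x. x \<in> C \<Longrightarrow> b < a \<bullet> x"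
    using separating_hyperplane_closed_point[OF C p(2)] by auto
  show thesis
  proof (cases "a = 0")
    case True
    \<comment> \<open>A vanishing normal cannot separate a point from a nonempty set; for empty
      \<open>C\<close> any direction will do.\<close>
    then have "C = {}" using ab by fastforce
    moreover obtain e :: "real ^ 'n" where "norm e = 1" using norm_axis_1 by blast
    ultimately show ?thesis using that[of e] by auto
  next
    case False
    define v where "v = - (a /\<^sub>R norm a)"
    have nv: "norm v = 1" using False by (simp add: v_def)
    have "x \<bullet> v \<le> r'" if "x \<in> C" for x
    proof -
      have "a \<bullet> p < a \<bullet> x" using ab(1) ab(2)[OF that] by simp
      then have "x \<bullet> v \<le> p \<bullet> v" using False by (simp add: v_def inner_commute divide_simps)
      also have "\<dots> \<le> norm p * norm v" by (rule norm_cauchy_schwarz)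
      also have "\<dots> \<le> r'" using p nv by simp
      finally show ?thesis .
    qed
    then show ?thesis using that[OF nv] by blast
  qed
qed

text \<open>The product form is enough: it is applied to two sets of equal measure, where
  \<open>ennreal_le_of_square_le\<close> turns it into a comparison, also for infinite
  measure.\<close>

theorem brunn_minkowski_vec:
  fixes A B C :: "(real ^ 'n) set"
  assumes [measurable]: "A \<in> sets borel" "B \<in> sets borel" "C \<in> sets borel"
    and mid: "\<And>a b. a \<in> A \<Longrightarrow> b \<in> B \<Longrightarrow> (1/2) *\<^sub>R (a + b) \<in> C"
  shows "emeasure lborel A * emeasure lborel B \<le> (emeasure lborel C)\<^sup>2"
proof -
  have e: "emeasure lborel S = (\<integral>\<^sup>+x. indicator S (vec_lambda x) \<partial>PiM UNIV (\<lambda>_. lborel))"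
    if "S \<in> sets borel" for S :: "(real ^ 'n) set"
    using that by (subst nn_integral_lborel_vec[symmetric]) auto
  show ?thesis
    unfolding e[OF assms(1)] e[OF assms(2)] e[OF assms(3)]
  proof (rule prekopa_leindler_PiM)
    fix x y :: "'n \<Rightarrow> real"
    have "vec_lambda (\<lambda>i\<in>UNIV. (x i + y i) / 2) = (1/2) *\<^sub>R (vec_lambda x + vec_lambda y)"
      by (simp add: vec_eq_iff)
    then show "indicator A (vec_lambda x) * indicator B (vec_lambda y) \<le> ((indicator C (vec_lambda (\<lambda>i\<in>UNIV. (x i + y i) / 2)))\<^sup>2 :: ennreal)"
      using mid[of "vec_lambda x" "vec_lambda y"] by (auto simp: indicator_def)
  qed measurable
qed

lemma ennreal_le_of_square_le:
  fixes a b :: ennreal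
  assumes "a * a \<le> b\<^sup>2"
  shows "a \<le> b"
proof (cases "b = top")
  case False
  then obtain y where y: "b = ennreal y" "0 \<le> y" by (cases b) auto
  have "a \<noteq> top" using assms y by (auto simp: ennreal_power top_unique)
  then obtain x where x: "a = ennreal x" "0 \<le> x" by (cases a) auto
  have "x\<^sup>2 \<le> y\<^sup>2" using assms x y by (simp add: ennreal_power ennreal_mult'[symmetric] power2_eq_square)
  then show ?thesis using x y by (auto intro!: ennreal_leI power2_le_imp_le)
qed simp

section \<open>Sections along one coordinate or one row\<close>

lemma measurable_section [measurable]:
  fixes x :: "'n::finite \<Rightarrow> 'a::euclidean_space"
  shows "(\<lambda>t. vec_lambda (x(i := t))) \<in> borel_measurable borel"
proof (subst borel_measurable_euclidean_space, rule ballI)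
  fix b :: "'a ^ 'n" assume "b \<in> Basis"
  then obtain j c where "b = axis j c" by (auto simp: Basis_vec_def)
  then show "(\<lambda>t. vec_lambda (x(i := t)) \<bullet> b) \<in> borel_measurable borel"
    by (cases "j = i") (simp_all add: inner_axis)
qed

lemma emeasure_sections:
  fixes S :: "('a::euclidean_space ^ 'n) set"
  assumes S: "S \<in> sets borel"
  shows "emeasure lborel S = (\<integral>\<^sup>+x. emeasure lborel {t. vec_lambda (x(i := t)) \<in> S} \<partial>PiM (UNIV - {i}) (\<lambda>_. lborel))"
proof -
  note [measurable] = S
  have U: "insert i (UNIV - {i}) = (UNIV :: 'n set)" by auto
  have "emeasure lborel S = (\<integral>\<^sup>+x. indicator S (vec_lambda x) \<partial>PiM UNIV (\<lambda>_. lborel))"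
    using S by (subst nn_integral_lborel_vec[symmetric]) auto
  also have "\<dots> = (\<integral>\<^sup>+x. (\<integral>\<^sup>+t. indicator S (vec_lambda (x(i := t))) \<partial>lborel) \<partial>PiM (UNIV - {i}) (\<lambda>_. lborel))"
    using lborel_PiM.product_nn_integral_insert[of "UNIV - {i}" i "\<lambda>x. indicator S (vec_lambda x)"] by (simp add: U)
  also have "\<dots> = (\<integral>\<^sup>+x. emeasure lborel {t. vec_lambda (x(i := t)) \<in> S} \<partial>PiM (UNIV - {i}) (\<lambda>_. lborel))"
  proof (rule nn_integral_cong)
    fix x :: "'n \<Rightarrow> 'a"
    have "(\<lambda>t. vec_lambda (x(i := t))) -` S \<in> sets borel"
      using measurable_sets_borel[OF measurable_section S] by simp
    then have "emeasure lborel {t. vec_lambda (x(i := t)) \<in> S} = (\<integral>\<^sup>+t. indicator {t. vec_lambda (x(i := t)) \<in> S} t \<partial>lborel)"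
      by (simp add: vimage_def)
    also have "\<dots> = (\<integral>\<^sup>+t. indicator S (vec_lambda (x(i := t))) \<partial>lborel)"
      by (rule nn_integral_cong) (auto simp: indicator_def)
    finally show "(\<integral>\<^sup>+t. indicator S (vec_lambda (x(i := t))) \<partial>lborel) = emeasure lborel {t. vec_lambda (x(i := t)) \<in> S}" ..
  qed
  finally show ?thesis .
qed

lemma emeasure_mono_sections:
  fixes S T :: "('a::euclidean_space ^ 'n) set"
  assumes "S \<in> sets borel" "T \<in> sets borel"
    and "\<And>x. emeasure lborel {t. vec_lambda (x(i := t)) \<in> S} \<le> emeasure lborel {t. vec_lambda (x(i := t)) \<in> T}"
  shows "emeasure lborel S \<le> emeasure lborel T"
  unfolding emeasure_sections[OF assms(1), of i] emeasure_sections[OF assms(2), of i]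
  by (intro nn_integral_mono assms)

lemma reflect_axis_nth: "reflect (axis i 1) b $ j = (if j = i then - b $ i else b $ j)" for b :: "real ^ 'n"
proof -
  have "b \<bullet> axis i 1 = b $ i" by (simp add: inner_axis)
  then show ?thesis unfolding reflect_def by (simp add: axis_def)
qed

lemma steiner_axis_iff:
  fixes K :: "(real ^ 'n) set"
  shows "p \<in> steiner (axis i 1) K \<longleftrightarrow>
    (\<exists>a\<in>K. \<exists>b\<in>K. (\<forall>j. j \<noteq> i \<longrightarrow> a $ j = p $ j \<and> b $ j = p $ j) \<and> p $ i = (a $ i - b $ i) / 2)"
proof
  assume "p \<in> steiner (axis i 1) K"
  then obtain a b c where ab: "p = (1/2) *\<^sub>R (a + reflect (axis i 1) b)" "a \<in> K" "b \<in> K" "a - b = c *\<^sub>R axis i 1"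
    by (auto simp: steiner_def)
  have "a $ j = b $ j" if "j \<noteq> i" for j
    using arg_cong[OF ab(4), of "\<lambda>v. v $ j"] that by (simp add: axis_def)
  then show "\<exists>a\<in>K. \<exists>b\<in>K. (\<forall>j. j \<noteq> i \<longrightarrow> a $ j = p $ j \<and> b $ j = p $ j) \<and> p $ i = (a $ i - b $ i) / 2"
    using ab(2,3) by (intro bexI[of _ a] bexI[of _ b]) (auto simp: ab(1) reflect_axis_nth)
next
  assume "\<exists>a\<in>K. \<exists>b\<in>K. (\<forall>j. j \<noteq> i \<longrightarrow> a $ j = p $ j \<and> b $ j = p $ j) \<and> p $ i = (a $ i - b $ i) / 2"
  then obtain a b where ab: "a \<in> K" "b \<in> K" "\<And>j. j \<noteq> i \<Longrightarrow> a $ j = p $ j" "\<And>j. j \<noteq> i \<Longrightarrow> b $ j = p $ j" "p $ i = (a $ i - b $ i) / 2"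
    by auto
  have "p $ j = ((1/2) *\<^sub>R (a + reflect (axis i 1) b)) $ j" for j
    using ab(3)[of j] ab(4)[of j] ab(5) by (cases "j = i") (auto simp: reflect_axis_nth)
  then have "p = (1/2) *\<^sub>R (a + reflect (axis i 1) b)" by (simp add: vec_eq_iff)
  moreover have "a - b = (a $ i - b $ i) *\<^sub>R axis i 1"
    using ab(3,4) by (auto simp: vec_eq_iff axis_def)
  ultimately show "p \<in> steiner (axis i 1) K" using ab(1,2) unfolding steiner_def by blast
qed

text \<open>Sections of \<open>K\<close> parallel to the axis are compact intervals
  \<open>{a..b}\<close>, and those of the symmetrization lie in the interval of equal length centred
  at 0. For the comparison with a ball it suffices that the volume does not grow.\<close>

lemma emeasure_steiner_axis:
  fixes K :: "(real ^ 'n) set"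
  assumes K: "compact K" "convex K"
  shows "emeasure lborel (steiner (axis i 1) K) \<le> emeasure lborel K"
proof (rule emeasure_mono_sections)
  show "steiner (axis i 1) K \<in> sets borel" "K \<in> sets borel"
    using borel_compact[OF compact_steiner[OF K(1)]] borel_compact[OF K(1)] by simp_all
  fix x :: "'n \<Rightarrow> real"
  let ?s = "\<lambda>t. vec_lambda (x(i := t)) :: real ^ 'n"
  define I where "I = {t. ?s t \<in> K}"
  have s: "?s t = t *\<^sub>R axis i 1 + ?s 0" for t by (auto simp: vec_eq_iff axis_def)
  have "I = (\<lambda>v. v \<bullet> axis i 1) ` (K \<inter> range ?s)"
  proof (intro equalityI subsetI)
    fix t assume "t \<in> I"
    then show "t \<in> (\<lambda>v. v \<bullet> axis i 1) ` (K \<inter> range ?s)"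
      by (intro rev_image_eqI[of "?s t"]) (auto simp: I_def inner_axis)
  qed (auto simp: I_def inner_axis)
  moreover have "closed (range ?s)"
  proof -
    have "range ?s = (\<Inter>j\<in>UNIV - {i}. {v. v $ j = x j})"
      by (auto simp: vec_eq_iff image_iff)
    also have "closed \<dots>" by (intro closed_INT ballI closed_Collect_eq continuous_intros)
    finally show ?thesis .
  qed
  ultimately have "compact I"
    using K by (auto intro!: compact_continuous_image continuous_intros compact_Int_closed)
  moreover have "convex I"
  proof (rule convexI)
    fix t t' u v :: real assume h: "t \<in> I" "t' \<in> I" "0 \<le> u" "0 \<le> v" "u + v = 1"
    then have "u *\<^sub>R ?s t + v *\<^sub>R ?s t' \<in> K" using K(2) by (auto simp: I_def dest: convexD)
    also have "u *\<^sub>R ?s t + v *\<^sub>R ?s t' = ?s (u *\<^sub>R t + v *\<^sub>R t')"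
      using h(5) by (auto simp: vec_eq_iff simp flip: distrib_right)
    finally show "u *\<^sub>R t + v *\<^sub>R t' \<in> I" by (simp add: I_def)
  qed
  ultimately obtain a b where I: "I = {a..b}"
    using connected_compact_interval_1[of I] convex_connected by blast
  have sub: "{t. ?s t \<in> steiner (axis i 1) K} \<subseteq> (if a \<le> b then {(a-b)/2..(b-a)/2} else {})"
  proof
    fix t assume "t \<in> {t. ?s t \<in> steiner (axis i 1) K}"
    then obtain p q where pq: "p \<in> K" "q \<in> K" "\<forall>j. j \<noteq> i \<longrightarrow> p $ j = ?s t $ j \<and> q $ j = ?s t $ j" "?s t $ i = (p $ i - q $ i) / 2"
      unfolding mem_Collect_eq steiner_axis_iff by blast
    have "p = ?s (p $ i)" "q = ?s (q $ i)" using pq(3) by (auto simp: vec_eq_iff)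
    then have "p $ i \<in> I" "q $ i \<in> I" using pq(1,2) by (auto simp: I_def)
    then show "t \<in> (if a \<le> b then {(a-b)/2..(b-a)/2} else {})" using pq(4) unfolding I by (auto simp: field_simps)
  qed
  have "emeasure lborel {t. ?s t \<in> steiner (axis i 1) K} \<le> emeasure lborel (if a \<le> b then {(a-b)/2..(b-a)/2} else {})"
    by (rule emeasure_mono[OF sub]) simp
  also have "\<dots> = emeasure lborel I"
  proof -
    have "(b - a) / 2 - (a - b) / 2 = b - a" by (simp add: field_simps)
    then show ?thesis by (auto simp: I emeasure_lborel_Icc_eq)
  qed
  finally show "emeasure lborel {t. ?s t \<in> steiner (axis i 1) K} \<le> emeasure lborel {t. ?s t \<in> K}" by (simp add: I_def)
qed

section \<open>Matrices carrying one set into another\<close>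

definition maps_into :: "(real ^ 'm) set \<Rightarrow> (real ^ 'n) set \<Rightarrow> (real ^ 'm ^ 'n) set" where
  "maps_into Q K = {x. \<forall>q\<in>Q. x *v q \<in> K}"

lemma maps_into_mono: "A \<subseteq> B \<Longrightarrow> maps_into Q A \<subseteq> maps_into Q B"
  by (auto simp: maps_into_def)

lemma linear_matrix_vector_mult_left: "linear (\<lambda>x :: real ^ 'm ^ 'n. x *v q)"
  by (rule linearI) (simp_all add: vec_eq_iff matrix_vector_mult_def sum.distrib sum_distrib_left algebra_simps)

lemma closed_maps_into:
  assumes "closed K"
  shows "closed (maps_into Q K :: (real ^ 'm ^ 'n) set)"
proof -
  have "maps_into Q K = (\<Inter>q\<in>Q. (\<lambda>x. x *v q) -` K)" by (auto simp: maps_into_def)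
  moreover have "continuous_on UNIV (\<lambda>x :: real ^ 'm ^ 'n. x *v q)" for q
    using linear_matrix_vector_mult_left by (intro linear_continuous_on) (simp add: linear_conv_bounded_linear[symmetric])
  ultimately show ?thesis using assms by (auto intro!: closed_INT closed_vimage)
qed

text \<open>With all other rows fixed, row \<open>i\<close> affects only the \<open>i\<close>-th
  entry of \<open>x *v q\<close>, and linearly. For rows \<open>s\<close> and \<open>- t\<close> in
  the section of the first set, the images of \<open>q\<close> are two points of \<open>K\<close> on
  one chord, and half the difference of their \<open>i\<close>-th entries is the entry produced by
  the row (s + t) / 2. So midpoints of the section and its mirror image lie in the section of the
  second set.\<close>

lemma emeasure_maps_into_steiner_axis:
  fixes K :: "(real ^ 'n) set"
  assumes K: "compact K"
  shows "emeasure lborel (maps_into Q K :: (real ^ 'm ^ 'n) set) \<le> emeasure lborel (maps_into Q (steiner (axis i 1) K) :: (real ^ 'm ^ 'n) set)"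
proof (rule emeasure_mono_sections)
  let ?K = "steiner (axis i 1) K"
  show b: "(maps_into Q K :: (real ^ 'm ^ 'n) set) \<in> sets borel" "(maps_into Q ?K :: (real ^ 'm ^ 'n) set) \<in> sets borel"
    by (rule borel_closed[OF closed_maps_into[OF compact_imp_closed[OF K]]],
        rule borel_closed[OF closed_maps_into[OF compact_imp_closed[OF compact_steiner[OF K]]]])
  fix x :: "'n \<Rightarrow> real ^ 'm"
  let ?s = "\<lambda>t. vec_lambda (x(i := t)) :: real ^ 'm ^ 'n"
  let ?T = "{t. ?s t \<in> maps_into Q K}"
  let ?T' = "{t. ?s t \<in> maps_into Q ?K}"
  have T: "?T \<in> sets borel" "?T' \<in> sets borel"
    using measurable_sets_borel[OF measurable_section b(1)] measurable_sets_borel[OF measurable_section b(2)]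
    by (simp_all add: vimage_def)
  have "orthogonal_transformation (uminus :: real ^ 'm \<Rightarrow> real ^ 'm)"
    by (simp add: orthogonal_transformation_def linear_uminus)
  then have neg: "emeasure lborel (uminus -` ?T) = emeasure lborel ?T" using T(1) by (rule emeasure_orthogonal_vimage)
  have "emeasure lborel ?T * emeasure lborel (uminus -` ?T) \<le> (emeasure lborel ?T')\<^sup>2"
  proof (rule brunn_minkowski_vec)
    show "uminus -` ?T \<in> sets borel" using T(1) measurable_sets_borel[of uminus borel ?T] by simp
    fix s t assume "s \<in> ?T" "t \<in> uminus -` ?T"
    then have st: "?s s *v q \<in> K" "?s (- t) *v q \<in> K" if "q \<in> Q" for q using that by (auto simp: maps_into_def)
    have row: "(?s t *v q) $ j = (if j = i then t \<bullet> q else x j \<bullet> q)" for t q j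
      by (simp add: matrix_vector_mult_def inner_vec_def)
    have "?s ((1/2) *\<^sub>R (s + t)) *v q \<in> ?K" if "q \<in> Q" for q
      unfolding steiner_axis_iff
      by (rule bexI[OF _ st(1)[OF that]], rule bexI[OF _ st(2)[OF that]]) (simp add: row inner_add_left)
    then show "(1/2) *\<^sub>R (s + t) \<in> ?T'" by (simp add: maps_into_def)
  qed (use T in auto)
  then show "emeasure lborel ?T \<le> emeasure lborel ?T'"
    unfolding neg by (rule ennreal_le_of_square_le)
qed

lemma inner_matrix_columns:
  fixes x y :: "real ^ 'm ^ 'n"
  shows "x \<bullet> y = (\<Sum>k\<in>UNIV. (x *v axis k 1) \<bullet> (y *v axis k 1))"
proof -
  have "x \<bullet> y = (\<Sum>i\<in>UNIV. \<Sum>k\<in>UNIV. x $ i $ k * y $ i $ k)" by (simp add: inner_vec_def)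
  also have "\<dots> = (\<Sum>k\<in>UNIV. \<Sum>i\<in>UNIV. x $ i $ k * y $ i $ k)" by (rule sum.swap)
  finally show ?thesis by (simp add: matrix_vector_mult_basis column_def inner_vec_def)
qed

text \<open>Left multiplication by the matrix of \<open>R\<close> acts on each column by
  \<open>R\<close>, hence by \<open>inner_matrix_columns\<close> it is orthogonal on the space of
  matrices.\<close>

lemma emeasure_maps_into_orthogonal:
  fixes R :: "real ^ 'n \<Rightarrow> real ^ 'n"
  assumes R: "orthogonal_transformation R" and K: "compact K"
  shows "emeasure lborel (maps_into Q (R ` K) :: (real ^ 'm ^ 'n) set) = emeasure lborel (maps_into Q K :: (real ^ 'm ^ 'n) set)"
proof -
  define G where "G x = matrix R ** x" for x :: "real ^ 'm ^ 'n"
  have lin: "linear R" using R by (rule orthogonal_transformation_linear)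
  have G: "G x *v q = R (x *v q)" for x q
    by (simp add: G_def matrix_vector_mul_assoc[symmetric] matrix_works lin)
  have "linear G" unfolding G_def
    by (rule linearI) (simp_all add: matrix_add_ldistrib matrix_scalar_ac scalar_matrix_assoc vec_eq_iff matrix_matrix_mult_def sum_distrib_left algebra_simps sum.distrib)
  then have "orthogonal_transformation G"
    using R by (simp add: orthogonal_transformation_def inner_matrix_columns[of "G _"] inner_matrix_columns G)
  moreover have "compact (R ` K)"
    using K lin by (intro compact_continuous_image linear_continuous_on) (auto simp: linear_conv_bounded_linear)
  ultimately have "emeasure lborel (G -` maps_into Q (R ` K)) = emeasure lborel (maps_into Q (R ` K) :: (real ^ 'm ^ 'n) set)"
    by (intro emeasure_orthogonal_vimage borel_closed closed_maps_into compact_imp_closed)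
  moreover have "G -` maps_into Q (R ` K) = maps_into Q K"
    using orthogonal_transformation_inj[OF R] by (auto simp: maps_into_def G inj_image_mem_iff)
  ultimately show ?thesis by simp
qed

text \<open>The coordinate computations concern axis directions; a rotation taking an axis to
  \<open>u\<close> transfers them to every unit vector. Which axis is taken is immaterial.\<close>

lemma steiner_rotated:
  fixes u :: "real ^ 'n" and K :: "(real ^ 'n) set"
  assumes u: "norm u = 1" and K: "compact K"
  obtains R :: "real ^ 'n \<Rightarrow> real ^ 'n" and K' :: "(real ^ 'n) set" and i :: 'n where "orthogonal_transformation R" "K = R ` K'" "steiner u K = R ` steiner (axis i 1) K'"
    "compact K'" "convex K \<Longrightarrow> convex K'"
proof -
  define i :: 'n where "i = undefined"
  have a: "norm (axis i 1 :: real ^ 'n) = 1" by (rule norm_axis_1)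
  obtain R :: "real ^ 'n \<Rightarrow> real ^ 'n" where R: "orthogonal_transformation R" "R (axis i 1) = u"
    by (rule orthogonal_transformation_exists_1[OF a u])
  have S: "orthogonal_transformation (inv R)" using R(1) by (rule orthogonal_transformation_inv)
  have lin: "linear (inv R)" using S by (rule orthogonal_transformation_linear)
  define K' where "K' = inv R ` K"
  have "K = R ` K'"
    using orthogonal_transformation_surj[OF R(1)] by (simp add: K'_def image_image surj_f_inv_f)
  moreover have "steiner u K = R ` steiner (axis i 1) K'"
    using steiner_similarity[OF R(1) one_neq_zero, of "axis i 1" K'] \<open>K = R ` K'\<close> R(2) by simp
  moreover have "compact K'"
    unfolding K'_def using K lin by (intro compact_continuous_image linear_continuous_on) (auto simp: linear_conv_bounded_linear)
  moreover have "convex K'" if "convex K" unfolding K'_def using lin that by (rule convex_linear_image)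
  ultimately show thesis using that R(1) by blast
qed

lemma emeasure_steiner:
  fixes K :: "(real ^ 'n) set"
  assumes u: "norm u = 1" and K: "compact K" "convex K"
  shows "emeasure lborel (steiner u K) \<le> emeasure lborel K"
proof -
  obtain R :: "real ^ 'n \<Rightarrow> real ^ 'n" and K' :: "(real ^ 'n) set" and i :: 'n where *: "orthogonal_transformation R" "K = R ` K'" "steiner u K = R ` steiner (axis i 1) K'" "compact K'" "convex K'"
    by (rule steiner_rotated[OF u K(1)]) (use K(2) in blast)
  have "emeasure lborel (steiner u K) = emeasure lborel (steiner (axis i 1) K')"
    unfolding *(3) by (rule emeasure_orthogonal_image[OF *(1) compact_steiner[OF *(4)]])
  also have "\<dots> \<le> emeasure lborel K'" by (rule emeasure_steiner_axis[OF *(4,5)])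
  also have "\<dots> = emeasure lborel K" unfolding *(2) by (rule emeasure_orthogonal_image[OF *(1,4), symmetric])
  finally show ?thesis .
qed

lemma emeasure_maps_into_steiner:
  fixes K :: "(real ^ 'n) set"
  assumes u: "norm u = 1" and K: "compact K"
  shows "emeasure lborel (maps_into Q K :: (real ^ 'm ^ 'n) set) \<le> emeasure lborel (maps_into Q (steiner u K) :: (real ^ 'm ^ 'n) set)"
proof -
  obtain R :: "real ^ 'n \<Rightarrow> real ^ 'n" and K' :: "(real ^ 'n) set" and i :: 'n where *: "orthogonal_transformation R" "K = R ` K'" "steiner u K = R ` steiner (axis i 1) K'" "compact K'"
    by (rule steiner_rotated[OF u K])
  show ?thesis
    unfolding *(3) unfolding *(2) emeasure_maps_into_orthogonal[OF *(1) compact_steiner[OF *(4)]] emeasure_maps_into_orthogonal[OF *(1,4)]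
    by (rule emeasure_maps_into_steiner_axis[OF *(4)])
qed

lemma emeasure_fold_steiner:
  fixes K :: "(real ^ 'n) set"
  assumes "\<forall>u\<in>set us. norm u = 1" "compact K" "convex K"
  shows "emeasure lborel (fold steiner us K) \<le> emeasure lborel K"
  using assms
proof (induction us arbitrary: K)
  case (Cons u us)
  have "emeasure lborel (fold steiner us (steiner u K)) \<le> emeasure lborel (steiner u K)"
    using Cons.prems by (intro Cons.IH compact_steiner convex_steiner) auto
  also have "\<dots> \<le> emeasure lborel K" using Cons.prems by (intro emeasure_steiner) auto
  finally show ?case by simp
qed simp

lemma emeasure_maps_into_fold_steiner:
  fixes K :: "(real ^ 'n) set"
  assumes "\<forall>u\<in>set us. norm u = 1" "compact K"
  shows "emeasure lborel (maps_into Q K :: (real ^ 'm ^ 'n) set) \<le> emeasure lborel (maps_into Q (fold steiner us K) :: (real ^ 'm ^ 'n) set)"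
  using assms
proof (induction us arbitrary: K)
  case (Cons u us)
  have "emeasure lborel (maps_into Q K :: (real ^ 'm ^ 'n) set) \<le> emeasure lborel (maps_into Q (steiner u K) :: (real ^ 'm ^ 'n) set)"
    using Cons.prems by (intro emeasure_maps_into_steiner) auto
  also have "\<dots> \<le> emeasure lborel (maps_into Q (fold steiner us (steiner u K)) :: (real ^ 'm ^ 'n) set)"
    using Cons.prems by (intro Cons.IH compact_steiner) auto
  finally show ?case by simp
qed simp

text \<open>An infimum takes the place of a convergent sequence of bodies. If the infimum
  \<open>R0\<close> of the radii that can be reached exceeded \<open>r\<close>, a symmetrized body
  in a ball of radius close to \<open>R0\<close> would miss a cap of definite relative size, and
  further symmetrizations would shrink it below \<open>R0\<close>.\<close>

theorem steiner_symmetrization_to_ball: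
  fixes K :: "(real ^ 'n) set"
  assumes K: "compact K" "convex K" and r: "0 < r" "r < s"
    and vol: "emeasure lborel K \<le> emeasure lborel (cball (0 :: real ^ 'n) r)"
  obtains us where "\<forall>u\<in>set us. norm u = 1" "fold steiner us K \<subseteq> cball 0 s"
proof -
  \<comment> \<open>The condition \<open>r \<le> R\<close> makes the infimum positive; it is the
    reason for the \<open>max r\<close> below.\<close>
  define I where "I = {R. r \<le> R \<and> (\<exists>us. (\<forall>u\<in>set us. norm u = 1) \<and> fold steiner us K \<subseteq> cball 0 R)}"
  have bdd: "bdd_below I" by (rule bdd_belowI[of _ r]) (simp add: I_def)
  obtain B where "\<forall>x\<in>K. norm x \<le> B" using compact_imp_bounded[OF K(1)] unfolding bounded_iff by blast
  then have "K \<subseteq> cball 0 (max r B)" by (auto simp: le_max_iff_disj)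
  then have "max r B \<in> I" unfolding I_def by (auto intro!: exI[of _ "[]"])
  then have ne: "I \<noteq> {}" by blast
  define R0 where "R0 = Inf I"
  have R0: "r \<le> R0" unfolding R0_def using ne by (rule cInf_greatest) (simp add: I_def)
  have "R0 \<le> r"
  proof (rule ccontr)
    assume "\<not> R0 \<le> r"
    define r' where "r' = (r + R0) / 2"
    have r': "r < r'" "r' < R0" using \<open>\<not> R0 \<le> r\<close> by (auto simp: r'_def)
    \<comment> \<open>The cap height is normalised by \<open>R0\<close> and not by the radius
      \<open>R\<close> used later, so that \<open>d\<close> is available before \<open>R\<close> is
      chosen with \<open>R * (1 - d) < R0\<close>.\<close>
    have "r' / R0 < 1" using r r' by (simp add: field_simps)
    then obtain d where d: "0 < d" "d < 1"
      "\<forall>v :: real ^ 'n. norm v = 1 \<longrightarrow> (\<exists>us. (\<forall>u\<in>set us. norm u = 1) \<and> fold steiner us (cball 0 1 \<inter> {x. x \<bullet> v \<le> r' / R0}) \<subseteq> cball 0 (1 - d))"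
      by (rule uniform_cap_symmetrization)
    have "Inf I < min (R0 / (1 - d)) (R0 + 1)" using d r' r R0_def[symmetric] by (simp add: field_simps)
    then obtain R where R: "R \<in> I" "R < R0 / (1 - d)" using cInf_less_iff[OF ne bdd] by auto
    have "R0 \<le> R" unfolding R0_def by (rule cInf_lower[OF R(1) bdd])
    then have Rpos: "0 < R" using r r' by linarith
    obtain us where us: "\<forall>u\<in>set us. norm u = 1" "fold steiner us K \<subseteq> cball 0 R" using R(1) by (auto simp: I_def)
    define C where "C = fold steiner us K"
    have C: "compact C" "convex C" unfolding C_def using K by (auto intro: fold_steiner_compact fold_steiner_convex)
    have "emeasure lborel C \<le> emeasure lborel (cball (0 :: real ^ 'n) r)"
      unfolding C_def using emeasure_fold_steiner[OF us(1) K] vol by (rule order_trans)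
    then obtain v where v: "norm v = 1" "C \<subseteq> {x. x \<bullet> v \<le> r'}"
      using halfspace_of_small_volume[of C r r'] C r r' compact_imp_closed by (metis less_imp_le)
    obtain ws where ws: "\<forall>u\<in>set ws. norm u = 1" "fold steiner ws (cball 0 1 \<inter> {x. x \<bullet> v \<le> r' / R0}) \<subseteq> cball 0 (1 - d)"
      using d(3) v(1) by blast
    have "C \<subseteq> (\<lambda>x. R *\<^sub>R id x) ` (cball 0 1 \<inter> {x. x \<bullet> v \<le> r' / R0})"
    proof
      fix x assume x: "x \<in> C"
      have nx: "norm x \<le> R" using x us(2) by (auto simp: C_def)
      have "x \<bullet> v / R \<le> r' / R" using x v(2) Rpos by (auto intro!: divide_right_mono)
      also have "\<dots> \<le> r' / R0" using \<open>R0 \<le> R\<close> r r' by (intro divide_left_mono) auto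
      finally have "inverse R *\<^sub>R x \<in> cball 0 1 \<inter> {x. x \<bullet> v \<le> r' / R0}"
        using nx Rpos by (simp add: field_simps)
      moreover have "x = R *\<^sub>R id (inverse R *\<^sub>R x)" using Rpos by simp
      ultimately show "x \<in> (\<lambda>x. R *\<^sub>R id x) ` (cball 0 1 \<inter> {x. x \<bullet> v \<le> r' / R0})" by blast
    qed
    then have "fold steiner (map id ws) C \<subseteq> fold steiner (map id ws) ((\<lambda>x. R *\<^sub>R id x) ` (cball 0 1 \<inter> {x. x \<bullet> v \<le> r' / R0}))"
      by (rule fold_steiner_mono)
    also have "\<dots> = (\<lambda>x. R *\<^sub>R id x) ` fold steiner ws (cball 0 1 \<inter> {x. x \<bullet> v \<le> r' / R0})"
      by (rule fold_steiner_similarity) (use Rpos in \<open>auto simp: id_def orthogonal_transformation_id\<close>)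
    also have "\<dots> \<subseteq> (\<lambda>x. R *\<^sub>R id x) ` cball 0 (1 - d)" using ws(2) by (rule image_mono)
    also have "\<dots> \<subseteq> cball 0 (max r (R * (1 - d)))" using Rpos by (auto simp: le_max_iff_disj)
    finally have "fold steiner (us @ ws) K \<subseteq> cball 0 (max r (R * (1 - d)))" by (simp add: C_def)
    then have "max r (R * (1 - d)) \<in> I" using us(1) ws(1) unfolding I_def by (auto intro!: exI[of _ "us @ ws"])
    then have "R0 \<le> max r (R * (1 - d))" unfolding R0_def by (rule cInf_lower[OF _ bdd])
    moreover have "R * (1 - d) < R0" using R(2) d by (simp add: field_simps)
    ultimately show False using r' by auto
  qed
  then have "Inf I < s" using r by (simp add: R0_def)
  then obtain R where "R \<in> I" "R < s" using cInf_less_iff[OF ne bdd] by auto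
  then obtain us where "\<forall>u\<in>set us. norm u = 1" "fold steiner us K \<subseteq> cball 0 R" by (auto simp: I_def)
  moreover have "cball (0 :: real ^ 'n) R \<subseteq> cball 0 s" using \<open>R < s\<close> by (intro subset_cball) simp
  ultimately show thesis using that by blast
qed

lemma emeasure_maps_into_cball:
  assumes s: "0 < s"
  shows "emeasure lborel (maps_into Q (cball 0 s) :: (real ^ 'm ^ 'n) set)
       = ennreal (s ^ (CARD('n) * CARD('m))) * emeasure lborel (maps_into Q (cball 0 1) :: (real ^ 'm ^ 'n) set)"
proof -
  let ?A = "\<lambda>s. maps_into Q (cball 0 s) :: (real ^ 'm ^ 'n) set"
  have m: "?A s \<in> sets borel" for s by (intro borel_closed closed_maps_into closed_cball)
  have "emeasure lborel (?A s) = (\<integral>\<^sup>+x. indicator (?A s) x \<partial>lborel)" using m by simp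
  also have "\<dots> = ennreal (s ^ DIM(real ^ 'm ^ 'n)) * (\<integral>\<^sup>+x. indicator (?A s) (s *\<^sub>R x) \<partial>lborel)"
    using m by (intro nn_integral_lborel_scale s borel_measurable_indicator)
  also have "(\<integral>\<^sup>+x. indicator (?A s) (s *\<^sub>R x) \<partial>lborel) = (\<integral>\<^sup>+x. indicator (?A 1) x \<partial>lborel)"
  proof (rule nn_integral_cong)
    fix x :: "real ^ 'm ^ 'n"
    have "(s *\<^sub>R x) *v q = s *\<^sub>R (x *v q)" for q using linear_scale[OF linear_matrix_vector_mult_left] .
    then show "indicator (?A s) (s *\<^sub>R x) = (indicator (?A 1) x :: ennreal)"
      using s by (auto simp: indicator_def maps_into_def)
  qed
  finally show ?thesis using m by simp
qed

text \<open>Symmetrization is only guaranteed to reach radii \<open>s > r\<close>, so the bound is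
  first obtained for these by homogeneity and then for \<open>r\<close> in the limit from the
  right.\<close>

theorem emeasure_maps_into_le_ball:
  fixes K :: "(real ^ 'n) set"
  assumes K: "compact K" "convex K" and r: "0 < r"
    and vol: "emeasure lborel K \<le> emeasure lborel (cball (0 :: real ^ 'n) r)"
    and fin: "emeasure lborel (maps_into Q (cball 0 1) :: (real ^ 'm ^ 'n) set) = ennreal F" "0 \<le> F"
  shows "emeasure lborel (maps_into Q K :: (real ^ 'm ^ 'n) set) \<le> ennreal (r ^ (CARD('n) * CARD('m)) * F)"
proof (rule tendsto_lowerbound)
  let ?N = "CARD('n) * CARD('m)"
  have "((\<lambda>s. s ^ ?N * F) \<longlongrightarrow> r ^ ?N * F) (at_right r)" by (intro tendsto_intros)
  then show "((\<lambda>s. ennreal (s ^ ?N * F)) \<longlongrightarrow> ennreal (r ^ ?N * F)) (at_right r)" by (rule tendsto_ennrealI)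
  show "\<forall>\<^sub>F s in at_right r. emeasure lborel (maps_into Q K :: (real ^ 'm ^ 'n) set) \<le> ennreal (s ^ ?N * F)"
    using eventually_at_right_less[of r]
  proof eventually_elim
    case (elim s)
    obtain us where us: "\<forall>u\<in>set us. norm u = 1" "fold steiner us K \<subseteq> cball 0 s"
      using steiner_symmetrization_to_ball[OF K r elim vol] by blast
    have "emeasure lborel (maps_into Q K :: (real ^ 'm ^ 'n) set) \<le> emeasure lborel (maps_into Q (fold steiner us K) :: (real ^ 'm ^ 'n) set)"
      by (rule emeasure_maps_into_fold_steiner[OF us(1) K(1)])
    also have "\<dots> \<le> emeasure lborel (maps_into Q (cball 0 s) :: (real ^ 'm ^ 'n) set)"
      using us(2) by (intro emeasure_mono maps_into_mono) (auto intro!: borel_closed closed_maps_into)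
    also have "\<dots> = ennreal (s ^ ?N * F)"
      using r elim fin by (subst emeasure_maps_into_cball) (auto simp: ennreal_mult')
    finally show ?case .
  qed
qed simp

section \<open>Polar bodies and the main inequality\<close>

lemma vol_eq_measure_lborel: "S \<in> sets borel \<Longrightarrow> vol S = measure lborel S"
  by (simp add: vol_def measure_completion)

lemma emeasure_eq_vol:
  assumes "compact S"
  shows "emeasure lborel S = ennreal (vol S)"
  using emeasure_compact_finite[OF assms] borel_compact[OF assms]
  by (simp add: vol_eq_measure_lborel emeasure_eq_ennreal_measure)

lemma support_fun_upper:
  assumes "bounded G" "y \<in> G"
  shows "y \<bullet> x \<le> support_fun G x"
proof -
  obtain B where B: "\<forall>y\<in>G. norm y \<le> B" using assms unfolding bounded_iff by blast
  have "y \<bullet> x \<le> B * norm x" if "y \<in> G" for y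
    using norm_cauchy_schwarz[of y x] B that by (meson mult_right_mono norm_ge_zero order_trans)
  then have "bdd_above ((\<lambda>y. y \<bullet> x) ` G)" by (intro bdd_aboveI2)
  then show ?thesis unfolding support_fun_def using assms(2) by (intro cSUP_upper)
qed

lemma support_fun_le_iff:
  assumes "bounded G" "G \<noteq> {}"
  shows "support_fun G x \<le> c \<longleftrightarrow> (\<forall>y\<in>G. y \<bullet> x \<le> c)"
  using support_fun_upper[OF assms(1)] assms(2)
  by (auto simp: support_fun_def intro: order_trans intro!: cSUP_least)

lemma polar_body_eq:
  assumes "bounded G" "G \<noteq> {}"
  shows "polar_body G = {x. \<forall>y\<in>G. y \<bullet> x \<le> 1}"
  unfolding polar_body_def support_fun_le_iff[OF assms] ..

lemma closed_polar_body:
  fixes G :: "'a::euclidean_space set"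
  assumes "bounded G" "G \<noteq> {}"
  shows "closed (polar_body G)"
proof -
  have "polar_body G = (\<Inter>y\<in>G. {x. y \<bullet> x \<le> 1})" unfolding polar_body_eq[OF assms] by auto
  then show ?thesis by (auto intro!: closed_INT closed_halfspace_le)
qed

lemma compact_polar_body:
  fixes G :: "'a::euclidean_space set"
  assumes "bounded G" "0 \<in> interior G"
  shows "compact (polar_body G)"
proof -
  have "G \<noteq> {}" using assms(2) interior_subset by blast
  obtain e where e: "0 < e" "cball 0 e \<subseteq> G" using assms(2) by (auto simp: mem_interior_cball)
  have "norm x \<le> 1 / e" if "x \<in> polar_body G" for x
  proof (cases "x = 0")
    case False
    have "(e / norm x) *\<^sub>R x \<in> G" using e False by (intro subsetD[OF e(2)]) simp
    then have "((e / norm x) *\<^sub>R x) \<bullet> x \<le> 1" using that unfolding polar_body_eq[OF assms(1) \<open>G \<noteq> {}\<close>] by blast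
    then have "e * norm x \<le> 1" using False by (simp add: power2_norm_eq_inner[symmetric] power2_eq_square)
    then show ?thesis using e by (simp add: field_simps)
  qed (use e in simp)
  then have "bounded (polar_body G)" unfolding bounded_iff by blast
  then show ?thesis using closed_polar_body[OF assms(1) \<open>G \<noteq> {}\<close>] by (simp add: compact_eq_bounded_closed)
qed

section \<open>Criticality of the Santalo point\<close>

lemma nn_integral_exp_tail:
  assumes "0 \<le> c"
  shows "(\<integral>\<^sup>+s. ennreal (exp (- s)) * indicator {c..} s \<partial>lborel) = ennreal (exp (- c))"
proof -
  have "(\<integral>\<^sup>+s. ennreal (exp (- s)) * indicator {c..} s \<partial>lborel) = ennreal (0 - (- exp (- c)))"
  proof (rule nn_integral_FTC_atLeast)
    have "((\<lambda>s::real. exp (- s)) \<longlongrightarrow> 0) at_top"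
      by (rule filterlim_compose[OF exp_at_bot filterlim_uminus_at_bot_at_top])
    then show "((\<lambda>s::real. - exp (- s)) \<longlongrightarrow> 0) at_top" using tendsto_minus by fastforce
    show "((\<lambda>s. - exp (- s)) has_real_derivative exp (- x)) (at x)" for x :: real
      by (auto intro!: derivative_eq_intros)
  qed auto
  then show ?thesis by simp
qed

lemma exp_le_quadratic: "exp t \<le> 1 + t + t\<^sup>2 * exp \<bar>t\<bar>" for t :: real
proof -
  have a: "exp s - 1 \<le> s * exp s" for s :: real
  proof -
    have "(1 - s) * exp s \<le> exp (- s) * exp s"
      using exp_ge_add_one_self[of "- s"] by (intro mult_right_mono) auto
    then show ?thesis by (simp add: exp_minus left_diff_distrib)
  qed
  have b: "\<bar>exp t - 1\<bar> \<le> \<bar>t\<bar> * exp \<bar>t\<bar>"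
  proof (cases "0 \<le> t")
    case True then show ?thesis using a[of t] by simp
  next
    case False
    have "1 - exp t \<le> - t" using exp_ge_add_one_self[of t] by linarith
    also have "- t \<le> - t * exp (- t)" using False by (simp add: mult_le_cancel_left1)
    finally show ?thesis using False by simp
  qed
  have "t * (exp t - 1) \<le> \<bar>t\<bar> * \<bar>exp t - 1\<bar>" by (simp add: abs_mult[symmetric])
  also have "\<dots> \<le> \<bar>t\<bar> * (\<bar>t\<bar> * exp \<bar>t\<bar>)" using b by (rule mult_left_mono) simp
  also have "\<dots> = t\<^sup>2 * exp \<bar>t\<bar>" by (simp add: power2_eq_square flip: mult.assoc abs_mult)
  finally show ?thesis using a[of t] by (simp add: right_diff_distrib)
qed

lemma square_le_exp: "a\<^sup>2 \<le> 4 * exp \<bar>a\<bar>" for a :: real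
proof -
  have "\<bar>a\<bar> / 2 \<le> exp (\<bar>a\<bar> / 2)" using exp_ge_add_one_self[of "\<bar>a\<bar> / 2"] by linarith
  then have "(\<bar>a\<bar> / 2)\<^sup>2 \<le> (exp (\<bar>a\<bar> / 2))\<^sup>2" by (intro power_mono) auto
  also have "(exp (\<bar>a\<bar> / 2))\<^sup>2 = exp \<bar>a\<bar>" by (simp add: exp_double[symmetric])
  finally show ?thesis by (simp add: power_divide)
qed

text \<open>The error is \<open>e\<^sup>2\<close> times a function free of \<open>e\<close>. For
  \<open>a\<close> a small multiple of a coordinate that function is integrable against the density
  in question, so the first-order condition follows without differentiating under the
  integral.\<close>

lemma exp_perturbation:
  fixes a e :: real
  assumes "0 < e" "e \<le> 1"
  shows "exp (e * a) \<le> 1 + e * a + e\<^sup>2 * (4 * (exp (2 * a) + exp (- 2 * a)))"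
proof -
  have "exp \<bar>e * a\<bar> \<le> exp \<bar>a\<bar>" using assms by (simp add: abs_mult mult_left_le_one_le)
  then have "(e * a)\<^sup>2 * exp \<bar>e * a\<bar> \<le> (e * a)\<^sup>2 * exp \<bar>a\<bar>" by (rule mult_left_mono) simp
  also have "\<dots> = e\<^sup>2 * (a\<^sup>2 * exp \<bar>a\<bar>)" by (simp add: power_mult_distrib)
  also have "\<dots> \<le> e\<^sup>2 * ((4 * exp \<bar>a\<bar>) * exp \<bar>a\<bar>)" by (intro mult_left_mono mult_right_mono square_le_exp) auto
  also have "(4 * exp \<bar>a\<bar>) * exp \<bar>a\<bar> = 4 * exp (2 * \<bar>a\<bar>)" by (simp add: exp_double power2_eq_square)
  also have "e\<^sup>2 * (4 * exp (2 * \<bar>a\<bar>)) \<le> e\<^sup>2 * (4 * (exp (2 * a) + exp (- 2 * a)))"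
    by (intro mult_left_mono) (auto simp: abs_if)
  finally show ?thesis using exp_le_quadratic[of "e * a"] by linarith
qed

text \<open>Minimality of the volume of the polar at the origin is differentiated through
  \<open>z \<mapsto> \<integral> exp (z \<bullet> y - h y) dy\<close>, which is a fixed multiple of the volume of the
  polar of the translate by \<open>-z\<close>.\<close>

lemma santalo_position_balanced:
  fixes K :: "(real ^ 'n) set"
  assumes K: "compact K" and sp: "santalo_position K"
  shows "(\<integral>\<^sup>+y. ennreal (y $ i) * indicator (polar_body K) y \<partial>lborel) = (\<integral>\<^sup>+y. ennreal (- y $ i) * indicator (polar_body K) y \<partial>lborel)"
    and "(\<integral>\<^sup>+y. ennreal (y $ i) * indicator (polar_body K) y \<partial>lborel) < top"
proof -
  define h where "h = support_fun K"
  have bK: "bounded K" using K by (rule compact_imp_bounded)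
  have int0: "0 \<in> interior K" using sp by (simp add: santalo_position_def)
  then have neK: "K \<noteq> {}" using interior_subset by blast
  define T where "T z = polar_body ((\<lambda>x. x - z) ` K)" for z
  have Tc: "compact (T z)" if z: "z \<in> interior K" for z
    unfolding T_def
  proof (rule compact_polar_body)
    show "bounded ((\<lambda>x. x - z) ` K)" using bounded_translation_minus[OF bK] .
    obtain e where e: "0 < e" "ball z e \<subseteq> K" using z by (auto simp: mem_interior)
    have "ball (0 :: real ^ 'n) e \<subseteq> (\<lambda>x. x - z) ` K"
    proof
      fix x :: "real ^ 'n" assume "x \<in> ball 0 e"
      then have "x + z \<in> K" using e by (auto simp: dist_norm)
      then show "x \<in> (\<lambda>x. x - z) ` K" by (intro rev_image_eqI[of "x + z"]) auto
    qed
    then show "0 \<in> interior ((\<lambda>x. x - z) ` K)" using e by (auto simp: mem_interior)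
  qed
  have T0: "T 0 = polar_body K" by (simp add: T_def)
  \<comment> \<open>Thus \<open>h y - z \<bullet> y\<close> is the gauge of \<open>T z\<close>, and
    with the weight \<open>exp (- s)\<close> the layers of \<open>T z\<close> add up to
    \<open>exp (z \<bullet> y - h y)\<close>, where \<open>z\<close> occurs only linearly in the
    exponent.\<close>
  have Tiff: "y \<in> T z \<longleftrightarrow> h y - z \<bullet> y \<le> 1" for y z
  proof -
    have "y \<in> T z \<longleftrightarrow> (\<forall>x\<in>K. (x - z) \<bullet> y \<le> 1)"
      unfolding T_def using bounded_translation_minus[OF bK] neK by (subst polar_body_eq) auto
    also have "\<dots> \<longleftrightarrow> (\<forall>x\<in>K. x \<bullet> y \<le> 1 + z \<bullet> y)" by (auto simp: inner_diff_left algebra_simps)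
    also have "\<dots> \<longleftrightarrow> h y \<le> 1 + z \<bullet> y" unfolding h_def by (rule support_fun_le_iff[OF bK neK, symmetric])
    finally show ?thesis by linarith
  qed
  have hs: "h (s *\<^sub>R y) = s * h y" if "0 < s" for s y
  proof -
    have 1: "h (c *\<^sub>R y) \<le> c * h y" if "0 < c" for c y
      unfolding h_def support_fun_le_iff[OF bK neK] using support_fun_upper[OF bK, of _ y] that by simp
    have "h y \<le> inverse s * h (s *\<^sub>R y)" using 1[of "inverse s" "s *\<^sub>R y"] that by simp
    then have "s * h y \<le> h (s *\<^sub>R y)" using that by (simp add: field_simps)
    then show ?thesis using 1[OF that, of y] by simp
  qed
  let ?w = "\<lambda>s::real. ennreal (exp (- s))"
  have lay: "layers ?w (T z) y = ennreal (exp (z \<bullet> y - h y))" if z: "z \<in> K" for z y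
  proof -
    have nn: "0 \<le> h y - z \<bullet> y" using support_fun_upper[OF bK z, of y] by (simp add: h_def)
    have "layers ?w (T z) y = (\<integral>\<^sup>+s. ?w s * indicator {h y - z \<bullet> y..} s \<partial>lborel)"
      unfolding layers_def
    proof (rule nn_integral_cong_AE)
      show "AE s in lborel. ?w s * (indicator {0<..} s * indicator (T z) (inverse s *\<^sub>R y)) = ?w s * indicator {h y - z \<bullet> y..} s"
        using AE_lborel_singleton[of "0::real"]
      proof eventually_elim
        case (elim s)
        show ?case
        proof (cases "0 < s")
          case True
          have "inverse s *\<^sub>R y \<in> T z \<longleftrightarrow> inverse s * (h y - z \<bullet> y) \<le> 1"
            unfolding Tiff using hs[of "inverse s" y] True by (simp add: right_diff_distrib)
          also have "\<dots> \<longleftrightarrow> h y - z \<bullet> y \<le> s" using True by (simp add: field_simps)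
          finally show ?thesis using True by (simp add: indicator_def)
        next
          case False
          then show ?thesis using nn elim by (auto simp: indicator_def)
        qed
      qed
    qed
    then show ?thesis using nn_integral_exp_tail[OF nn] by simp
  qed
  define J where "J d = (\<integral>\<^sup>+s. ?w s * ennreal (s ^ (CARD('n) + d)) * indicator {0<..} s \<partial>lborel)" for d
  have J_top: "J d < top" for d
  proof -
    have "J d = (\<integral>\<^sup>+s. ennreal (s ^ (CARD('n) + d) * exp (- s)) * indicator {0<..} s \<partial>lborel)"
      unfolding J_def by (intro nn_integral_cong) (auto simp: indicator_def ennreal_mult'[symmetric] mult_ac)
    then show ?thesis using nn_integral_power_exp_finite[of "CARD('n) + d"] by (simp only:)
  qed
  have J_pos: "J d \<noteq> 0" for d
  proof -
    have "0 < ennreal (exp (- 2))" by simp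
    also have "ennreal (exp (- 2)) = (\<integral>\<^sup>+s. ennreal (exp (- 2)) * indicator {1<..2} (s::real) \<partial>lborel)"
      by (simp add: nn_integral_cmult)
    also have "\<dots> \<le> J d"
      unfolding J_def
    proof (rule nn_integral_mono)
      fix s :: real
      have "1 * ennreal (exp (- 2)) \<le> ennreal (s ^ (CARD('n) + d)) * ?w s" if "1 < s" "s \<le> 2"
        using that by (intro mult_mono) (auto intro!: ennreal_leI one_le_power simp: ennreal_1[symmetric] simp del: ennreal_1)
      then show "ennreal (exp (- 2)) * indicator {1<..2} s \<le> ?w s * ennreal (s ^ (CARD('n) + d)) * indicator {0<..} s"
        by (auto simp: indicator_def mult.commute)
    qed
    finally show ?thesis by simp
  qed
  \<comment> \<open>Measurability is read off from the layer formula, since the layered function of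
    a compact set is Borel.\<close>
  have meas[measurable]: "(\<lambda>y. exp (z \<bullet> y - h y)) \<in> borel_measurable borel" if z: "z \<in> interior K" for z
  proof -
    have "layers ?w (T z) \<in> borel_measurable borel"
      using Tc[OF z] by (intro borel_measurable_layers) (auto simp: borel_compact)
    then have "(\<lambda>y. enn2real (layers ?w (T z) y)) \<in> borel_measurable borel" by measurable
    moreover have "z \<in> K" using z interior_subset by blast
    ultimately show ?thesis by (simp add: lay)
  qed
  have Phi: "(\<integral>\<^sup>+y. ennreal (exp (z \<bullet> y - h y)) \<partial>lborel) = J 0 * ennreal (vol (T z))" if z: "z \<in> interior K" for z
  proof -
    have "(\<integral>\<^sup>+y. ennreal (exp (z \<bullet> y - h y)) \<partial>lborel) = (\<integral>\<^sup>+y. layers ?w (T z) y \<partial>lborel)"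
    proof -
      have "z \<in> K" using z interior_subset by blast
      then show ?thesis by (simp only: lay)
    qed
    also have "\<dots> = J 0 * emeasure lborel (T z)"
      using Tc[OF z] by (subst emeasure_layers) (auto simp: J_def borel_compact)
    finally show ?thesis by (simp add: emeasure_eq_vol[OF Tc[OF z]])
  qed
  have intE: "integrable lborel (\<lambda>y. exp (z \<bullet> y - h y))" if z: "z \<in> interior K" for z
    by (rule integrableI_nonneg) (use meas[OF z] Phi[OF z] J_top[of 0] in \<open>auto simp: ennreal_mult_less_top\<close>)
  have minim: "(\<integral>y. exp (0 \<bullet> y - h y) \<partial>lborel) \<le> (\<integral>y. exp (z \<bullet> y - h y) \<partial>lborel)" if z: "z \<in> interior K" for z
  proof -
    have "vol (T 0) \<le> vol (T z)" unfolding T0 using sp z by (simp add: santalo_position_def T_def)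
    then have "(\<integral>\<^sup>+y. ennreal (exp (0 \<bullet> y - h y)) \<partial>lborel) \<le> (\<integral>\<^sup>+y. ennreal (exp (z \<bullet> y - h y)) \<partial>lborel)"
      unfolding Phi[OF int0] Phi[OF z] by (intro mult_left_mono ennreal_leI) auto
    then have "ennreal (\<integral>y. exp (0 \<bullet> y - h y) \<partial>lborel) \<le> ennreal (\<integral>y. exp (z \<bullet> y - h y) \<partial>lborel)"
      using nn_integral_eq_integral[OF intE[OF int0]] nn_integral_eq_integral[OF intE[OF z]] by simp
    then show ?thesis by simp
  qed
  obtain \<rho> where \<rho>: "0 < \<rho>" "ball 0 \<rho> \<subseteq> K" using int0 by (auto simp: mem_interior)
  then have ballint: "ball 0 \<rho> \<subseteq> interior K" by (intro interior_maximal) auto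
  \<comment> \<open>A third of the radius: the perturbation goes up to \<open>\<delta>\<close> along
    the axis, the error terms of \<open>exp_perturbation\<close> need twice that, and both stay
    inside the ball of radius \<open>\<rho>\<close>.\<close>
  define \<delta> where "\<delta> = \<rho> / 3"
  have wint: "t *\<^sub>R axis i 1 \<in> interior K" if "\<bar>t\<bar> \<le> 2 * \<delta>" for t
    using that \<rho>(1) by (intro subsetD[OF ballint]) (simp add: \<delta>_def norm_axis_1)
  have ax: "axis i 1 \<bullet> y = y $ i" for y :: "real ^ 'n" by (simp add: inner_axis')
  have E0: "integrable lborel (\<lambda>y. exp (- h y))" using intE[OF int0] by simp
  have E2: "integrable lborel (\<lambda>y. exp (t * y $ i) * exp (- h y))" if "\<bar>t\<bar> \<le> 2 * \<delta>" for t
    using intE[OF wint[OF that]] by (simp add: ax exp_add[symmetric])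
  have \<delta>0: "0 < \<delta>" using \<rho> by (simp add: \<delta>_def)
  define C where "C = (\<integral>y. 4 * (exp (2 * \<delta> * y $ i) + exp (- 2 * \<delta> * y $ i)) * exp (- h y) \<partial>lborel)"
  have EC: "integrable lborel (\<lambda>y. 4 * (exp (2 * \<delta> * y $ i) + exp (- 2 * \<delta> * y $ i)) * exp (- h y))"
    using E2[of "2 * \<delta>"] E2[of "- 2 * \<delta>"] \<delta>0 by (simp add: distrib_left distrib_right mult.assoc)
  have hm: "(\<lambda>y. exp (- h y)) \<in> borel_measurable borel" using E0 by auto
  have E1: "integrable lborel (\<lambda>y. y $ i * exp (- h y))"
  proof (rule Bochner_Integration.integrable_bound)
    show "integrable lborel (\<lambda>y. (1 / \<delta>) * (4 * (exp (2 * \<delta> * y $ i) + exp (- 2 * \<delta> * y $ i)) * exp (- h y)))"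
      using EC by (rule integrable_mult_right)
    show "(\<lambda>y. y $ i * exp (- h y)) \<in> borel_measurable lborel" using hm by measurable
    show "AE y in lborel. norm (y $ i * exp (- h y)) \<le> norm ((1 / \<delta>) * (4 * (exp (2 * \<delta> * y $ i) + exp (- 2 * \<delta> * y $ i)) * exp (- h y)))"
    proof (rule AE_I2)
      fix y :: "real ^ 'n"
      have "\<delta> * \<bar>y $ i\<bar> = \<bar>\<delta> * y $ i\<bar>" using \<delta>0 by (simp add: abs_mult)
      also have "\<dots> \<le> exp (2 * \<bar>\<delta> * y $ i\<bar>)" using exp_ge_add_one_self[of "2 * \<bar>\<delta> * y $ i\<bar>"] abs_ge_zero[of "\<delta> * y $ i"] by linarith
      also have "\<dots> \<le> exp (2 * \<delta> * y $ i) + exp (- 2 * \<delta> * y $ i)" by (simp add: abs_if mult.assoc)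
      also have "\<dots> \<le> 4 * (exp (2 * \<delta> * y $ i) + exp (- 2 * \<delta> * y $ i))" by simp
      finally have "\<bar>y $ i\<bar> \<le> (1 / \<delta>) * (4 * (exp (2 * \<delta> * y $ i) + exp (- 2 * \<delta> * y $ i)))" using \<delta>0 by (simp add: field_simps)
      then have "\<bar>y $ i\<bar> * exp (- h y) \<le> (1 / \<delta>) * (4 * (exp (2 * \<delta> * y $ i) + exp (- 2 * \<delta> * y $ i))) * exp (- h y)" by (rule mult_right_mono) simp
      then show "norm (y $ i * exp (- h y)) \<le> norm ((1 / \<delta>) * (4 * (exp (2 * \<delta> * y $ i) + exp (- 2 * \<delta> * y $ i)) * exp (- h y)))"
        using \<delta>0 by (simp add: abs_mult mult.assoc)
    qed
  qed
  define m where "m = (\<integral>y. y $ i * exp (- h y) \<partial>lborel)"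
  \<comment> \<open>Minimality compared with the point \<open>e * \<sigma> * \<delta>\<close> on the
    axis, divided by \<open>e\<close>. Letting \<open>e\<close> tend to 0 for both signs
    \<open>\<sigma>\<close> forces the first moment \<open>m\<close> to vanish.\<close>
  have main: "0 \<le> \<sigma> * \<delta> * m + e * C" if e: "0 < e" "e \<le> 1" and \<sigma>: "\<sigma> = 1 \<or> \<sigma> = -1" for e \<sigma> :: real
  proof -
    have t: "\<bar>e * \<sigma> * \<delta>\<bar> \<le> 2 * \<delta>" using e \<sigma> \<delta>0 by (auto simp: abs_mult intro: order_trans[of _ \<delta>])
    have "(\<integral>y. exp (- h y) \<partial>lborel) \<le> (\<integral>y. exp ((e * \<sigma> * \<delta>) * y $ i) * exp (- h y) \<partial>lborel)"
      using minim[OF wint[OF t]] by (simp add: ax exp_add[symmetric])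
    also have "\<dots> \<le> (\<integral>y. exp (- h y) + (e * \<sigma> * \<delta>) * (y $ i * exp (- h y)) + e\<^sup>2 * (4 * (exp (2 * \<delta> * y $ i) + exp (- 2 * \<delta> * y $ i)) * exp (- h y)) \<partial>lborel)"
    proof (rule integral_mono[OF E2[OF t]])
      show "integrable lborel (\<lambda>y. exp (- h y) + (e * \<sigma> * \<delta>) * (y $ i * exp (- h y)) + e\<^sup>2 * (4 * (exp (2 * \<delta> * y $ i) + exp (- 2 * \<delta> * y $ i)) * exp (- h y)))"
        by (intro Bochner_Integration.integrable_add integrable_mult_right E0 E1 EC)
      fix y :: "real ^ 'n"
      have "exp ((e * \<sigma> * \<delta>) * y $ i) \<le> 1 + (e * \<sigma> * \<delta>) * y $ i + e\<^sup>2 * (4 * (exp (2 * \<delta> * y $ i) + exp (- 2 * \<delta> * y $ i)))"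
        using exp_perturbation[OF e, of "\<sigma> * \<delta> * y $ i"] \<sigma> by (auto simp: mult.assoc add.commute)
      then have "exp ((e * \<sigma> * \<delta>) * y $ i) * exp (- h y) \<le> (1 + (e * \<sigma> * \<delta>) * y $ i + e\<^sup>2 * (4 * (exp (2 * \<delta> * y $ i) + exp (- 2 * \<delta> * y $ i)))) * exp (- h y)"
        by (rule mult_right_mono) simp
      then show "exp ((e * \<sigma> * \<delta>) * y $ i) * exp (- h y) \<le> exp (- h y) + (e * \<sigma> * \<delta>) * (y $ i * exp (- h y)) + e\<^sup>2 * (4 * (exp (2 * \<delta> * y $ i) + exp (- 2 * \<delta> * y $ i)) * exp (- h y))"
        by (simp only: distrib_right mult_1 mult.assoc)
    qed
    also have "\<dots> = (\<integral>y. exp (- h y) \<partial>lborel) + (e * \<sigma> * \<delta>) * m + e\<^sup>2 * C"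
      unfolding m_def C_def
      by (simp only: Bochner_Integration.integral_add Bochner_Integration.integrable_add integrable_mult_right E0 E1 EC integral_mult_right_zero)
    finally have "0 \<le> e * (\<sigma> * \<delta> * m + e * C)" by (simp add: power2_eq_square algebra_simps)
    then show ?thesis using e by (simp add: zero_le_mult_iff)
  qed
  have sgn: "0 \<le> \<sigma> * \<delta> * m" if \<sigma>: "\<sigma> = 1 \<or> \<sigma> = -1" for \<sigma> :: real
  proof (rule tendsto_lowerbound)
    have "((\<lambda>e. \<sigma> * \<delta> * m + e * C) \<longlongrightarrow> \<sigma> * \<delta> * m + 0 * C) (at_right 0)" by (intro tendsto_intros)
    then show "((\<lambda>e. \<sigma> * \<delta> * m + e * C) \<longlongrightarrow> \<sigma> * \<delta> * m) (at_right 0)" by simp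
    show "\<forall>\<^sub>F e in at_right 0. 0 \<le> \<sigma> * \<delta> * m + e * C"
      unfolding eventually_at_right_field using main[OF _ _ \<sigma>] by (intro exI[of _ 1]) auto
  qed simp
  have "m = 0" using sgn[of 1] sgn[of "-1"] \<delta>0 by (simp add: mult_le_0_iff zero_le_mult_iff)
  note nn = integral_zero_nn_integral[OF E1 \<open>m = 0\<close>[unfolded m_def]]
  \<comment> \<open>In degree 1 the layer formula turns first moments of \<open>exp (- h y)\<close>
    into first moments of the polar body.\<close>
  have mom: "(\<integral>\<^sup>+y. ennreal (d * (y $ i * exp (- h y))) \<partial>lborel) = J 1 * (\<integral>\<^sup>+y. ennreal (d * y $ i) * indicator (polar_body K) y \<partial>lborel)" for d
  proof -
    have "0 \<in> K" using int0 interior_subset by blast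
    have "(\<integral>\<^sup>+y. ennreal (d * (y $ i * exp (- h y))) \<partial>lborel) = (\<integral>\<^sup>+y. ennreal (d * y $ i) * layers ?w (T 0) y \<partial>lborel)"
      unfolding lay[OF \<open>0 \<in> K\<close>] by (simp add: ennreal_mult''[symmetric] mult.assoc)
    also have "\<dots> = J 1 * (\<integral>\<^sup>+y. ennreal (d * y $ i) * indicator (T 0) y \<partial>lborel)"
      unfolding J_def using Tc[OF int0]
      by (subst nn_integral_layers[where d=1]) (auto simp: borel_compact ennreal_mult'[symmetric] mult_ac)
    finally show ?thesis unfolding T0 .
  qed
  have "J 1 * (\<integral>\<^sup>+y. ennreal (y $ i) * indicator (polar_body K) y \<partial>lborel) = J 1 * (\<integral>\<^sup>+y. ennreal (- y $ i) * indicator (polar_body K) y \<partial>lborel)"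
    using mom[of 1] mom[of "-1"] nn(1) by simp
  then show "(\<integral>\<^sup>+y. ennreal (y $ i) * indicator (polar_body K) y \<partial>lborel) = (\<integral>\<^sup>+y. ennreal (- y $ i) * indicator (polar_body K) y \<partial>lborel)"
    using J_pos[of 1] less_imp_neq[OF J_top[of 1]] unfolding ennreal_mult_cancel_left by blast
  show "(\<integral>\<^sup>+y. ennreal (y $ i) * indicator (polar_body K) y \<partial>lborel) < top"
    using mom[of 1] nn(2) J_pos[of 1] by (auto simp: ennreal_mult_less_top)
qed

lemma integral_zero_balanced:
  fixes K :: "(real ^ 'n) set"
  assumes K: "compact K" and zero: "integral K (\<lambda>x. x) = 0"
  shows "(\<integral>\<^sup>+x. ennreal (x $ i) * indicator K x \<partial>lborel) = (\<integral>\<^sup>+x. ennreal (- x $ i) * indicator K x \<partial>lborel)"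
    and "(\<integral>\<^sup>+x. ennreal (x $ i) * indicator K x \<partial>lborel) < top"
proof -
  have int: "integrable lborel (\<lambda>x. indicator K x *\<^sub>R (x $ i))"
    by (rule borel_integrable_compact[OF K]) (intro continuous_intros)
  then have "(\<integral>x. indicator K x *\<^sub>R (x $ i) \<partial>lborel) = integral K (\<lambda>x. x $ i)"
    using set_borel_integral_eq_integral(2)[of K "\<lambda>x. x $ i"] by (simp add: set_integrable_def set_lebesgue_integral_def)
  also have "\<dots> = integral K (\<lambda>x. x) $ i"
  proof (rule integral_component_eq_cart)
    have "set_integrable lborel K (\<lambda>x. x)"
      unfolding set_integrable_def by (rule borel_integrable_compact[OF K]) (intro continuous_intros)
    then show "(\<lambda>x. x) integrable_on K" by (rule set_borel_integral_eq_integral(1))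
  qed
  finally have "(\<integral>x. indicator K x *\<^sub>R (x $ i) \<partial>lborel) = 0" using zero by simp
  note nn = integral_zero_nn_integral[OF int this]
  have "(\<integral>\<^sup>+x. ennreal (d * (indicator K x *\<^sub>R (x $ i))) \<partial>lborel) = (\<integral>\<^sup>+x. ennreal (d * x $ i) * indicator K x \<partial>lborel)" for d
    by (rule nn_integral_cong) (auto simp: indicator_def)
  from this[of 1] this[of "-1"] nn
  show "(\<integral>\<^sup>+x. ennreal (x $ i) * indicator K x \<partial>lborel) = (\<integral>\<^sup>+x. ennreal (- x $ i) * indicator K x \<partial>lborel)"
    "(\<integral>\<^sup>+x. ennreal (x $ i) * indicator K x \<partial>lborel) < top"
    by simp_all
qed

theorem blaschke_santalo_vol:
  fixes K :: "(real ^ 'n) set"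
  assumes K: "compact K" "K \<noteq> {}" and pos: "santalo_position K \<or> centered K"
  shows "vol K * vol (polar_body K) \<le> (vol (cball (0 :: real ^ 'n) 1))\<^sup>2"
proof (cases "vol K = 0")
  \<comment> \<open>For \<open>vol K = 0\<close> the product vanishes. Excluding this case also
    gives content to \<open>centered\<close>, whose division by the volume would otherwise yield 0
    whatever the integral.\<close>
  case False
  have bK: "bounded K" using K by (simp add: compact_imp_bounded)
  have P: "polar_body K \<in> sets borel" using closed_polar_body[OF bK K(2)] by simp
  have KP: "x \<bullet> y \<le> 1" if "x \<in> K" "y \<in> polar_body K" for x y
    using that unfolding polar_body_eq[OF bK K(2)] by auto
  have "emeasure lborel K * emeasure lborel (polar_body K) \<le> (emeasure lborel (cball (0 :: real ^ 'n) 1))\<^sup>2"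
    using pos
  proof
    assume "santalo_position K"
    \<comment> \<open>The roles are exchanged: in Santalo position it is the polar body that has its
      barycentre at the origin.\<close>
    then have "emeasure lborel (polar_body K) * emeasure lborel K \<le> (emeasure lborel (cball (0 :: real ^ 'n) 1))\<^sup>2"
    proof (intro blaschke_santalo santalo_position_balanced K(1) P)
      show "K \<in> sets borel" using K(1) by (rule borel_compact)
      show "y \<bullet> x \<le> 1" if "y \<in> polar_body K" "x \<in> K" for x y
        using KP[OF that(2,1)] by (simp add: inner_commute)
    qed
    then show ?thesis by (simp add: mult.commute)
  next
    assume "centered K"
    then have "integral K (\<lambda>x. x) = 0" using False by (simp add: centered_def)
    then show ?thesis
      using KP by (intro blaschke_santalo integral_zero_balanced K(1) P borel_compact) blast+
  qed
  also have "\<dots> = ennreal ((vol (cball (0 :: real ^ 'n) 1))\<^sup>2)"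
    by (simp add: emeasure_eq_vol vol_def ennreal_power)
  \<comment> \<open>The product is converted as a whole, because in the centered case the measure of
    the polar is not known beforehand to be finite.\<close>
  finally have "enn2real (emeasure lborel K * emeasure lborel (polar_body K)) \<le> (vol (cball (0 :: real ^ 'n) 1))\<^sup>2"
    by (intro enn2real_leI) auto
  then show ?thesis
    using P K(1) by (simp add: enn2real_mult vol_eq_measure_lborel borel_compact measure_def)
qed simp

section \<open>The bodies Gamma and Pi\<close>

lemma norm_matrix_vector_mult_le:
  fixes x :: "real ^ 'm ^ 'n"
  shows "norm (x *v q) \<le> real CARD('n) * (norm x * norm q)"
proof -
  \<comment> \<open>The dimension factor is crude; the estimate only serves to make suprema finite
    and bodies bounded.\<close>
  have "norm (x *v q) \<le> (\<Sum>i\<in>UNIV. \<bar>(x *v q) $ i\<bar>)" by (rule norm_le_l1_cart)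
  also have "\<dots> \<le> (\<Sum>i\<in>(UNIV :: 'n set). norm x * norm q)"
  proof (rule sum_mono)
    fix i :: 'n
    have "\<bar>(x *v q) $ i\<bar> = \<bar>x $ i \<bullet> q\<bar>" by (simp add: matrix_vector_mult_def inner_vec_def)
    also have "\<dots> \<le> norm (x $ i) * norm q" by (rule Cauchy_Schwarz_ineq2)
    also have "\<dots> \<le> norm x * norm q" by (intro mult_right_mono Finite_Cartesian_Product.norm_nth_le) simp
    finally show "\<bar>(x *v q) $ i\<bar> \<le> norm x * norm q" .
  qed
  finally show ?thesis by simp
qed

lemma inner_vector_matrix_mult: "q \<bullet> (\<xi> v* x) = \<xi> \<bullet> (x *v q)" for x :: "real ^ 'm ^ 'n"
proof -
  have "q \<bullet> (\<xi> v* x) = (\<Sum>j\<in>UNIV. \<Sum>i\<in>UNIV. q $ j * (x $ i $ j * \<xi> $ i))"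
    by (simp add: vector_matrix_mult_def inner_vec_def sum_distrib_left mult_ac)
  also have "\<dots> = (\<Sum>i\<in>UNIV. \<Sum>j\<in>UNIV. q $ j * (x $ i $ j * \<xi> $ i))" by (rule sum.swap)
  also have "\<dots> = \<xi> \<bullet> (x *v q)"
    by (simp add: matrix_vector_mult_def inner_vec_def sum_distrib_left mult_ac)
  finally show ?thesis .
qed

lemma support_fun_vector_matrix_le_iff:
  fixes x :: "real ^ 'm ^ 'n"
  assumes "bounded Q" "Q \<noteq> {}"
  shows "support_fun Q (\<xi> v* x) \<le> c \<longleftrightarrow> (\<forall>q\<in>Q. \<xi> \<bullet> (x *v q) \<le> c)"
  unfolding support_fun_le_iff[OF assms] inner_vector_matrix_mult ..

text \<open>A supremum dominates its terms only once it is known to be bounded above. The uniform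
  bound \<open>M\<close> provides this, and testing a point against its own direction makes the
  intersection of half spaces bounded.\<close>

lemma Gamma_inf_properties:
  fixes Q :: "(real ^ 'm) set" and L :: "(real ^ 'm ^ 'n) set"
  assumes Q: "bounded Q" "Q \<noteq> {}" and L: "bounded L" "L \<noteq> {}"
  shows "compact (Gamma_inf Q L)" "convex (Gamma_inf Q L)" "L \<subseteq> maps_into Q (Gamma_inf Q L)"
proof -
  define H where "H \<xi> = (SUP x\<in>L. support_fun Q (\<xi> v* x))" for \<xi>
  obtain BQ where BQ: "\<forall>q\<in>Q. norm q \<le> BQ" using Q(1) unfolding bounded_iff by blast
  obtain BL where BL: "\<forall>x\<in>L. norm x \<le> BL" using L(1) unfolding bounded_iff by blast
  define M where "M = real CARD('n) * (BL * BQ)"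
  have M: "norm (x *v q) \<le> M" if "x \<in> L" "q \<in> Q" for x q
  proof -
    have "norm (x *v q) \<le> real CARD('n) * (norm x * norm q)" by (rule norm_matrix_vector_mult_le)
    also have "\<dots> \<le> M" unfolding M_def
    proof (intro mult_left_mono mult_mono)
      show "norm x \<le> BL" "norm q \<le> BQ" using that BQ BL by blast+
      then show "0 \<le> BL" using norm_ge_zero[of x] by linarith
    qed simp_all
    finally show ?thesis .
  qed
  have sM: "support_fun Q (\<xi> v* x) \<le> M * norm \<xi>" if "x \<in> L" for \<xi> x
    unfolding support_fun_vector_matrix_le_iff[OF Q]
  proof
    fix q assume "q \<in> Q"
    have "\<xi> \<bullet> (x *v q) \<le> norm \<xi> * norm (x *v q)" by (rule norm_cauchy_schwarz)
    also have "\<dots> \<le> norm \<xi> * M" using M[OF that \<open>q \<in> Q\<close>] by (intro mult_left_mono) auto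
    finally show "\<xi> \<bullet> (x *v q) \<le> M * norm \<xi>" by (simp add: mult.commute)
  qed
  have HM: "H \<xi> \<le> M * norm \<xi>" for \<xi> unfolding H_def using L(2) sM by (intro cSUP_least) auto
  have Hup: "\<xi> \<bullet> (x *v q) \<le> H \<xi>" if "x \<in> L" "q \<in> Q" for \<xi> x q
  proof -
    have "\<xi> \<bullet> (x *v q) \<le> support_fun Q (\<xi> v* x)"
      using support_fun_vector_matrix_le_iff[OF Q] that(2) by blast
    also have "\<dots> \<le> H \<xi>" unfolding H_def using sM that(1) by (intro cSUP_upper bdd_aboveI2[where M="M * norm \<xi>"])
    finally show ?thesis .
  qed
  have eq: "Gamma_inf Q L = (\<Inter>\<xi>. {z. \<xi> \<bullet> z \<le> H \<xi>})"
    by (auto simp: Gamma_inf_def H_def inner_commute)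
  have "norm z \<le> M" if "z \<in> Gamma_inf Q L" for z
  proof (cases "z = 0")
    case True
    obtain x q where "x \<in> L" "q \<in> Q" using L(2) Q(2) by blast
    then have "norm (x *v q) \<le> M" by (rule M)
    then have "0 \<le> M" using norm_ge_zero[of "x *v q"] by linarith
    then show ?thesis using True by simp
  next
    case False
    have "z \<bullet> z \<le> H z" using that unfolding eq by blast
    then have "z \<bullet> z \<le> M * norm z" using HM[of z] by (rule order_trans)
    then have "norm z * norm z \<le> M * norm z" by (simp add: power2_norm_eq_inner[symmetric] power2_eq_square)
    then show ?thesis using False by simp
  qed
  then have "bounded (Gamma_inf Q L)" unfolding bounded_iff by blast
  moreover have "closed (Gamma_inf Q L)" unfolding eq by (intro closed_INT ballI closed_halfspace_le)
  ultimately show "compact (Gamma_inf Q L)" by (simp add: compact_eq_bounded_closed)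
  show "convex (Gamma_inf Q L)" unfolding eq by (intro convex_INT convex_halfspace_le)
  show "L \<subseteq> maps_into Q (Gamma_inf Q L)" unfolding eq maps_into_def by (auto intro: Hup)
qed

text \<open>For one inclusion \<open>x\<close> is tested against the rank-one matrices with entries
  \<open>v $ i * q $ j\<close>: they lie in the body, and their product with \<open>x\<close> is v .
  (x q), which is the norm of x q for \<open>v\<close> in its direction. The other inclusion uses
  only z . x <= H x <= 1. Neither requires \<open>H\<close> to be identified as the support function
  of the body.\<close>

lemma polar_Pi_inf_ball:
  fixes Q :: "(real ^ 'm) set"
  assumes Q: "bounded Q" "Q \<noteq> {}"
  shows "polar_body (Pi_inf_ball Q :: (real ^ 'm ^ 'n) set) = maps_into Q (cball 0 1)"
proof -
  let ?P = "Pi_inf_ball Q :: (real ^ 'm ^ 'n) set"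
  define H where "H x = (SUP v\<in>cball (0 :: real ^ 'n) 1. support_fun Q (v v* x))" for x :: "real ^ 'm ^ 'n"
  obtain BQ where BQ: "\<forall>q\<in>Q. norm q \<le> BQ" using Q(1) unfolding bounded_iff by blast
  obtain q0 where q0: "q0 \<in> Q" using Q(2) by blast
  then have "norm q0 \<le> BQ" using BQ by blast
  then have BQ0: "0 \<le> BQ" using norm_ge_zero[of q0] by linarith
  have le: "v \<bullet> (x *v q) \<le> c" if "v \<in> cball 0 1" "norm (x *v q) \<le> c" for v :: "real ^ 'n" and x :: "real ^ 'm ^ 'n" and q c
  proof -
    have "v \<bullet> (x *v q) \<le> norm v * norm (x *v q)" by (rule norm_cauchy_schwarz)
    also have "\<dots> \<le> norm (x *v q)" using that(1) by (simp add: mult_left_le_one_le)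
    finally show ?thesis using that(2) by simp
  qed
  have sM: "support_fun Q (v v* x) \<le> real CARD('n) * BQ * norm x" if "v \<in> cball 0 1" for v :: "real ^ 'n" and x :: "real ^ 'm ^ 'n"
    unfolding support_fun_vector_matrix_le_iff[OF Q]
  proof
    fix q assume q: "q \<in> Q"
    have "norm (x *v q) \<le> real CARD('n) * (norm x * norm q)" by (rule norm_matrix_vector_mult_le)
    also have "\<dots> \<le> real CARD('n) * (norm x * BQ)" using BQ q by (intro mult_left_mono) auto
    finally show "v \<bullet> (x *v q) \<le> real CARD('n) * BQ * norm x" by (intro le that) (simp add: mult_ac)
  qed
  have HM: "H x \<le> real CARD('n) * BQ * norm x" for x unfolding H_def using sM by (intro cSUP_least) auto
  have Hup: "v \<bullet> (x *v q) \<le> H x" if "v \<in> cball 0 1" "q \<in> Q" for v x q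
  proof -
    have "v \<bullet> (x *v q) \<le> support_fun Q (v v* x)"
      using support_fun_vector_matrix_le_iff[OF Q] that(2) by blast
    also have "\<dots> \<le> H x" unfolding H_def using sM that(1) by (intro cSUP_upper bdd_aboveI2[where M="real CARD('n) * BQ * norm x"])
    finally show ?thesis .
  qed
  have P: "?P = {z. \<forall>x. z \<bullet> x \<le> H x}" by (simp add: Pi_inf_ball_def H_def)
  have "norm z \<le> real CARD('n) * BQ" if "z \<in> ?P" for z
  proof (cases "z = 0")
    case False
    have "z \<bullet> z \<le> H z" using that unfolding P by blast
    then have "z \<bullet> z \<le> real CARD('n) * BQ * norm z" using HM[of z] by (rule order_trans)
    then have "norm z * norm z \<le> real CARD('n) * BQ * norm z" by (simp add: power2_norm_eq_inner[symmetric] power2_eq_square)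
    then show ?thesis using False by simp
  qed (use BQ0 in simp)
  then have bP: "bounded ?P" unfolding bounded_iff by blast
  have "0 \<in> ?P" unfolding P using Hup[OF _ q0, of 0] by simp
  then have nP: "?P \<noteq> {}" by blast
  show ?thesis
    unfolding polar_body_eq[OF bP nP]
  proof (intro equalityI subsetI)
    fix x :: "real ^ 'm ^ 'n" assume x: "x \<in> {x. \<forall>z\<in>?P. z \<bullet> x \<le> 1}"
    have "norm (x *v q) \<le> 1" if q: "q \<in> Q" for q
    proof (cases "x *v q = 0")
      case False
      define v where "v = (x *v q) /\<^sub>R norm (x *v q)"
      have v: "v \<in> cball 0 1" using False by (simp add: v_def)
      define z :: "real ^ 'm ^ 'n" where "z = (\<chi> i j. v $ i * q $ j)"
      have z: "z \<bullet> y = v \<bullet> (y *v q)" for y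
        by (simp add: z_def inner_vec_def matrix_vector_mult_def sum_distrib_left mult_ac)
      have "z \<in> ?P" unfolding P using Hup[OF v q] by (simp add: z)
      then have "v \<bullet> (x *v q) \<le> 1" using x z[of x] by auto
      then show ?thesis
        using False by (simp add: v_def power2_norm_eq_inner[symmetric] power2_eq_square mult.assoc[symmetric])
    qed simp
    then show "x \<in> maps_into Q (cball 0 1)" by (simp add: maps_into_def)
  next
    fix x :: "real ^ 'm ^ 'n" assume x: "x \<in> maps_into Q (cball 0 1)"
    have "H x \<le> 1" unfolding H_def
    proof (rule cSUP_least)
      fix v :: "real ^ 'n" assume "v \<in> cball 0 1"
      then show "support_fun Q (v v* x) \<le> 1"
        unfolding support_fun_vector_matrix_le_iff[OF Q] using x by (auto simp: maps_into_def intro!: le)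
    qed simp
    then show "x \<in> {x. \<forall>z\<in>?P. z \<bullet> x \<le> 1}" unfolding P by (auto intro: order_trans)
  qed
qed

text \<open>\<open>Q\<close> contains a ball of radius \<open>e\<close> around some
  \<open>q\<close>, so \<open>e\<close> times a column of \<open>x\<close> is the difference of two
  vectors of norm at most 1. Finiteness of the volume lets the comparison with the ball be stated in
  real numbers.\<close>

lemma compact_maps_into_cball:
  fixes Q :: "(real ^ 'm) set"
  assumes "interior Q \<noteq> {}"
  shows "compact (maps_into Q (cball 0 1) :: (real ^ 'm ^ 'n) set)"
proof -
  obtain q e where e: "0 < e" "cball q e \<subseteq> Q" using assms by (auto simp: mem_interior_cball ex_in_conv[symmetric])
  have "norm x \<le> sqrt (real CARD('m) * (2 / e)\<^sup>2)" if x: "x \<in> maps_into Q (cball 0 1)" for x :: "real ^ 'm ^ 'n"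
  proof -
    have col: "norm (x *v axis k 1) \<le> 2 / e" for k
    proof -
      have "q + e *\<^sub>R axis k 1 \<in> Q" "q \<in> Q" using e by (auto intro!: subsetD[OF e(2)] simp: dist_norm norm_axis_1)
      then have n: "norm (x *v (q + e *\<^sub>R axis k 1)) \<le> 1" "norm (x *v q) \<le> 1" using x by (auto simp: maps_into_def)
      have "e *\<^sub>R (x *v axis k 1) = x *v (q + e *\<^sub>R axis k 1) - x *v q"
        by (simp add: matrix_vector_right_distrib matrix_vector_mult_scaleR)
      then have "norm (e *\<^sub>R (x *v axis k 1)) \<le> 2"
        using norm_triangle_ineq4[of "x *v (q + e *\<^sub>R axis k 1)" "x *v q"] n by simp
      then show ?thesis using e by (simp add: field_simps)
    qed
    have "(norm x)\<^sup>2 = (\<Sum>k\<in>UNIV. (norm (x *v axis k 1))\<^sup>2)"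
      unfolding power2_norm_eq_inner by (rule inner_matrix_columns)
    also have "\<dots> \<le> (\<Sum>k\<in>(UNIV :: 'm set). (2 / e)\<^sup>2)" by (intro sum_mono power_mono col) simp
    finally show ?thesis by (intro real_le_rsqrt) simp
  qed
  then have "bounded (maps_into Q (cball 0 1) :: (real ^ 'm ^ 'n) set)" unfolding bounded_iff by blast
  then show ?thesis by (simp add: compact_eq_bounded_closed closed_maps_into)
qed

text \<open>The radius \<open>r\<close> only has to be large enough, so that the case
  \<open>vol K = 0\<close> can be treated by letting \<open>r\<close> tend to 0.\<close>

lemma vol_maps_into_le:
  fixes Q :: "(real ^ 'm) set" and K :: "(real ^ 'n) set"
  assumes Q: "interior Q \<noteq> {}" and K: "compact K" "convex K" and L: "L \<subseteq> maps_into Q K" "compact L"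
    and r: "0 < r" "vol K \<le> vol (cball (0 :: real ^ 'n) 1) * r ^ CARD('n)"
  shows "vol L \<le> r ^ (CARD('n) * CARD('m)) * vol (maps_into Q (cball 0 1) :: (real ^ 'm ^ 'n) set)"
proof -
  let ?A = "maps_into Q (cball 0 1) :: (real ^ 'm ^ 'n) set"
  have v1: "vol (cball (0 :: real ^ 'n) 1) = unit_ball_vol (real CARD('n))"
    by (simp add: vol_def content_cball)
  have vr: "vol (cball (0 :: real ^ 'n) r) = unit_ball_vol (real CARD('n)) * r ^ CARD('n)"
    using r(1) by (simp add: vol_def content_cball)
  have "emeasure lborel K \<le> emeasure lborel (cball (0 :: real ^ 'n) r)"
    unfolding emeasure_eq_vol[OF K(1)] emeasure_eq_vol[OF compact_cball] using r(2) by (intro ennreal_leI) (simp add: v1 vr)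
  then have "emeasure lborel (maps_into Q K :: (real ^ 'm ^ 'n) set) \<le> ennreal (r ^ (CARD('n) * CARD('m)) * vol ?A)"
    using emeasure_eq_vol[OF compact_maps_into_cball[OF Q]]
    by (intro emeasure_maps_into_le_ball[OF K r(1)]) (auto simp: vol_def)
  moreover have "emeasure lborel L \<le> emeasure lborel (maps_into Q K :: (real ^ 'm ^ 'n) set)"
    using K(1) by (intro emeasure_mono[OF L(1)]) (simp add: closed_maps_into compact_imp_closed)
  ultimately have "ennreal (vol L) \<le> ennreal (r ^ (CARD('n) * CARD('m)) * vol ?A)"
    unfolding emeasure_eq_vol[OF L(2)] by (rule order_trans[rotated])
  then show ?thesis using r(1) by (simp add: vol_def)
qed

theorem theorem4p8:
  fixes Q :: "(real^'m) set" and L :: "(real^'m^'n) set"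
  assumes "convex_body Q" and "0 \<in> Q"
    and "compact L" and "vol L > 0"
    and "santalo_position (Gamma_inf Q L) \<or> centered (Gamma_inf Q L)"
  shows "vol L powr (1 / real CARD('m)) * vol (polar_body (Gamma_inf Q L))
         \<le> vol (cball (0::real^'n) 1) * vol (polar_body (Pi_inf_ball Q :: (real^'m^'n) set)) powr (1 / real CARD('m))"
proof -
  let ?m = "real CARD('m)"
  define K where "K = Gamma_inf Q L"
  define V where "V = vol K"
  define W where "W = vol (polar_body K)"
  define \<omega> where "\<omega> = vol (cball (0 :: real ^ 'n) 1)"
  define F where "F = vol (maps_into Q (cball 0 1) :: (real ^ 'm ^ 'n) set)"
  have Q: "bounded Q" "Q \<noteq> {}" "interior Q \<noteq> {}"
    using assms(1,2) by (auto simp: convex_body_def compact_imp_bounded)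
  have L: "bounded L" "L \<noteq> {}" using assms(3,4) by (auto simp: compact_imp_bounded vol_def)
  note Kprop = Gamma_inf_properties[OF Q(1,2) L, folded K_def]
  have Kne: "K \<noteq> {}" using Kprop(3) L(2) Q(2) unfolding maps_into_def by blast
  have nn: "0 \<le> V" "0 \<le> W" "0 \<le> F" by (simp_all add: V_def W_def F_def vol_def)
  have \<omega>: "0 < \<omega>" by (simp add: \<omega>_def vol_def content_cball)
  have bound: "vol L \<le> r ^ (CARD('n) * CARD('m)) * F" if "0 < r" "V \<le> \<omega> * r ^ CARD('n)" for r
    unfolding F_def using that unfolding V_def \<omega>_def
    by (intro vol_maps_into_le[OF Q(3) Kprop assms(3)])
  have V: "0 < V"
  proof (rule ccontr)
    assume "\<not> 0 < V"
    then have "V = 0" using nn by simp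
    have "vol L \<le> 0"
    proof (rule tendsto_lowerbound)
      have "((\<lambda>r. r ^ (CARD('n) * CARD('m)) * F) \<longlongrightarrow> 0 ^ (CARD('n) * CARD('m)) * F) (at_right 0)" by (intro tendsto_intros)
      then show "((\<lambda>r. r ^ (CARD('n) * CARD('m)) * F) \<longlongrightarrow> 0) (at_right 0)" by (simp add: power_0_left)
      show "\<forall>\<^sub>F r in at_right 0. vol L \<le> r ^ (CARD('n) * CARD('m)) * F"
        using eventually_at_right_less[of 0] by eventually_elim (rule bound, use \<open>V = 0\<close> \<omega> in auto)
    qed simp
    with assms(4) show False by simp
  qed
  \<comment> \<open>The radius of the ball of volume \<open>V\<close>. The exponent in
    \<open>bound\<close> then gives \<open>(V / \<omega>) ^ CARD('m)\<close>, whose m-th root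
    \<open>V / \<omega>\<close> combines with \<open>W\<close> to the volume product bounded by
    \<open>\<omega>\<^sup>2\<close>.\<close>
  define r where "r = root CARD('n) (V / \<omega>)"
  have r: "0 < r" "r ^ CARD('n) = V / \<omega>"
    using V \<omega> by (auto simp: r_def real_root_gt_zero)
  have "vol L \<le> (V / \<omega>) ^ CARD('m) * F"
    using bound[OF r(1)] \<omega> by (simp add: r(2) power_mult)
  then have "vol L powr (1 / ?m) \<le> ((V / \<omega>) ^ CARD('m) * F) powr (1 / ?m)"
    using assms(4) by (intro powr_mono2) auto
  also have "\<dots> = ((V / \<omega>) ^ CARD('m)) powr (1 / ?m) * F powr (1 / ?m)"
    by (rule powr_mult)
  also have "((V / \<omega>) ^ CARD('m)) powr (1 / ?m) = ((V / \<omega>) powr ?m) powr (1 / ?m)"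
    using V \<omega> by (subst powr_realpow) auto
  also have "\<dots> = V / \<omega>"
    using V \<omega> by (simp add: powr_powr)
  finally have "vol L powr (1 / ?m) * W \<le> V / \<omega> * F powr (1 / ?m) * W"
    using nn by (intro mult_right_mono)
  also have "\<dots> = (V * W) * (F powr (1 / ?m) / \<omega>)" by simp
  also have "\<dots> \<le> \<omega>\<^sup>2 * (F powr (1 / ?m) / \<omega>)"
    using blaschke_santalo_vol[OF Kprop(1) Kne] assms(5) \<omega>
    by (intro mult_right_mono) (auto simp: V_def W_def \<omega>_def K_def)
  also have "\<dots> = \<omega> * F powr (1 / ?m)" using \<omega> by (simp add: power2_eq_square)
  finally show ?thesis
    by (simp add: W_def \<omega>_def F_def K_def polar_Pi_inf_ball[OF Q(1,2)])
qed

end
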